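(* Let $k$ be an algebraically closed field of characteristic $p\ge 0$. Let $C\subseteq\mathbb{P}^n_k$ be a reduced curve with at most ordinary nodes for singularities. Assume $C$ is the complete intersection of hypersurfaces of degrees $d_1,d_2,\dots,d_{n-1}$. If $C$ is left invariant by a vector field $X$ of degree $m$ on $\mathbb{P}^n_k$, and $C$ contains only finitely many singularities of $X$, then $$d_1+\cdots+d_{n-1}\leq m+n,$$ with equality only if $C$ is reducible or $p\mid(d_1\cdots d_{n-1})$.
   Context: Write $S=k[t_0,\dots,t_n]$. A curve in $\mathbb{P}^n_k$ is a closed subscheme of pure dimension 1. Vector fields: for an integer $m\ge 0$, a vector field of degree $m$ on $\mathbb{P}^n_k$ is a map of sheaves $X:\Omega^1_{\mathbb{P}^n_k}\to\mathcal{O}_{\mathbb{P}^n_k}(m-1)$. By the Euler sequence, it is induced by a homogeneous vector field $\sum_{i=0}^n G_i\partial_i$ on $\mathbb{A}^{n+1}_k$, with $G_i\in S$ homogeneous of degree $m$ and $\partial_i=\partial/\partial t_i$; two such homogeneous fields induce the same $X$ if and only if they differ by a multiple $H\sum t_i\partial_i$ of the radial field. A singularity of $X$ is a point where all $2\times2$ minors $t_iG_j-t_jG_i$ vanish. Invariance: a closed subscheme $V\subseteq\mathbb{P}^n_k$ with saturated homogeneous ideal $I\subseteq S$ is left invariant by $X$ if $X|_V$ factors through the natural surjection $\Omega^1_{\mathbb{P}^n_k}|_V\to\Omega^1_V$; equivalently, $\sum G_i\partial_iF\in I$ for every $F\in I$. The condition $p\mid (d_1\cdots d_{n-1})$ never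 holds when $p=0$. *)

theory Defs
  imports
    "HOL-Library.Poly_Mapping"
    "HOL-Library.Extended_Nat"
    "HOL-Library.Cardinality"
    "HOL-Computational_Algebra.Computational_Algebra"
    "HOL-Algebra.Algebra"
    "HOL-Algebra.Algebraic_Closure_Type"
begin

section \<open>The homogeneous coordinate ring\<close>

text \<open>
  The ring \<open>S = k[t\<^sub>0, \<dots>, t\<^sub>n]\<close> is the type \<open>('v, 'a) mpol\<close>, where the variables are indexed by a
  finite type \<open>'v\<close> with \<open>n + 1\<close> elements and \<open>k\<close> is the type \<open>'a\<close>.
\<close>

type_synonym ('v, 'a) mpol = "('v \<Rightarrow>\<^sub>0 nat) \<Rightarrow>\<^sub>0 'a"

abbreviation S_ring :: "('v, 'a::comm_ring_1) mpol ring" where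
  "S_ring \<equiv> ring_of_type_algebra"

definition mconst :: "'a::comm_ring_1 \<Rightarrow> ('v, 'a) mpol" where
  "mconst c = Poly_Mapping.single 0 c"

definition mvar :: "'v \<Rightarrow> ('v, 'a::comm_ring_1) mpol" where
  "mvar i = Poly_Mapping.single (Poly_Mapping.single i 1) 1"

definition mdegree :: "('v::finite \<Rightarrow>\<^sub>0 nat) \<Rightarrow> nat" where
  "mdegree \<alpha> = (\<Sum>i\<in>UNIV. Poly_Mapping.lookup \<alpha> i)"

text \<open>As usual, the zero polynomial is homogeneous of every degree.\<close>

definition homogeneous :: "nat \<Rightarrow> ('v::finite, 'a::comm_ring_1) mpol \<Rightarrow> bool" where
  "homogeneous e F \<longleftrightarrow> (\<forall>\<alpha>\<in>Poly_Mapping.keys F. mdegree \<alpha> = e)"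

definition hom_component :: "nat \<Rightarrow> ('v::finite, 'a::comm_ring_1) mpol \<Rightarrow> ('v, 'a) mpol" where
  "hom_component e F =
     (\<Sum>\<alpha> | \<alpha> \<in> Poly_Mapping.keys F \<and> mdegree \<alpha> = e.
        Poly_Mapping.single \<alpha> (Poly_Mapping.lookup F \<alpha>))"

text \<open>The truncated exponent in \<open>\<alpha> - e\<^sub>i\<close> for \<open>\<alpha>\<^sub>i = 0\<close> is harmless: its coefficient is \<open>0\<close>.\<close>

definition partial :: "'v \<Rightarrow> ('v, 'a::comm_ring_1) mpol \<Rightarrow> ('v, 'a) mpol" where
  "partial i F =
     (\<Sum>\<alpha>\<in>Poly_Mapping.keys F.
        Poly_Mapping.single (\<alpha> - Poly_Mapping.single i 1)
          (of_nat (Poly_Mapping.lookup \<alpha> i) * Poly_Mapping.lookup F \<alpha>))"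

definition homogeneous_ideal :: "('v::finite, 'a::comm_ring_1) mpol set \<Rightarrow> bool" where
  "homogeneous_ideal I \<longleftrightarrow> ideal I S_ring \<and> (\<forall>F\<in>I. \<forall>e. hom_component e F \<in> I)"

text \<open>
  The saturation of \<open>J\<close> with respect to the irrelevant ideal \<open>(t\<^sub>0, \<dots>, t\<^sub>n)\<close>. There are finitely
  many variables, so the exponent may depend on the variable.
\<close>

definition saturation :: "('v::finite, 'a::comm_ring_1) mpol set \<Rightarrow> ('v, 'a) mpol set" where
  "saturation J = {F. \<forall>i. \<exists>N::nat. mvar i ^ N * F \<in> J}"


section \<open>Closed subschemes of projective space\<close>

text \<open>A closed subscheme of \<open>\<P>\<^sup>n\<close> is represented by its saturated homogeneous ideal.\<close>

definition closed_subscheme :: "('v::finite, 'a::comm_ring_1) mpol set \<Rightarrow> bool" where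
  "closed_subscheme I \<longleftrightarrow> homogeneous_ideal I \<and> saturation I = I"

text \<open>The points of the scheme \<open>\<P>\<^sup>n = Proj S\<close>, closed or not.\<close>

definition proj_points :: "('v::finite, 'a::comm_ring_1) mpol set set" where
  "proj_points = {P. primeideal P S_ring \<and> homogeneous_ideal P \<and> (\<exists>i. mvar i \<notin> P)}"

definition zeros :: "('v::finite, 'a::comm_ring_1) mpol set \<Rightarrow> ('v, 'a) mpol set set" where
  "zeros I = {P \<in> proj_points. I \<subseteq> P}"

definition closed_points :: "('v::finite, 'a::comm_ring_1) mpol set \<Rightarrow> ('v, 'a) mpol set set" where
  "closed_points I = {P \<in> zeros I. \<forall>Q\<in>proj_points. P \<subseteq> Q \<longrightarrow> Q = P}"

text \<open>
  Supremum of the lengths of chains in a (nonempty) family of sets. Irreducible closed subsets of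
  \<open>Proj S\<close> correspond, inclusion-reversingly, to their generic points, so this computes both
  dimensions of closed subsets and dimensions of local rings.
\<close>

definition chain_dim :: "'b set set \<Rightarrow> enat" where
  "chain_dim \<A> = Sup {enat r | r. \<exists>c :: nat \<Rightarrow> 'b set.
     (\<forall>i\<le>r. c i \<in> \<A>) \<and> (\<forall>i<r. c i \<subset> c (Suc i))}"

text \<open>The generic points of the irreducible components.\<close>

definition component_points ::
    "('v::finite, 'a::comm_ring_1) mpol set \<Rightarrow> ('v, 'a) mpol set set" where
  "component_points I = {P \<in> zeros I. \<forall>Q\<in>zeros I. Q \<subseteq> P \<longrightarrow> Q = P}"

definition pure_dimension :: "nat \<Rightarrow> ('v::finite, 'a::comm_ring_1) mpol set \<Rightarrow> bool" where
  "pure_dimension e I \<longleftrightarrow>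
     zeros I \<noteq> {} \<and> (\<forall>P\<in>component_points I. chain_dim (zeros P) = enat e)"

definition curve :: "('v::finite, 'a::comm_ring_1) mpol set \<Rightarrow> bool" where
  "curve I \<longleftrightarrow> closed_subscheme I \<and> pure_dimension 1 I"

text \<open>For a saturated ideal, the scheme is reduced precisely if the ideal is radical.\<close>

definition reduced :: "('v::finite, 'a::comm_ring_1) mpol set \<Rightarrow> bool" where
  "reduced I \<longleftrightarrow> (\<forall>F. \<forall>N::nat. F ^ N \<in> I \<longrightarrow> F \<in> I)"

definition irreducible_scheme :: "('v::finite, 'a::comm_ring_1) mpol set \<Rightarrow> bool" where
  "irreducible_scheme I \<longleftrightarrow>
     zeros I \<noteq> {} \<and>
     (\<forall>J J'. homogeneous_ideal J \<and> homogeneous_ideal J' \<and> zeros I = zeros J \<union> zeros J' \<longrightarrow>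
        zeros I = zeros J \<or> zeros I = zeros J')"

definition hypersurface_form :: "nat \<Rightarrow> ('v::finite, 'a::comm_ring_1) mpol \<Rightarrow> bool" where
  "hypersurface_form e F \<longleftrightarrow> 0 < e \<and> F \<noteq> 0 \<and> homogeneous e F"

text \<open>
  The scheme-theoretic intersection of the hypersurfaces \<open>F\<^sub>j = 0\<close>, for \<open>j \<in> K\<close>, of codimension
  equal to their number.
\<close>

definition complete_intersection ::
    "nat set \<Rightarrow> (nat \<Rightarrow> nat) \<Rightarrow> ('v::finite, 'a::comm_ring_1) mpol set \<Rightarrow> bool" where
  "complete_intersection K d I \<longleftrightarrow>
     finite K \<and>
     (\<exists>e. e + card K + 1 = CARD('v) \<and> pure_dimension e I) \<and>
     (\<exists>F. (\<forall>j\<in>K. hypersurface_form (d j) (F j)) \<and> I = saturation (Idl\<^bsub>S_ring\<^esub> (F ` K)))"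


section \<open>Local structure at closed points\<close>

text \<open>
  Let \<open>C\<close> be the closed subscheme with ideal \<open>I\<close>, and \<open>P\<close> a closed point of \<open>C\<close> with \<open>t\<^sub>i \<notin> P\<close>.
  The affine open subscheme \<open>t\<^sub>i \<noteq> 0\<close> of \<open>C\<close> has coordinate ring \<open>S / (I + (t\<^sub>i - 1))\<close>, and \<open>P\<close>
  corresponds to its maximal ideal given by \<open>chart_max i P\<close>. Since that ideal is maximal,
  \<open>jet_ring I i P r\<close> is the quotient of the local ring of \<open>C\<close> at \<open>P\<close> by the \<open>r\<close>-th power of its
  maximal ideal.
\<close>

definition chart_max :: "'v \<Rightarrow> ('v, 'a::comm_ring_1) mpol set \<Rightarrow> ('v, 'a) mpol set" where
  "chart_max i P = Idl\<^bsub>S_ring\<^esub> (P \<union> {mvar i - 1})"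

definition jet_ideal ::
    "('v, 'a::comm_ring_1) mpol set \<Rightarrow> 'v \<Rightarrow> ('v, 'a) mpol set \<Rightarrow> nat \<Rightarrow> ('v, 'a) mpol set" where
  "jet_ideal I i P r =
     Idl\<^bsub>S_ring\<^esub> (I \<union> {mvar i - 1} \<union> chart_max i P [^]\<^bsub>ideals_set S_ring\<^esub> r)"

definition jet_ring ::
    "('v, 'a::comm_ring_1) mpol set \<Rightarrow> 'v \<Rightarrow> ('v, 'a) mpol set \<Rightarrow> nat \<Rightarrow> ('v, 'a) mpol set ring" where
  "jet_ring I i P r = S_ring Quot jet_ideal I i P r"

definition jet ::
    "('v, 'a::comm_ring_1) mpol set \<Rightarrow> 'v \<Rightarrow> ('v, 'a) mpol set \<Rightarrow> nat \<Rightarrow> ('v, 'a) mpol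
       \<Rightarrow> ('v, 'a) mpol set" where
  "jet I i P r F = jet_ideal I i P r +>\<^bsub>S_ring\<^esub> F"

text \<open>
  The local ring at \<open>P\<close> is regular if the dimension over \<open>k\<close> of \<open>\<mm>/\<mm>\<^sup>2\<close>, here the image of \<open>\<mm>\<close> in
  the jet ring of order \<open>2\<close>, is the Krull dimension of the local ring.
\<close>

definition regular_at ::
    "('v::finite, 'a::field) mpol set \<Rightarrow> 'v \<Rightarrow> ('v, 'a) mpol set \<Rightarrow> bool" where
  "regular_at I i P \<longleftrightarrow>
     (\<exists>e. chain_dim {Q \<in> zeros I. Q \<subseteq> P} = enat e \<and>
          ring.dimension (jet_ring I i P 2) e
            (jet I i P 2 ` range mconst) (jet I i P 2 ` chart_max i P))"

text \<open>
  The completed local ring, as the inverse limit of the jet rings. The transition maps send a coset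
  to the coset containing it.
\<close>

definition completed_local_ring ::
    "('v, 'a::comm_ring_1) mpol set \<Rightarrow> 'v \<Rightarrow> ('v, 'a) mpol set \<Rightarrow> (nat \<Rightarrow> ('v, 'a) mpol set) ring"
  where
  "completed_local_ring I i P =
     \<lparr>carrier = {f. \<forall>r. f r \<in> carrier (jet_ring I i P r) \<and> f (Suc r) \<subseteq> f r},
      monoid.mult = (\<lambda>f g r. f r \<otimes>\<^bsub>jet_ring I i P r\<^esub> g r),
      one = (\<lambda>r. \<one>\<^bsub>jet_ring I i P r\<^esub>),
      ring.zero = (\<lambda>r. \<zero>\<^bsub>jet_ring I i P r\<^esub>),
      add = (\<lambda>f g r. f r \<oplus>\<^bsub>jet_ring I i P r\<^esub> g r)\<rparr>"

text \<open>The ideal \<open>(u v)\<close> of \<open>k[[u, v]]\<close>, realised as \<open>k[[u]][[v]]\<close>.\<close>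

definition node_ideal :: "'a::field fps fps set" where
  "node_ideal = PIdl\<^bsub>ring_of_type_algebra\<^esub> (fps_const fps_X * fps_X)"

text \<open>An ordinary node: the completed local ring is isomorphic to \<open>k[[u, v]]/(u v)\<close> over \<open>k\<close>.\<close>

definition ordinary_node_at ::
    "('v, 'a::field) mpol set \<Rightarrow> 'v \<Rightarrow> ('v, 'a) mpol set \<Rightarrow> bool" where
  "ordinary_node_at I i P \<longleftrightarrow>
     (\<exists>\<phi> \<in> ring_iso (completed_local_ring I i P) (ring_of_type_algebra Quot node_ideal).
        \<forall>c. \<phi> (\<lambda>r. jet I i P r (mconst c)) =
             node_ideal +>\<^bsub>ring_of_type_algebra\<^esub> fps_const (fps_const c))"

text \<open>Neither condition depends on the chart containing \<open>P\<close>.\<close>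

definition at_most_ordinary_nodes :: "('v::finite, 'a::field) mpol set \<Rightarrow> bool" where
  "at_most_ordinary_nodes I \<longleftrightarrow>
     (\<forall>P\<in>closed_points I. \<forall>i. mvar i \<notin> P \<longrightarrow> regular_at I i P \<or> ordinary_node_at I i P)"


section \<open>Vector fields\<close>

text \<open>
  A vector field of degree \<open>m\<close> on \<open>\<P>\<^sup>n\<close> is represented by the coefficients of a homogeneous vector
  field inducing it. Adding a multiple of the radial field changes neither the singularities nor
  the homogeneous ideals left invariant.
\<close>

definition vector_field ::
    "nat \<Rightarrow> ('v::finite \<Rightarrow> ('v, 'a::comm_ring_1) mpol) \<Rightarrow> bool" where
  "vector_field m G \<longleftrightarrow> (\<forall>i. homogeneous m (G i))"

definition apply_field ::
    "('v::finite \<Rightarrow> ('v, 'a::comm_ring_1) mpol) \<Rightarrow> ('v, 'a) mpol \<Rightarrow> ('v, 'a) mpol" where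
  "apply_field G F = (\<Sum>i\<in>UNIV. G i * partial i F)"

definition left_invariant ::
    "('v::finite, 'a::comm_ring_1) mpol set \<Rightarrow> ('v \<Rightarrow> ('v, 'a) mpol) \<Rightarrow> bool" where
  "left_invariant I G \<longleftrightarrow> (\<forall>F\<in>I. apply_field G F \<in> I)"

definition singularities ::
    "('v::finite \<Rightarrow> ('v, 'a::comm_ring_1) mpol) \<Rightarrow> ('v, 'a) mpol set set" where
  "singularities G = {P \<in> proj_points. \<forall>i j. mvar i * G j - mvar j * G i \<in> P}"

end

theory Submission
  imports Defs "HOL-Analysis.Determinants" "HOL-Library.Function_Algebras"
begin

text \<open>
  The curve carries two bivectors: the minors \<open>t\<^sub>l G\<^sub>k - t\<^sub>k G\<^sub>l\<close> of the vector field, of degree \<open>m + 1\<close>,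
  and the Jacobian minors \<open>J\<^sub>k\<^sub>l\<close> of its equations \<open>F\<^sub>j\<close>, of degree \<open>\<Sum>j. d\<^sub>j - 1\<close>. Both annihilate the
  differentials of the \<open>F\<^sub>j\<close> along the curve, hence they are proportional. At a smooth point some
  \<open>J\<^sub>k\<^sub>l\<close> is a unit. At a node the \<open>J\<^sub>k\<^sub>l\<close> generate the maximal ideal of the local ring, and the
  vector field vanishes. So the first bivector lies in the ideal of the \<open>J\<^sub>k\<^sub>l\<close> everywhere, and on a
  component of the curve it is a nonzero section of \<open>\<O>(m + 1 - (\<Sum>j. d\<^sub>j - 1))\<close> times the second one.
  Such a section exists only for a nonnegative degree, and it is a constant if the degree is \<open>0\<close>.

  In the latter case let the curve be irreducible and contract both bivectors with linear forms \<open>x\<close>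
  and \<open>y\<close> such that the \<open>F\<^sub>j\<close>, \<open>x\<close> and \<open>y\<close> have no common zero. The first one becomes a member of the
  ideal \<open>(x, y)\<close>, the second one the Jacobian determinant of the \<open>F\<^sub>j\<close>, \<open>x\<close> and \<open>y\<close>. If no degree is
  divisible by the characteristic, then the determinant is not in the ideal \<open>(F\<^sub>j, x, y)\<close>, by Euler's
  formula and Wiebe's theorem.
\<close>

text \<open>The bound \<open>m + n\<close> is \<open>m + 1\<close> plus one for each of the
  \<open>n - 1\<close> equations, since a partial derivative lowers the degree by one. The equations
  are indexed by the variables with two slots \<open>p\<close> and \<open>q\<close> left free, so
  that the Jacobian minors become square determinants in which the slots receive two further
  differentials. At a node the vector field vanishes because a derivation \<open>D\<close> of
  \<open>k[[u, v]]/(u v)\<close> satisfies \<open>D(u) v + D(v) u = 0\<close>, which forces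
  \<open>D(u)\<close> and \<open>D(v)\<close> into the maximal ideal. To pass from closed points to
  the whole curve, the polynomials that multiply the first bivector into the ideal of the second are
  collected in an ideal; it has no zeros, hence contains powers of all variables. So the ratio of
  the bivectors acts on forms of one large degree, a finite-dimensional space, and algebraic
  closedness makes it a scalar. Euler's formula recovers a form from its derivatives only up to its
  degree as a factor. This is where the divisibility by the characteristic enters.\<close>

no_notation fps_nth (infixl \<open>$\<close> 75)

section \<open>Ideals\<close>

text \<open>With the ring as a module over itself the submodules are the ideals, so the theory of
  spans supplies generated ideals, their sums and induction over generators.\<close>

global_interpretation rmod: Modules.module "(*) :: 'a::comm_ring_1 \<Rightarrow> 'a \<Rightarrow> 'a"
  by standard (auto simp: algebra_simps)

text \<open>As a rewrite rule this loops with associativity of multiplication.\<close>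
declare rmod.scale_scale [simp del]

definition is_prime :: "'a::comm_ring_1 set \<Rightarrow> bool" where
  "is_prime P \<longleftrightarrow> rmod.subspace P \<and> 1 \<notin> P \<and> (\<forall>a b. a * b \<in> P \<longrightarrow> a \<in> P \<or> b \<in> P)"

lemma subspace_of_prime: "is_prime P \<Longrightarrow> rmod.subspace P"
  by (simp add: is_prime_def)

lemma prime_mult_iff: "is_prime P \<Longrightarrow> a * b \<in> P \<longleftrightarrow> a \<in> P \<or> b \<in> P"
  unfolding is_prime_def by (metis mult.commute rmod.subspace_scale)

lemma prime_power_iff: "is_prime P \<Longrightarrow> a ^ k \<in> P \<longleftrightarrow> a \<in> P \<and> k > 0"
  by (induction k) (auto simp: prime_mult_iff, auto simp: is_prime_def)

lemma ring_of_type_algebra_simps: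
  "carrier ring_of_type_algebra = UNIV" "monoid.mult ring_of_type_algebra = (*)"
  "\<one>\<^bsub>ring_of_type_algebra\<^esub> = 1" "\<zero>\<^bsub>ring_of_type_algebra\<^esub> = 0"
  "add ring_of_type_algebra = (+)"
  by (simp_all add: ring_of_type_algebra_def)

lemma ideal_iff_subspace:
  "ideal I (ring_of_type_algebra :: 'a::comm_ring_1 ring) \<longleftrightarrow> rmod.subspace I"
proof
  assume I: "ideal I (ring_of_type_algebra :: 'a ring)"
  interpret ideal I "ring_of_type_algebra :: 'a ring" by (fact I)
  show "rmod.subspace I"
    using additive_subgroup.a_closed[OF additive_subgroup_axioms] I_l_closed
      additive_subgroup.zero_closed[OF additive_subgroup_axioms]
    by (auto simp: rmod.subspace_def ring_of_type_algebra_simps)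
next
  assume I: "rmod.subspace I"
  show "ideal I (ring_of_type_algebra :: 'a ring)"
  proof (rule idealI)
    show "ring (ring_of_type_algebra :: 'a ring)" by (rule ring_from_type_algebra)
    interpret ring "ring_of_type_algebra :: 'a ring" by (rule ring_from_type_algebra)
    show "subgroup I (add_monoid (ring_of_type_algebra :: 'a ring))"
    proof (rule add.subgroupI)
      fix a assume "a \<in> I"
      have "\<ominus>\<^bsub>ring_of_type_algebra\<^esub> a = - a"
        by (rule minus_equality) (auto simp: ring_of_type_algebra_simps)
      with \<open>a \<in> I\<close> I show "\<ominus>\<^bsub>ring_of_type_algebra\<^esub> a \<in> I" by (simp add: rmod.subspace_neg)
    qed (use I in \<open>auto simp: ring_of_type_algebra_simps rmod.subspace_def\<close>)
    show "x \<otimes>\<^bsub>ring_of_type_algebra\<^esub> a \<in> I" if "a \<in> I" for a x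
      using rmod.subspace_scale[OF I that] by (simp add: ring_of_type_algebra_simps)
    show "a \<otimes>\<^bsub>ring_of_type_algebra\<^esub> x \<in> I" if "a \<in> I" for a x
      using rmod.subspace_scale[OF I that, of x] by (simp add: ring_of_type_algebra_simps mult.commute)
  qed
qed

lemma Idl_eq_span: "Idl\<^bsub>ring_of_type_algebra\<^esub> B = rmod.span (B :: 'a::comm_ring_1 set)"
  unfolding genideal_def ideal_iff_subspace rmod.span_def hull_def ..

lemma primeideal_iff:
  "primeideal P (ring_of_type_algebra :: 'a::comm_ring_1 ring) \<longleftrightarrow> is_prime P"
proof
  assume P: "primeideal P (ring_of_type_algebra :: 'a ring)"
  interpret primeideal P "ring_of_type_algebra :: 'a ring" by (fact P)
  have "1 \<notin> P" using I_notcarr one_imp_carrier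
    by (auto simp: ring_of_type_algebra_simps)
  then show "is_prime P"
    using I_prime is_ideal by (auto simp: is_prime_def ring_of_type_algebra_simps ideal_iff_subspace)
next
  assume P: "is_prime P"
  show "primeideal P (ring_of_type_algebra :: 'a ring)"
    by (rule primeidealI)
      (use P in \<open>auto simp: is_prime_def ring_of_type_algebra_simps ideal_iff_subspace
        intro: cring_from_type_algebra\<close>)
qed

text \<open>Krull's argument: an ideal that is maximal among those containing \<open>K\<close> and
  no power of \<open>f\<close> is prime.\<close>

lemma exists_prime_avoiding:
  assumes K: "rmod.subspace (K :: 'a::comm_ring_1 set)" and f: "\<And>N::nat. f ^ N \<notin> K"
  obtains P where "is_prime P" "K \<subseteq> P" "f \<notin> P"
proof -
  define \<F> where "\<F> = {J. rmod.subspace J \<and> K \<subseteq> J \<and> (\<forall>N::nat. f ^ N \<notin> J)}"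
  have "\<exists>M\<in>\<F>. \<forall>B\<in>\<F>. M \<subseteq> B \<longrightarrow> B = M"
  proof (rule subset_Zorn_nonempty)
    have "K \<in> \<F>" unfolding \<F>_def using K f by simp
    then show "\<F> \<noteq> {}" by blast
  next
    fix \<C> assume C: "\<C> \<noteq> {}" "subset.chain \<F> \<C>"
    have ch: "A \<subseteq> B \<or> B \<subseteq> A" if "A \<in> \<C>" "B \<in> \<C>" for A B
      using C(2) that unfolding subset_chain_def by blast
    have sub: "\<C> \<subseteq> \<F>" using C(2) unfolding subset_chain_def by blast
    have sC: "rmod.subspace A" "K \<subseteq> A" "f ^ N \<notin> A" if "A \<in> \<C>" for A N
      using sub that unfolding \<F>_def by blast+
    have "rmod.subspace (\<Union>\<C>)"
    proof (rule rmod.subspaceI)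
      show "0 \<in> \<Union>\<C>" using C(1) rmod.subspace_0[OF sC(1)] by blast
      show "x + y \<in> \<Union>\<C>" if xy: "x \<in> \<Union>\<C>" "y \<in> \<Union>\<C>" for x y
      proof -
        obtain A B where AB: "A \<in> \<C>" "B \<in> \<C>" "x \<in> A" "y \<in> B" using xy by blast
        then obtain D where D: "D \<in> \<C>" "x \<in> D" "y \<in> D" using ch[OF AB(1,2)] by blast
        then show ?thesis using rmod.subspace_add[OF sC(1)[OF D(1)] D(2,3)] by blast
      qed
      show "c * x \<in> \<Union>\<C>" if "x \<in> \<Union>\<C>" for c x
        using that rmod.subspace_scale[OF sC(1)] by blast
    qed
    then show "\<Union>\<C> \<in> \<F>" using C(1) sC(2,3) unfolding \<F>_def by blast
  qed
  then obtain M where M: "M \<in> \<F>" and max: "\<And>B. B \<in> \<F> \<Longrightarrow> M \<subseteq> B \<Longrightarrow> B = M" by blast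
  have sM: "rmod.subspace M" using M by (simp add: \<F>_def)
  \<comment> \<open>By maximality, adjoining an element outside \<open>M\<close> produces a power of
    \<open>f\<close>.\<close>
  have ex: "\<exists>N::nat. \<exists>k. f ^ N - k * a \<in> M" if "a \<notin> M" for a
  proof (rule ccontr)
    assume "\<not> ?thesis"
    then have "f ^ N \<notin> rmod.span (insert a M)" for N :: nat
      unfolding rmod.span_insert rmod.span_eq_iff[THEN iffD2, OF sM] by blast
    moreover have "M \<subseteq> rmod.span (insert a M)" using rmod.span_superset[of "insert a M"] by blast
    moreover have "K \<subseteq> M" using M by (simp add: \<F>_def)
    ultimately have "rmod.span (insert a M) \<in> \<F>" "M \<subseteq> rmod.span (insert a M)"
      unfolding \<F>_def by auto
    from max[OF this] have "a \<in> M" using rmod.span_superset[of "insert a M"] by auto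
    with that show False by simp
  qed
  have "is_prime M"
    unfolding is_prime_def
  proof (intro conjI allI impI sM)
    have "f ^ 0 \<notin> M" using M unfolding \<F>_def by blast
    then show "1 \<notin> M" by simp
    fix a b assume ab: "a * b \<in> M"
    show "a \<in> M \<or> b \<in> M"
    proof (rule ccontr)
      assume "\<not> ?thesis"
      then have nab: "a \<notin> M" "b \<notin> M" by auto
      obtain N k where 1: "f ^ N - k * a \<in> M" using ex[OF nab(1)] by auto
      obtain N' k' where 2: "f ^ N' - k' * b \<in> M" using ex[OF nab(2)] by auto
      \<comment> \<open>The product of the two powers of \<open>f\<close> is a combination of both
        congruences and of \<open>a * b\<close>, so it would lie in \<open>M\<close>.\<close>
      have *: "x * y = x * (y - k' * b) + (k' * b) * (x - k * a) + (k * k') * (a * b)" for x y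
        by (simp add: algebra_simps)
      have "f ^ (N + N') = f ^ N * (f ^ N' - k' * b) + (k' * b) * (f ^ N - k * a) + (k * k') * (a * b)"
        unfolding power_add by (rule *)
      also have "\<dots> \<in> M"
        using rmod.subspace_add[OF sM rmod.subspace_add[OF sM rmod.subspace_scale[OF sM 2]
          rmod.subspace_scale[OF sM 1]] rmod.subspace_scale[OF sM ab]] .
      finally have "f ^ (N + N') \<in> M" .
      moreover have "f ^ (N + N') \<notin> M" using M unfolding \<F>_def by blast
      ultimately show False by blast
    qed
  qed
  moreover have "K \<subseteq> M" using M by (simp add: \<F>_def)
  moreover have "f ^ 1 \<notin> M" using M unfolding \<F>_def by blast
  ultimately show thesis using that by simp
qed

section \<open>Congruences modulo an ideal\<close>

lemma sum_diff_in_ideal: "rmod.subspace K \<Longrightarrow> (\<And>k. k \<in> A \<Longrightarrow> x k - y k \<in> K) \<Longrightarrow> sum x A - sum y A \<in> K"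
  unfolding sum_subtractf[symmetric] by (intro rmod.subspace_sum)

lemma mult_diff_in_ideal:
  assumes K: "rmod.subspace K" and "x - y \<in> K" "x' - y' \<in> K"
  shows "x * x' - y * y' \<in> K"
proof -
  have "x * x' - y * y' = x' * (x - y) + y * (x' - y')" by (simp add: algebra_simps)
  with assms show ?thesis by (auto intro!: rmod.subspace_add rmod.subspace_scale)
qed

lemma prod_diff_in_ideal:
  assumes "rmod.subspace K" and "\<And>k. k \<in> A \<Longrightarrow> x k - y k \<in> K"
  shows "prod x A - prod y A \<in> K"
  using assms(2)
proof (induction A rule: infinite_finite_induct)
  case (insert k A)
  then show ?case by (auto intro!: mult_diff_in_ideal assms(1))
qed (use assms(1) in \<open>auto simp: rmod.subspace_0\<close>)

lemma power_diff_in_ideal: "rmod.subspace K \<Longrightarrow> x - y \<in> K \<Longrightarrow> x ^ k - y ^ k \<in> K"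
  by (induction k) (auto intro: mult_diff_in_ideal rmod.subspace_0)

lemma in_ideal_diff_iff: "rmod.subspace K \<Longrightarrow> x - y \<in> K \<Longrightarrow> x \<in> K \<longleftrightarrow> y \<in> K"
  by (metis rmod.subspace_add rmod.subspace_diff add_diff_cancel_left' diff_add_cancel)

section \<open>Polynomials\<close>

lemma mpol_sum_single: "(\<Sum>\<alpha>\<in>Poly_Mapping.keys F. Poly_Mapping.single \<alpha> (Poly_Mapping.lookup F \<alpha>)) = F"
  by (rule poly_mapping_eqI)
    (simp add: lookup_sum lookup_single when_def in_keys_iff sum.delta if_distrib cong: if_cong)

lemma mpol_induct [case_names single add]:
  assumes "\<And>\<alpha> c. P (Poly_Mapping.single \<alpha> c)" and "\<And>F G. P F \<Longrightarrow> P G \<Longrightarrow> P (F + G)"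
  shows "P (F :: ('v, 'a::comm_ring_1) mpol)"
proof -
  have "P (\<Sum>\<alpha>\<in>A. Poly_Mapping.single \<alpha> (Poly_Mapping.lookup F \<alpha>))" if "finite A" for A
    using that
  proof (induction A rule: finite_induct)
    case empty
    show ?case using assms(1)[of 0 0] by simp
  next
    case (insert \<alpha> A)
    then show ?case using assms by simp
  qed
  from this[of "Poly_Mapping.keys F"] show ?thesis by (simp add: mpol_sum_single)
qed

lemma mconst_add: "mconst (a + b) = mconst a + mconst b"
  by (simp add: mconst_def single_add)
lemma mconst_mult: "mconst (a * b) = mconst a * mconst b"
  by (simp add: mconst_def mult_single)
lemma mconst_0 [simp]: "mconst 0 = 0" and mconst_1 [simp]: "mconst 1 = 1"
  by (simp_all add: mconst_def)
lemma mconst_minus: "mconst (- a) = - mconst a"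
  by (simp add: mconst_def single_uminus)
lemma mconst_power: "mconst (a ^ k) = mconst a ^ k"
  by (induction k) (simp_all add: mconst_mult)
lemma mconst_of_nat: "mconst (of_nat k) = of_nat k"
  by (simp add: mconst_def)
lemma mconst_prod: "mconst (prod f A) = (\<Prod>i\<in>A. mconst (f i))"
  by (induction A rule: infinite_finite_induct) (simp_all add: mconst_mult)
lemma mconst_mult_single: "mconst c * Poly_Mapping.single \<alpha> d = Poly_Mapping.single \<alpha> (c * d)"
  by (simp add: mconst_def mult_single)
lemma mconst_eq_0_iff [simp]: "mconst c = 0 \<longleftrightarrow> c = 0"
  by (metis lookup_single_eq lookup_zero mconst_0 mconst_def)
lemma mconst_unit: "mconst c * mconst (inverse c) = 1" if "(c::'a::field) \<noteq> 0"
  using that by (simp flip: mconst_mult)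

lemma mdegree_add: "mdegree (\<alpha> + \<beta>) = mdegree \<alpha> + mdegree \<beta>"
  by (simp add: mdegree_def lookup_add sum.distrib)
lemma mdegree_0 [simp]: "mdegree 0 = 0" by (simp add: mdegree_def)
lemma mdegree_single [simp]: "mdegree (Poly_Mapping.single i k) = k"
  by (simp add: mdegree_def lookup_single when_def)

lemma lookup_hom_component:
  "Poly_Mapping.lookup (hom_component e F) \<alpha> = (if mdegree \<alpha> = e then Poly_Mapping.lookup F \<alpha> else 0)"
proof -
  have "Poly_Mapping.lookup (hom_component e F) \<alpha> =
    (\<Sum>\<beta> | \<beta> \<in> Poly_Mapping.keys F \<and> mdegree \<beta> = e. if \<beta> = \<alpha> then Poly_Mapping.lookup F \<beta> else 0)"
    unfolding hom_component_def lookup_sum by (rule sum.cong) (auto simp: lookup_single when_def)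
  also have "\<dots> = (if mdegree \<alpha> = e then Poly_Mapping.lookup F \<alpha> else 0)"
    by (subst sum.delta) (auto simp: in_keys_iff)
  finally show ?thesis .
qed

lemma homogeneous_iff:
  "homogeneous e F \<longleftrightarrow> (\<forall>\<alpha>. Poly_Mapping.lookup F \<alpha> \<noteq> 0 \<longrightarrow> mdegree \<alpha> = e)"
  by (auto simp: homogeneous_def in_keys_iff)

lemma homogeneous_0 [simp]: "homogeneous e 0"
  by (simp add: homogeneous_def)
lemma homogeneous_add: "homogeneous e F \<Longrightarrow> homogeneous e G \<Longrightarrow> homogeneous e (F + G)"
  unfolding homogeneous_iff lookup_add by (metis add.right_neutral)
lemma homogeneous_uminus: "homogeneous e F \<Longrightarrow> homogeneous e (- F)"
  by (auto simp: homogeneous_iff)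
lemma homogeneous_diff: "homogeneous e F \<Longrightarrow> homogeneous e G \<Longrightarrow> homogeneous e (F - G)"
  using homogeneous_add[of e F "- G"] homogeneous_uminus by auto
lemma homogeneous_sum: "(\<And>x. x \<in> A \<Longrightarrow> homogeneous e (f x)) \<Longrightarrow> homogeneous e (sum f A)"
  by (induction A rule: infinite_finite_induct) (auto intro: homogeneous_add)
lemma homogeneous_mult: "homogeneous e F \<Longrightarrow> homogeneous f G \<Longrightarrow> homogeneous (e + f) (F * G)"
  unfolding homogeneous_def using keys_mult[of F G] by (fastforce simp: mdegree_add)
lemma homogeneous_1 [simp]: "homogeneous 0 1"
  by (simp add: homogeneous_def)
lemma homogeneous_power: "homogeneous e F \<Longrightarrow> homogeneous (e * k) (F ^ k)"
  by (induction k) (auto intro: homogeneous_mult)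
lemma homogeneous_prod: "(\<And>x. x \<in> A \<Longrightarrow> homogeneous (g x) (f x)) \<Longrightarrow> homogeneous (sum g A) (prod f A)"
  by (induction A rule: infinite_finite_induct) (auto intro: homogeneous_mult)
lemma homogeneous_mconst [simp]: "homogeneous 0 (mconst c)"
  by (auto simp: homogeneous_iff mconst_def lookup_single when_def)
lemma homogeneous_mvar [simp]: "homogeneous 1 (mvar i)"
  by (auto simp: homogeneous_iff mvar_def lookup_single when_def)
lemma homogeneous_single: "homogeneous (mdegree \<alpha>) (Poly_Mapping.single \<alpha> c)"
  by (auto simp: homogeneous_iff lookup_single when_def)
lemma homogeneous_mconst_mult: "homogeneous e F \<Longrightarrow> homogeneous e (mconst c * F)"
  using homogeneous_mult[of 0 "mconst c" e F] by simp

lemma homogeneous_hom_component: "homogeneous e (hom_component e F)"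
  by (simp add: homogeneous_iff lookup_hom_component)
lemma hom_component_homogeneous: "homogeneous f F \<Longrightarrow> hom_component e F = (if e = f then F else 0)"
  by (rule poly_mapping_eqI) (auto simp: homogeneous_iff lookup_hom_component)
lemma hom_component_0 [simp]: "hom_component e 0 = 0"
  by (simp add: hom_component_homogeneous)
lemma hom_component_add: "hom_component e (F + G) = hom_component e F + hom_component e G"
  by (rule poly_mapping_eqI) (auto simp: lookup_hom_component lookup_add)
lemma hom_component_diff: "hom_component e (F - G) = hom_component e F - hom_component e G"
  by (rule poly_mapping_eqI) (auto simp: lookup_hom_component lookup_minus)
lemma hom_component_sum: "hom_component e (sum f A) = (\<Sum>x\<in>A. hom_component e (f x))"
  by (induction A rule: infinite_finite_induct) (auto simp: hom_component_add)

lemma hom_component_sum_self: "(\<Sum>e\<in>mdegree ` Poly_Mapping.keys F. hom_component e F) = F"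
  by (rule poly_mapping_eqI)
    (auto simp: lookup_sum lookup_hom_component sum.delta in_keys_iff cong: if_cong)

lemma hom_component_mult_homogeneous:
  assumes "homogeneous f G"
  shows "hom_component e (F * G) = (if f \<le> e then hom_component (e - f) F * G else 0)"
proof (induction F rule: mpol_induct)
  case (single \<alpha> c)
  show ?case
    using hom_component_homogeneous[OF homogeneous_mult[OF homogeneous_single[of \<alpha> c] assms], of e]
      hom_component_homogeneous[OF homogeneous_single[of \<alpha> c], of "e - f"] by auto
qed (auto simp: hom_component_add distrib_right)

lemma hom_component_mult:
  "hom_component e (F * G) = (\<Sum>i\<le>e. hom_component i F * hom_component (e - i) G)"
proof (induction F rule: mpol_induct)
  case (single \<alpha> c)
  have "(\<Sum>i\<le>e. hom_component i (Poly_Mapping.single \<alpha> c) * hom_component (e - i) G)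
      = (\<Sum>i\<le>e. if i = mdegree \<alpha> then Poly_Mapping.single \<alpha> c * hom_component (e - mdegree \<alpha>) G else 0)"
    by (rule sum.cong) (auto simp: hom_component_homogeneous[OF homogeneous_single])
  also have "\<dots> = hom_component e (Poly_Mapping.single \<alpha> c * G)"
    using hom_component_mult_homogeneous[OF homogeneous_single, of e G \<alpha> c]
    by (auto simp: sum.delta mult.commute)
  finally show ?case ..
qed (auto simp: hom_component_add distrib_right sum.distrib)

lemma single_eq_prod:
  "Poly_Mapping.single \<alpha> c = mconst c * (\<Prod>k\<in>UNIV. mvar k ^ Poly_Mapping.lookup \<alpha> (k::'v::finite))"
proof -
  have p: "mvar k ^ j = Poly_Mapping.single (Poly_Mapping.single k j) (1::'a)" for k :: 'v and j
    by (induction j) (auto simp: mvar_def mult_single simp flip: single_add)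
  have q: "(\<Prod>k\<in>A. Poly_Mapping.single (Poly_Mapping.single k (Poly_Mapping.lookup \<alpha> k)) (1::'a))
      = Poly_Mapping.single (\<Sum>k\<in>A. Poly_Mapping.single k (Poly_Mapping.lookup \<alpha> k)) 1" for A :: "'v set"
    by (induction A rule: infinite_finite_induct) (auto simp: mult_single)
  have "(\<Sum>k\<in>UNIV. Poly_Mapping.single k (Poly_Mapping.lookup \<alpha> k)) = \<alpha>"
    by (rule poly_mapping_eqI) (simp add: lookup_sum lookup_single when_def sum.delta)
  then show ?thesis by (simp add: p q mconst_mult_single)
qed

section \<open>Derivatives\<close>

lemma partial_add: "partial i (F + G) = partial i F + partial i G"
  unfolding partial_def by (rule setsum_keys_plus_distrib) (auto simp: algebra_simps single_add)

lemma partial_single: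
  "partial i (Poly_Mapping.single \<alpha> c)
    = Poly_Mapping.single (\<alpha> - Poly_Mapping.single i 1) (of_nat (Poly_Mapping.lookup \<alpha> i) * c)"
  by (cases "c = 0") (auto simp: partial_def)

lemma lookup_partial:
  "Poly_Mapping.lookup (partial i F) \<beta>
    = of_nat (Suc (Poly_Mapping.lookup \<beta> i)) * Poly_Mapping.lookup F (\<beta> + Poly_Mapping.single i 1)"
proof (induction F rule: mpol_induct)
  case (single \<alpha> c)
  show ?case
  proof (cases "Poly_Mapping.lookup \<alpha> i = 0")
    case True
    then have "\<alpha> \<noteq> \<beta> + Poly_Mapping.single i 1" by (auto simp: lookup_add)
    with True show ?thesis by (simp add: partial_single lookup_single)
  next
    case False
    then have "\<alpha> - Poly_Mapping.single i 1 = \<beta> \<longleftrightarrow> \<alpha> = \<beta> + Poly_Mapping.single i 1"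
      by (auto simp: poly_mapping_eq_iff fun_eq_iff lookup_add lookup_minus lookup_single when_def)
    then show ?thesis by (auto simp: partial_single lookup_single when_def lookup_add)
  qed
qed (auto simp: partial_add lookup_add algebra_simps)

text \<open>The truncated differences of exponents can disagree only if \<alpha> vanishes at
  \<open>i\<close>, and then both coefficients are zero.\<close>

lemma single_pred_add:
  fixes \<alpha> \<beta> :: "'v \<Rightarrow>\<^sub>0 nat"
  shows "Poly_Mapping.single (\<alpha> + \<beta> - Poly_Mapping.single i 1) (of_nat (Poly_Mapping.lookup \<alpha> i) * c)
    = Poly_Mapping.single (\<alpha> - Poly_Mapping.single i 1 + \<beta>) (of_nat (Poly_Mapping.lookup \<alpha> i) * (c::'a::comm_ring_1))"
proof (cases "Poly_Mapping.lookup \<alpha> i = 0")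
  case False
  then have "\<alpha> + \<beta> - Poly_Mapping.single i 1 = \<alpha> - Poly_Mapping.single i 1 + \<beta>"
    by (auto simp: poly_mapping_eq_iff fun_eq_iff lookup_add lookup_minus lookup_single when_def)
  then show ?thesis by simp
qed simp

lemma partial_mult: "partial i (F * G) = F * partial i G + partial i F * G"
proof (induction F rule: mpol_induct)
  case (single \<alpha> c)
  show ?case
  proof (induction G rule: mpol_induct)
    case (single \<beta> d)
    show ?case
      using single_pred_add[of \<alpha> \<beta> i "c * d"] single_pred_add[of \<beta> \<alpha> i "c * d"]
      by (simp add: mult_single partial_single lookup_add algebra_simps single_add)
  qed (simp add: partial_add algebra_simps)
qed (simp add: partial_add algebra_simps)

lemma partial_0 [simp]: "partial i 0 = 0" by (simp add: partial_def)
lemma partial_1 [simp]: "partial i 1 = 0" by (simp add: partial_def)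
lemma partial_mconst [simp]: "partial i (mconst c) = 0"
  by (simp add: mconst_def partial_single)
lemma partial_mvar: "partial i (mvar j) = (if i = j then 1 else 0)"
  by (auto simp: mvar_def partial_single lookup_single when_def)
lemma partial_uminus: "partial i (- F) = - partial i F"
  using partial_add[of i F "- F"] by (simp add: add_eq_0_iff)
lemma partial_diff: "partial i (F - G) = partial i F - partial i G"
  using partial_add[of i F "- G"] by (simp add: partial_uminus)
lemma partial_sum: "partial i (sum f A) = (\<Sum>x\<in>A. partial i (f x))"
  by (induction A rule: infinite_finite_induct) (auto simp: partial_add)

lemma homogeneous_partial: "homogeneous e F \<Longrightarrow> homogeneous (e - 1) (partial i F)"
  unfolding homogeneous_iff lookup_partial
proof (intro allI impI)
  fix \<beta>
  assume F: "\<forall>\<alpha>. Poly_Mapping.lookup F \<alpha> \<noteq> 0 \<longrightarrow> mdegree \<alpha> = e"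
    and "of_nat (Suc (Poly_Mapping.lookup \<beta> i)) * Poly_Mapping.lookup F (\<beta> + Poly_Mapping.single i 1) \<noteq> 0"
  then have "mdegree (\<beta> + Poly_Mapping.single i 1) = e" by (metis mult_zero_right)
  then show "mdegree \<beta> = e - 1" by (simp add: mdegree_add)
qed

lemma euler_single:
  "(\<Sum>i\<in>UNIV. mvar i * partial i (Poly_Mapping.single \<alpha> c))
    = of_nat (mdegree \<alpha>) * Poly_Mapping.single (\<alpha> :: 'v::finite \<Rightarrow>\<^sub>0 nat) (c::'a::comm_ring_1)"
proof -
  have "mvar i * partial i (Poly_Mapping.single \<alpha> c)
      = of_nat (Poly_Mapping.lookup \<alpha> i) * Poly_Mapping.single \<alpha> c" for i
    using single_pred_add[of \<alpha> "Poly_Mapping.single i 1" i c]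
    by (simp add: mvar_def partial_single mult_single add.commute flip: single_of_nat)
  then show ?thesis by (simp add: mdegree_def flip: sum_distrib_right)
qed

lemma euler:
  assumes "homogeneous e F"
  shows "(\<Sum>i\<in>UNIV. mvar i * partial i F) = of_nat e * F"
proof -
  have "(\<Sum>i\<in>UNIV. mvar i * partial i F)
    = (\<Sum>i\<in>UNIV. \<Sum>\<alpha>\<in>Poly_Mapping.keys F. mvar i * partial i (Poly_Mapping.single \<alpha> (Poly_Mapping.lookup F \<alpha>)))"
    by (simp add: mpol_sum_single flip: partial_sum sum_distrib_left)
  also have "\<dots> = (\<Sum>\<alpha>\<in>Poly_Mapping.keys F. of_nat e * Poly_Mapping.single \<alpha> (Poly_Mapping.lookup F \<alpha>))"
    by (subst sum.swap) (use assms in \<open>auto simp: euler_single homogeneous_def intro!: sum.cong\<close>)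
  also have "\<dots> = of_nat e * F"
    by (simp add: mpol_sum_single flip: sum_distrib_left)
  finally show ?thesis .
qed

section \<open>Evaluation\<close>

definition peval :: "('v::finite \<Rightarrow> 'a) \<Rightarrow> ('v, 'a::comm_ring_1) mpol \<Rightarrow> 'a" where
  "peval a F = (\<Sum>\<alpha>\<in>Poly_Mapping.keys F. Poly_Mapping.lookup F \<alpha> * (\<Prod>k\<in>UNIV. a k ^ Poly_Mapping.lookup \<alpha> k))"

lemma peval_add: "peval a (F + G) = peval a F + peval a G"
  unfolding peval_def by (rule setsum_keys_plus_distrib) (auto simp: algebra_simps)
lemma peval_single: "peval a (Poly_Mapping.single \<alpha> c) = c * (\<Prod>k\<in>UNIV. a k ^ Poly_Mapping.lookup \<alpha> k)"
  by (cases "c = 0") (auto simp: peval_def)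
lemma peval_mult: "peval a (F * G) = peval a F * peval a G"
proof (induction F rule: mpol_induct)
  case (single \<alpha> c)
  show ?case
  proof (induction G rule: mpol_induct)
    case (single \<beta> d)
    show ?case
      by (simp add: mult_single peval_single lookup_add power_add prod.distrib mult.assoc mult.left_commute)
  qed (simp add: peval_add distrib_left)
qed (simp add: peval_add distrib_right)
lemma peval_0 [simp]: "peval a 0 = 0" by (simp add: peval_def)
lemma peval_1 [simp]: "peval a 1 = 1" by (simp add: peval_def)
lemma peval_uminus: "peval a (- F) = - peval a F"
  using peval_add[of a F "- F"] by (simp add: add_eq_0_iff)
lemma peval_diff: "peval a (F - G) = peval a F - peval a G"
  using peval_add[of a F "- G"] by (simp add: peval_uminus)
lemma peval_mconst [simp]: "peval a (mconst c) = c"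
  by (simp add: mconst_def peval_single)
lemma peval_mvar [simp]: "peval a (mvar i) = a i"
proof -
  have "(\<Prod>k\<in>UNIV. a k ^ (1 when i = k)) = (\<Prod>k\<in>UNIV. if i = k then a k else 1)"
    by (rule prod.cong) (auto simp: when_def)
  also have "\<dots> = a i" by simp
  finally show ?thesis unfolding mvar_def peval_single lookup_single by simp
qed
lemma peval_sum: "peval a (sum f A) = (\<Sum>x\<in>A. peval a (f x))"
  by (induction A rule: infinite_finite_induct) (auto simp: peval_add)
lemma peval_prod: "peval a (prod f A) = (\<Prod>x\<in>A. peval a (f x))"
  by (induction A rule: infinite_finite_induct) (auto simp: peval_mult)
lemma peval_power: "peval a (F ^ k) = peval a F ^ k"
  by (induction k) (auto simp: peval_mult)
lemma peval_of_nat [simp]: "peval a (of_nat k) = of_nat k"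
  by (simp flip: mconst_of_nat)

lemmas peval_simps = peval_add peval_mult peval_diff peval_uminus peval_sum peval_prod peval_power

lemma mpol_diff_peval_in_ideal:
  assumes K: "rmod.subspace K" and a: "\<And>k. mvar k - mconst (a k) \<in> K"
  shows "F - mconst (peval a F) \<in> K"
proof (induction F rule: mpol_induct)
  case (single \<alpha> c)
  have "(\<Prod>k\<in>UNIV. mvar k ^ Poly_Mapping.lookup \<alpha> k)
      - (\<Prod>k\<in>UNIV. mconst (a k) ^ Poly_Mapping.lookup \<alpha> k) \<in> K"
    by (intro prod_diff_in_ideal power_diff_in_ideal K a)
  then have "mconst c * ((\<Prod>k\<in>UNIV. mvar k ^ Poly_Mapping.lookup \<alpha> k)
      - (\<Prod>k\<in>UNIV. mconst (a k) ^ Poly_Mapping.lookup \<alpha> k)) \<in> K"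
    by (rule rmod.subspace_scale[OF K])
  then show ?case
    unfolding single_eq_prod[of \<alpha>] peval_simps peval_mconst peval_mvar mconst_mult mconst_prod mconst_power right_diff_distrib .
next
  case (add F G)
  from rmod.subspace_add[OF K this] show ?case by (simp add: peval_add mconst_add algebra_simps)
qed

text \<open>All variables are congruent to multiples of one element \<open>t\<close>, which can be
  factored out of every monomial. With a variable for \<open>t\<close> this decides by evaluation
  whether a form belongs to a point.\<close>

lemma homogeneous_diff_peval_in_ideal:
  assumes K: "rmod.subspace K" and a: "\<And>k. mvar k - mconst (a k) * t \<in> K" and F: "homogeneous e F"
  shows "F - mconst (peval a F) * t ^ e \<in> K"
proof -
  have *: "Poly_Mapping.single \<alpha> c - mconst (c * (\<Prod>k\<in>UNIV. a k ^ Poly_Mapping.lookup \<alpha> k)) * t ^ mdegree \<alpha> \<in> K" for \<alpha> c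
  proof -
    have "(\<Prod>k\<in>UNIV. mvar k ^ Poly_Mapping.lookup \<alpha> k)
        - (\<Prod>k\<in>UNIV. (mconst (a k) * t) ^ Poly_Mapping.lookup \<alpha> k) \<in> K"
      by (intro prod_diff_in_ideal power_diff_in_ideal K a)
    then have "mconst c * ((\<Prod>k\<in>UNIV. mvar k ^ Poly_Mapping.lookup \<alpha> k)
        - (\<Prod>k\<in>UNIV. (mconst (a k) * t) ^ Poly_Mapping.lookup \<alpha> k)) \<in> K"
      by (rule rmod.subspace_scale[OF K])
    moreover have "(\<Prod>k\<in>UNIV. (mconst (a k) * t) ^ Poly_Mapping.lookup \<alpha> k)
        = mconst (\<Prod>k\<in>UNIV. a k ^ Poly_Mapping.lookup \<alpha> k) * t ^ mdegree \<alpha>"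
      unfolding mconst_prod mconst_power power_mult_distrib prod.distrib mdegree_def power_sum ..
    ultimately show ?thesis
      unfolding single_eq_prod mconst_mult right_diff_distrib by (simp only: mult.assoc)
  qed
  have "(\<Sum>\<alpha>\<in>Poly_Mapping.keys F. Poly_Mapping.single \<alpha> (Poly_Mapping.lookup F \<alpha>)) -
    (\<Sum>\<alpha>\<in>Poly_Mapping.keys F. mconst (Poly_Mapping.lookup F \<alpha> * (\<Prod>k\<in>UNIV. a k ^ Poly_Mapping.lookup \<alpha> k)) * t ^ mdegree \<alpha>) \<in> K"
    by (intro sum_diff_in_ideal K *)
  moreover have "(\<Sum>\<alpha>\<in>Poly_Mapping.keys F. mconst (Poly_Mapping.lookup F \<alpha> * (\<Prod>k\<in>UNIV. a k ^ Poly_Mapping.lookup \<alpha> k)) * t ^ mdegree \<alpha>)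
     = mconst (peval a F) * t ^ e"
  proof -
    have mc: "mconst (sum f A) = (\<Sum>x\<in>A. mconst (f x))" for f :: "_ \<Rightarrow> 'b" and A
      by (induction A rule: infinite_finite_induct) (auto simp: mconst_add)
    show ?thesis unfolding peval_def mc sum_distrib_right
      by (rule sum.cong) (use F in \<open>auto simp: homogeneous_def\<close>)
  qed
  ultimately show ?thesis by (simp add: mpol_sum_single)
qed

section \<open>Points of projective space\<close>

lemma homogeneous_ideal_iff:
  "homogeneous_ideal K \<longleftrightarrow> rmod.subspace K \<and> (\<forall>F\<in>K. \<forall>e. hom_component e F \<in> K)"
  by (simp add: homogeneous_ideal_def ideal_iff_subspace)

lemma subspace_of_homogeneous: "homogeneous_ideal K \<Longrightarrow> rmod.subspace K"
  by (simp add: homogeneous_ideal_iff)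

lemma hom_component_in: "homogeneous_ideal K \<Longrightarrow> F \<in> K \<Longrightarrow> hom_component e F \<in> K"
  by (simp add: homogeneous_ideal_iff)

lemma in_subspace_of_components:
  "rmod.subspace K \<Longrightarrow> (\<And>e. hom_component e F \<in> K) \<Longrightarrow> F \<in> K"
  using rmod.subspace_sum[of K "mdegree ` Poly_Mapping.keys F" "\<lambda>e. hom_component e F"]
  by (simp add: hom_component_sum_self)

lemma proj_points_iff:
  "P \<in> proj_points \<longleftrightarrow> is_prime P \<and> homogeneous_ideal P \<and> (\<exists>i. mvar i \<notin> P)"
  by (simp add: proj_points_def primeideal_iff)

text \<open>For an ideal \<open>P\<close> this is the largest homogeneous ideal inside
  \<open>P\<close>; it turns prime ideals of the polynomial ring into candidates for points of
  Proj.\<close>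

definition hpart :: "('v::finite, 'a::comm_ring_1) mpol set \<Rightarrow> ('v, 'a) mpol set" where
  "hpart P = {F. \<forall>e. hom_component e F \<in> P}"

lemma hpart_subset: "rmod.subspace P \<Longrightarrow> hpart P \<subseteq> P"
  by (auto simp: hpart_def intro: in_subspace_of_components)

lemma subset_hpart: "homogeneous_ideal K \<Longrightarrow> K \<subseteq> P \<Longrightarrow> K \<subseteq> hpart P"
  by (auto simp: hpart_def homogeneous_ideal_iff)

lemma hpart_homogeneous_ideal: "homogeneous_ideal K \<Longrightarrow> hpart K = K"
  using hpart_subset subset_hpart subspace_of_homogeneous by blast

lemma homogeneous_in_hpart_iff: "rmod.subspace P \<Longrightarrow> homogeneous e F \<Longrightarrow> F \<in> hpart P \<longleftrightarrow> F \<in> P"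
  by (auto simp: hpart_def hom_component_homogeneous rmod.subspace_0 split: if_splits)

lemma homogeneous_ideal_hpart:
  assumes P: "rmod.subspace P"
  shows "homogeneous_ideal (hpart P)"
  unfolding homogeneous_ideal_iff
proof (intro conjI ballI allI)
  show "rmod.subspace (hpart P)"
  proof (rule rmod.subspaceI)
    show "c * x \<in> hpart P" if "x \<in> hpart P" for c x
      using that by (auto simp: hpart_def hom_component_mult intro!: rmod.subspace_sum rmod.subspace_scale P)
  qed (auto simp: hpart_def hom_component_add rmod.subspace_0[OF P] intro: rmod.subspace_add[OF P])
  show "hom_component e F \<in> hpart P" if "F \<in> hpart P" for F e
    using that by (auto simp: hpart_def hom_component_homogeneous[OF homogeneous_hom_component] rmod.subspace_0[OF P])
qed

text \<open>Take the lowest components of both factors outside \<open>P\<close>. In the degree of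
  their product every other term contains a lower component, which lies in \<open>P\<close>. The
  hypothesis concerns forms only, so the lemma also applies to a homogeneous ideal not yet known to
  be prime.\<close>

lemma is_prime_hpart:
  assumes P: "rmod.subspace P" "1 \<notin> P"
    and pr: "\<And>e f F G. homogeneous e F \<Longrightarrow> homogeneous f G \<Longrightarrow> F * G \<in> P \<Longrightarrow> F \<in> P \<or> G \<in> P"
  shows "is_prime (hpart P)"
  unfolding is_prime_def
proof (intro conjI allI impI)
  show "rmod.subspace (hpart P)" using homogeneous_ideal_hpart[OF P(1)] by (rule subspace_of_homogeneous)
  show "1 \<notin> hpart P" using hpart_subset[OF P(1)] P(2) by blast
  fix F G assume FG: "F * G \<in> hpart P"
  show "F \<in> hpart P \<or> G \<in> hpart P"
  proof (rule ccontr)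
    assume "\<not> ?thesis"
    then obtain e0 f0 where "hom_component e0 F \<notin> P" "hom_component f0 G \<notin> P"
      by (auto simp: hpart_def)
    define e where "e = (LEAST e. hom_component e F \<notin> P)"
    define f where "f = (LEAST e. hom_component e G \<notin> P)"
    have e: "hom_component e F \<notin> P" unfolding e_def by (rule LeastI) fact
    have f: "hom_component f G \<notin> P" unfolding f_def by (rule LeastI) fact
    have le: "hom_component i F \<in> P" if "i < e" for i using that not_less_Least unfolding e_def by blast
    have lf: "hom_component i G \<in> P" if "i < f" for i using that not_less_Least unfolding f_def by blast
    have "(\<Sum>i\<in>{..e + f} - {e}. hom_component i F * hom_component (e + f - i) G) \<in> P"
    proof (rule rmod.subspace_sum[OF P(1)])
      fix i assume i: "i \<in> {..e + f} - {e}"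
      show "hom_component i F * hom_component (e + f - i) G \<in> P"
      proof (cases "i < e")
        case True
        from rmod.subspace_scale[OF P(1) le[OF True], of "hom_component (e + f - i) G"]
        show ?thesis by (simp add: mult.commute)
      next
        case False
        with i have "e + f - i < f" by auto
        from rmod.subspace_scale[OF P(1) lf[OF this]] show ?thesis .
      qed
    qed
    moreover have "hom_component (e + f) (F * G) \<in> P" using FG by (auto simp: hpart_def)
    moreover have "hom_component (e + f) (F * G) = hom_component e F * hom_component f G
        + (\<Sum>i\<in>{..e + f} - {e}. hom_component i F * hom_component (e + f - i) G)"
      unfolding hom_component_mult by (subst sum.remove[of _ e]) auto
    ultimately have "hom_component e F * hom_component f G \<in> P"
      using rmod.subspace_diff[OF P(1)] by fastforce
    with pr[OF homogeneous_hom_component homogeneous_hom_component] e f show False by blast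
  qed
qed

lemma in_span_insert_iff: "rmod.subspace K \<Longrightarrow> F \<in> rmod.span (insert x K) \<longleftrightarrow> (\<exists>c. F - c * x \<in> K)"
  by (simp add: rmod.span_insert rmod.span_eq_iff[THEN iffD2])

lemma homogeneous_ideal_span:
  assumes "\<And>b. b \<in> B \<Longrightarrow> \<exists>e. homogeneous e b"
  shows "homogeneous_ideal (rmod.span B)"
  unfolding homogeneous_ideal_iff
proof (intro conjI ballI)
  fix F assume "F \<in> rmod.span B"
  then show "\<forall>e. hom_component e F \<in> rmod.span B"
  proof (induction rule: rmod.span_induct_alt)
    case base
    show ?case by (simp add: rmod.span_zero)
  next
    case (step c x y)
    from assms[OF step(1)] obtain f where f: "homogeneous f x" by blast
    from step show ?case
      by (auto simp: hom_component_add hom_component_mult_homogeneous[OF f]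
          intro: rmod.span_add rmod.span_scale rmod.span_base)
  qed
qed (rule rmod.subspace_span)

lemma homogeneous_ideal_span_insert:
  assumes K: "homogeneous_ideal K" and x: "homogeneous f x"
  shows "homogeneous_ideal (rmod.span (insert x K))"
proof -
  have sK: "rmod.subspace K" by (rule subspace_of_homogeneous[OF K])
  show ?thesis
    unfolding homogeneous_ideal_iff
  proof (intro conjI ballI allI)
    fix F e assume "F \<in> rmod.span (insert x K)"
    then obtain c where "F - c * x \<in> K" by (auto simp: in_span_insert_iff[OF sK])
    from hom_component_in[OF K this, of e]
    have "hom_component e F - (if f \<le> e then hom_component (e - f) c else 0) * x \<in> K"
      by (simp add: hom_component_diff hom_component_mult_homogeneous[OF x] split: if_splits)
    then show "hom_component e F \<in> rmod.span (insert x K)"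
      unfolding in_span_insert_iff[OF sK] by blast
  qed (rule rmod.subspace_span)
qed

section \<open>Existence of points, closed points and generic points\<close>

lemma zerosD:
  assumes "P \<in> zeros K"
  shows "P \<in> proj_points" "K \<subseteq> P" "is_prime P" "homogeneous_ideal P" "rmod.subspace P"
  using assms by (auto simp: zeros_def proj_points_iff intro: subspace_of_prime)

text \<open>Avoiding the product \<open>mvar i * f\<close> also keeps the prime from containing all
  variables, so its homogeneous part is a point.\<close>

lemma exists_zero_avoiding:
  assumes K: "homogeneous_ideal K" and f: "\<And>N::nat. (mvar i * f) ^ N \<notin> K"
  obtains P where "P \<in> zeros K" "mvar i \<notin> P" "f \<notin> P"
proof -
  obtain P where P: "is_prime P" "K \<subseteq> P" "mvar i * f \<notin> P"
    using exists_prime_avoiding[OF subspace_of_homogeneous[OF K] f] by blast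
  note sP = subspace_of_prime[OF P(1)]
  have 1: "is_prime (hpart P)"
    by (rule is_prime_hpart) (use P(1) in \<open>auto simp: is_prime_def\<close>)
  have i: "mvar i \<notin> P" and f: "f \<notin> P" using P(3) by (auto simp: prime_mult_iff[OF P(1)])
  have "hpart P \<in> zeros K"
    using 1 homogeneous_ideal_hpart[OF sP] subset_hpart[OF K P(2)] hpart_subset[OF sP] i
    by (auto simp: zeros_def proj_points_iff)
  with i f hpart_subset[OF sP] that show thesis by blast
qed

text \<open>The weak projective Nullstellensatz: the preceding lemma with \<open>f = 1\<close> gives
  a power of each variable, and the sum of the exponents serves all of them.\<close>

lemma zeros_empty_imp_powers:
  fixes K :: "('v::finite, 'a::comm_ring_1) mpol set"
  assumes K: "homogeneous_ideal K" and "zeros K = {}"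
  shows "\<exists>N. \<forall>j. mvar j ^ N \<in> K"
proof -
  have "\<exists>N. mvar j ^ N \<in> K" for j
    using exists_zero_avoiding[OF K, of j 1] assms(2) by auto
  then obtain N where N: "\<And>j. mvar j ^ N j \<in> K" by metis
  have "mvar j ^ (\<Sum>j\<in>UNIV. N j) \<in> K" for j
  proof -
    have "(\<Sum>j\<in>UNIV. N j) = (\<Sum>j\<in>UNIV - {j}. N j) + N j"
      by (subst sum.remove[of _ j]) auto
    then have "mvar j ^ (\<Sum>j\<in>UNIV. N j) = mvar j ^ (\<Sum>j\<in>UNIV - {j}. N j) * mvar j ^ N j"
      by (simp add: power_add)
    then show ?thesis using rmod.subspace_scale[OF subspace_of_homogeneous[OF K] N] by metis
  qed
  then show ?thesis by blast
qed

lemma zeros_empty_of_powers: "(\<And>j. \<exists>N. mvar j ^ N \<in> K) \<Longrightarrow> zeros K = {}"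
proof (rule ccontr)
  assume *: "\<And>j. \<exists>N. mvar j ^ N \<in> K" and "zeros K \<noteq> {}"
  then obtain P i where P: "P \<in> zeros K" "mvar i \<notin> P" by (auto simp: zeros_def proj_points_iff)
  from * obtain N where "mvar i ^ N \<in> K" by blast
  with P show False using zerosD[OF P(1)] prime_power_iff by blast
qed

lemma exists_closed_point:
  fixes K :: "('v::finite, 'a::comm_ring_1) mpol set"
  assumes P: "P \<in> zeros K"
  obtains Q where "Q \<in> closed_points K" "P \<subseteq> Q"
proof -
  define \<F> where "\<F> = {Q \<in> proj_points. P \<subseteq> Q}"
  have "\<exists>M\<in>\<F>. \<forall>B\<in>\<F>. M \<subseteq> B \<longrightarrow> B = M"
  proof (rule subset_Zorn_nonempty)
    show "\<F> \<noteq> {}" using zerosD(1)[OF P] unfolding \<F>_def by blast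
  next
    fix \<C> assume C: "\<C> \<noteq> {}" "subset.chain \<F> \<C>"
    have ch: "A \<subseteq> B \<or> B \<subseteq> A" if "A \<in> \<C>" "B \<in> \<C>" for A B
      using C(2) that unfolding subset_chain_def by blast
    have sub: "\<C> \<subseteq> \<F>" using C(2) unfolding subset_chain_def by blast
    have sC: "is_prime A" "homogeneous_ideal A" "P \<subseteq> A" "\<exists>i. mvar i \<notin> A" if "A \<in> \<C>" for A
      using sub that unfolding \<F>_def proj_points_iff by auto
    have ss: "rmod.subspace A" if "A \<in> \<C>" for A using sC(1)[OF that] by (rule subspace_of_prime)
    have "rmod.subspace (\<Union>\<C>)"
    proof (rule rmod.subspaceI)
      show "0 \<in> \<Union>\<C>" using C(1) rmod.subspace_0[OF ss] by blast
      show "x + y \<in> \<Union>\<C>" if xy: "x \<in> \<Union>\<C>" "y \<in> \<Union>\<C>" for x y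
      proof -
        obtain A B where AB: "A \<in> \<C>" "B \<in> \<C>" "x \<in> A" "y \<in> B" using xy by blast
        then obtain D where D: "D \<in> \<C>" "x \<in> D" "y \<in> D" using ch[OF AB(1,2)] by blast
        then show ?thesis using rmod.subspace_add[OF ss[OF D(1)] D(2,3)] by blast
      qed
      show "c * x \<in> \<Union>\<C>" if "x \<in> \<Union>\<C>" for c x
        using that rmod.subspace_scale[OF ss] by blast
    qed
    moreover have "1 \<notin> \<Union>\<C>" using sC(1) unfolding is_prime_def by blast
    moreover have "a \<in> \<Union>\<C> \<or> b \<in> \<Union>\<C>" if "a * b \<in> \<Union>\<C>" for a b
      using that prime_mult_iff[OF sC(1)] by blast
    ultimately have "is_prime (\<Union>\<C>)" unfolding is_prime_def by blast
    moreover have "homogeneous_ideal (\<Union>\<C>)"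
      unfolding homogeneous_ideal_iff using \<open>rmod.subspace (\<Union>\<C>)\<close> hom_component_in[OF sC(2)] by blast
    \<comment> \<open>Finiteness of the set of variables enters here: if all of them lay in the
      union, a single member of the chain would contain them.\<close>
    moreover have "\<exists>i. mvar i \<notin> \<Union>\<C>"
    proof (rule ccontr)
      assume "\<not> ?thesis"
      then have "range mvar \<subseteq> \<Union>\<C>" by blast
      then obtain A where "A \<in> \<C>" "range mvar \<subseteq> A"
        using finite_subset_Union_chain[OF _ _ C, of "range mvar"] by auto
      with sC(4) show False by blast
    qed
    moreover have "P \<subseteq> \<Union>\<C>" using C(1) sC(3) by blast
    ultimately show "\<Union>\<C> \<in> \<F>" unfolding \<F>_def proj_points_iff by blast
  qed
  then obtain M where M: "M \<in> \<F>" "\<And>B. B \<in> \<F> \<Longrightarrow> M \<subseteq> B \<Longrightarrow> B = M" by blast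
  have "M \<in> closed_points K"
    using M zerosD(2)[OF P] unfolding closed_points_def zeros_def \<F>_def by blast
  with M that show thesis unfolding \<F>_def by blast
qed

lemma exists_component_point:
  fixes K :: "('v::finite, 'a::comm_ring_1) mpol set"
  assumes P: "P \<in> zeros K"
  obtains Q where "Q \<in> component_points K" "Q \<subseteq> P"
proof -
  \<comment> \<open>Complements turn the search for a minimal point into one for a maximal
    set.\<close>
  define \<F> where "\<F> = uminus ` {Q \<in> zeros K. Q \<subseteq> P}"
  have "\<exists>M\<in>\<F>. \<forall>B\<in>\<F>. M \<subseteq> B \<longrightarrow> B = M"
  proof (rule subset_Zorn_nonempty)
    show "\<F> \<noteq> {}" using P unfolding \<F>_def by blast
  next
    fix \<C> assume C: "\<C> \<noteq> {}" "subset.chain \<F> \<C>"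
    have ch: "A \<subseteq> B \<or> B \<subseteq> A" if "A \<in> \<C>" "B \<in> \<C>" for A B
      using C(2) that unfolding subset_chain_def by blast
    have sC: "- A \<in> zeros K" "- A \<subseteq> P" if "A \<in> \<C>" for A
      using C(2) that unfolding subset_chain_def \<F>_def by auto
    have ss: "rmod.subspace (- A)" if "A \<in> \<C>" for A using sC(1)[OF that] by (rule zerosD)
    have "rmod.subspace (- \<Union>\<C>)"
    proof (rule rmod.subspaceI)
      show "0 \<in> - \<Union>\<C>" using rmod.subspace_0[OF ss] by blast
      show "x + y \<in> - \<Union>\<C>" if xy: "x \<in> - \<Union>\<C>" "y \<in> - \<Union>\<C>" for x y
        using rmod.subspace_add[OF ss] that by blast
      show "c * x \<in> - \<Union>\<C>" if "x \<in> - \<Union>\<C>" for c x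
        using that rmod.subspace_scale[OF ss] by blast
    qed
    moreover have "1 \<notin> - \<Union>\<C>" using C(1) zerosD(3)[OF sC(1)] unfolding is_prime_def by blast
    moreover have "a \<in> - \<Union>\<C> \<or> b \<in> - \<Union>\<C>" if ab: "a * b \<in> - \<Union>\<C>" for a b
    proof (rule ccontr)
      assume "\<not> ?thesis"
      then obtain A B where AB: "A \<in> \<C>" "B \<in> \<C>" "a \<in> A" "b \<in> B" by blast
      then obtain D where D: "D \<in> \<C>" "a \<in> D" "b \<in> D" using ch[OF AB(1,2)] by blast
      then show False using ab prime_mult_iff[OF zerosD(3)[OF sC(1)[OF D(1)]], of a b] by blast
    qed
    ultimately have "is_prime (- \<Union>\<C>)" unfolding is_prime_def by blast
    moreover have "homogeneous_ideal (- \<Union>\<C>)"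
      unfolding homogeneous_ideal_iff using \<open>rmod.subspace (- \<Union>\<C>)\<close> hom_component_in[OF zerosD(4)[OF sC(1)]] by blast
    moreover have "- \<Union>\<C> \<subseteq> P" using C(1) sC(2) by blast
    moreover have "\<exists>i. mvar i \<notin> P" using zerosD(1)[OF P] unfolding proj_points_iff by blast
    moreover have "K \<subseteq> - \<Union>\<C>" using zerosD(2)[OF sC(1)] by blast
    ultimately have "- \<Union>\<C> \<in> {Q \<in> zeros K. Q \<subseteq> P}" unfolding zeros_def proj_points_iff by blast
    then have "- (- \<Union>\<C>) \<in> \<F>" unfolding \<F>_def by (rule imageI)
    then show "\<Union>\<C> \<in> \<F>" by simp
  qed
  then obtain N where N: "N \<in> \<F>" "\<And>B. B \<in> \<F> \<Longrightarrow> N \<subseteq> B \<Longrightarrow> B = N" by blast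
  then obtain M where M: "M \<in> zeros K" "M \<subseteq> P" and NM: "N = - M" unfolding \<F>_def by auto
  have "Q = M" if "Q \<in> zeros K" "Q \<subseteq> M" for Q
  proof -
    have "- Q \<in> \<F>" unfolding \<F>_def by (rule imageI) (use that M(2) in blast)
    moreover have "N \<subseteq> - Q" unfolding NM using that(2) by blast
    ultimately have "- Q = - M" using N(2) NM by blast
    then show ?thesis by simp
  qed
  then have "M \<in> component_points K" using M(1) unfolding component_points_def by blast
  with M that show thesis by blast
qed

section \<open>Rational points\<close>

text \<open>The kernel of evaluation is the ideal of an affine point. For nonzero \<open>a\<close>
  its homogeneous part is the ideal of the line through the origin and \<open>a\<close>, that is,
  the projective point \<open>[a]\<close>.\<close>

definition hpt :: "('v::finite \<Rightarrow> 'a::comm_ring_1) \<Rightarrow> ('v, 'a) mpol set" where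
  "hpt a = hpart {F. peval a F = 0}"

lemma subspace_peval_kernel: "rmod.subspace {F. peval a F = 0}"
  by (auto simp: rmod.subspace_def peval_simps)

lemma hpt_subset: "F \<in> hpt a \<Longrightarrow> peval a F = 0"
  using hpart_subset[OF subspace_peval_kernel] unfolding hpt_def by blast

lemma homogeneous_in_hpt_iff: "homogeneous e F \<Longrightarrow> F \<in> hpt a \<longleftrightarrow> peval a F = 0"
  unfolding hpt_def using homogeneous_in_hpart_iff[OF subspace_peval_kernel] by blast

lemma mvar_in_hpt_iff: "mvar i \<in> hpt a \<longleftrightarrow> a i = 0"
  using homogeneous_in_hpt_iff[OF homogeneous_mvar, of i a] by simp

lemma hpt_in_proj_points:
  fixes a :: "'v::finite \<Rightarrow> 'a::idom"
  assumes "a i \<noteq> 0"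
  shows "hpt a \<in> proj_points"
  unfolding proj_points_iff
proof (intro conjI)
  show "is_prime (hpt a)" unfolding hpt_def
    by (rule is_prime_hpart[OF subspace_peval_kernel]) (auto simp: peval_simps)
  show "homogeneous_ideal (hpt a)" unfolding hpt_def
    by (rule homogeneous_ideal_hpart[OF subspace_peval_kernel])
qed (use assms mvar_in_hpt_iff in blast)

lemma generator_in_hpt: "a i = 1 \<Longrightarrow> mvar j - mconst (a j) * mvar i \<in> hpt a"
  by (subst homogeneous_in_hpt_iff[of 1])
    (auto simp: peval_simps intro!: homogeneous_diff homogeneous_mconst_mult homogeneous_mvar[unfolded One_nat_def])

text \<open>A form of degree \<open>e\<close> is congruent to its value at \<open>a\<close> times
  \<open>mvar i ^ e\<close>, and \<open>mvar i\<close> is outside \<open>P\<close> because otherwise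
  all variables would belong to \<open>P\<close>.\<close>

lemma proj_point_eq_hpt:
  fixes a :: "'v::finite \<Rightarrow> 'a::field"
  assumes P: "P \<in> proj_points" and ai: "a i = 1" and a: "\<And>j. mvar j - mconst (a j) * mvar i \<in> P"
  shows "P = hpt a" "mvar i \<notin> P"
proof -
  have pP: "is_prime P" and hP: "homogeneous_ideal P" using P by (auto simp: proj_points_iff)
  note sP = subspace_of_prime[OF pP]
  show ni: "mvar i \<notin> P"
  proof
    assume i: "mvar i \<in> P"
    have "mvar j \<in> P" for j
      using rmod.subspace_add[OF sP a[of j] rmod.subspace_scale[OF sP i, of "mconst (a j)"]] by simp
    with P show False by (auto simp: proj_points_iff)
  qed
  have *: "hom_component e F \<in> P \<longleftrightarrow> peval a (hom_component e F) = 0" for e F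
  proof -
    have "hom_component e F \<in> P \<longleftrightarrow> mconst (peval a (hom_component e F)) * mvar i ^ e \<in> P"
      by (rule in_ideal_diff_iff[OF sP homogeneous_diff_peval_in_ideal[OF sP a homogeneous_hom_component]])
    also have "\<dots> \<longleftrightarrow> mconst (peval a (hom_component e F)) \<in> P"
      using ni by (simp add: prime_mult_iff[OF pP] prime_power_iff[OF pP])
    also have "\<dots> \<longleftrightarrow> peval a (hom_component e F) = 0"
    proof
      assume m: "mconst (peval a (hom_component e F)) \<in> P"
      show "peval a (hom_component e F) = 0"
      proof (rule ccontr)
        assume "peval a (hom_component e F) \<noteq> 0"
        from mconst_unit[OF this] rmod.subspace_scale[OF sP m] have "1 \<in> P"
          by (metis mult.commute)
        with pP show False by (simp add: is_prime_def)
      qed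
    qed (simp add: rmod.subspace_0[OF sP])
    finally show ?thesis .
  qed
  have "F \<in> P \<longleftrightarrow> (\<forall>e. hom_component e F \<in> P)" for F
    using hom_component_in[OF hP] in_subspace_of_components[OF sP] by blast
  then show "P = hpt a" unfolding hpt_def hpart_def by (auto simp: *)
qed

lemma hpt_maximal:
  fixes a :: "'v::finite \<Rightarrow> 'a::field"
  assumes "a i = 1" "hpt a \<subseteq> Q" "Q \<in> proj_points"
  shows "Q = hpt a"
proof (rule proj_point_eq_hpt(1))
  show "mvar j - mconst (a j) * mvar i \<in> Q" for j
    using generator_in_hpt[of a i j] assms by blast
qed (use assms in auto)

subsection \<open>Linear dependence\<close>

lemma finite_mdegree: "finite {\<alpha> :: 'b::finite \<Rightarrow>\<^sub>0 nat. mdegree \<alpha> = d}"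
proof -
  have "Poly_Mapping.lookup ` {\<alpha> :: 'b \<Rightarrow>\<^sub>0 nat. mdegree \<alpha> = d} \<subseteq> (PiE UNIV (\<lambda>_. {..d}) :: ('b \<Rightarrow> nat) set)"
    by (auto simp: mdegree_def intro: member_le_sum)
  moreover have "finite (PiE UNIV (\<lambda>_. {..d}) :: ('b \<Rightarrow> nat) set)" by (rule finite_PiE) auto
  ultimately have "finite (Poly_Mapping.lookup ` {\<alpha> :: 'b \<Rightarrow>\<^sub>0 nat. mdegree \<alpha> = d})"
    by (rule finite_subset)
  moreover have "inj_on Poly_Mapping.lookup A" for A :: "('b \<Rightarrow>\<^sub>0 nat) set"
    by (auto intro!: inj_onI poly_mapping_eqI)
  ultimately show ?thesis using finite_imageD by blast
qed

text \<open>These are \<open>B + 1\<close> forms in a space spanned by at most \<open>B\<close>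
  monomials. If the family repeats a form, the difference of the two copies is a relation.\<close>

lemma exists_linear_relation:
  fixes w :: "nat \<Rightarrow> ('v::finite, 'a::field) mpol"
  assumes w: "\<And>i. homogeneous d (w i)" and B: "card {\<alpha> :: 'v \<Rightarrow>\<^sub>0 nat. mdegree \<alpha> = d} \<le> B"
  obtains a where "\<exists>i\<le>B. a i \<noteq> 0" "(\<Sum>i\<le>B. mconst (a i) * w i) = 0"
proof -
  interpret V: vector_space "\<lambda>(c::'a) (F::('v, 'a) mpol). mconst c * F"
    by unfold_locales (simp_all add: mconst_add mconst_mult distrib_left distrib_right mult.assoc)
  consider (1) "inj_on w {..B}" "V.dependent (w ` {..B})" | (2) "inj_on w {..B}" "V.independent (w ` {..B})"
    | (3) "\<not> inj_on w {..B}" by blast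
  then show thesis
  proof cases
    case 1
    then obtain u where u: "\<exists>v\<in>w ` {..B}. u v \<noteq> 0" "(\<Sum>v\<in>w ` {..B}. mconst (u v) * v) = 0"
      using V.dependent_finite[of "w ` {..B}"] by auto
    show thesis
      by (rule that[of "\<lambda>i. u (w i)"]) (use u 1(1) in \<open>auto simp: sum.reindex\<close>)
  next
    case 2
    define T where "T = (\<lambda>\<alpha>. Poly_Mapping.single \<alpha> (1::'a)) ` {\<alpha> :: 'v \<Rightarrow>\<^sub>0 nat. mdegree \<alpha> = d}"
    have "w i \<in> V.span T" for i
    proof -
      have "(\<Sum>\<alpha>\<in>Poly_Mapping.keys (w i). mconst (Poly_Mapping.lookup (w i) \<alpha>) * Poly_Mapping.single \<alpha> 1) \<in> V.span T"
        using w[of i] by (intro V.span_sum V.span_scale V.span_base) (auto simp: T_def homogeneous_def)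
      then show ?thesis by (simp add: mconst_mult_single mpol_sum_single)
    qed
    then have "w ` {..B} \<subseteq> V.span T" by blast
    moreover have fT: "finite T" unfolding T_def by (intro finite_imageI finite_mdegree)
    ultimately have "card (w ` {..B}) \<le> card T" using V.independent_span_bound[OF fT 2(2)] by blast
    also have "\<dots> \<le> B" unfolding T_def using card_image_le[OF finite_mdegree] B le_trans by blast
    finally show thesis using 2(1) by (simp add: card_image)
  next
    case 3
    then obtain i j where ij: "i \<le> B" "j \<le> B" "i \<noteq> j" "w i = w j" by (auto simp: inj_on_def)
    define a where "a k = (if k = i then 1 else if k = j then -1 else (0::'a))" for k
    have "(\<Sum>k\<le>B. mconst (a k) * w k) = (\<Sum>k\<in>{i, j}. mconst (a k) * w k)"
      by (rule sum.mono_neutral_right) (use ij in \<open>auto simp: a_def\<close>)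
    also have "\<dots> = 0" using ij by (simp add: a_def mconst_minus)
    finally show thesis
    proof (rule that[rotated])
      show "\<exists>k\<le>B. a k \<noteq> 0" using ij by (intro exI[of _ i]) (simp add: a_def)
    qed
  qed
qed

text \<open>The homogenisation of \<open>p\<close> in degree \<open>D\<close>, evaluated at
  \<open>x\<close> and \<open>y\<close>.\<close>

definition binary_form :: "('v, 'a::comm_ring_1) mpol \<Rightarrow> ('v, 'a) mpol \<Rightarrow> nat \<Rightarrow> 'a poly \<Rightarrow> ('v, 'a) mpol" where
  "binary_form x y D p = (\<Sum>i\<le>D. mconst (coeff p i) * x ^ i * y ^ (D - i))"

lemma binary_form_add: "binary_form x y D (p + q) = binary_form x y D p + binary_form x y D q"
  by (simp add: binary_form_def mconst_add distrib_right sum.distrib)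

lemma binary_form_pCons_0: "binary_form x y (Suc D) (pCons 0 q) = x * binary_form x y D q"
  unfolding binary_form_def by (subst sum.atMost_Suc_shift) (simp add: sum_distrib_left ac_simps)

lemma binary_form_smult: "binary_form x y D (smult r q) = mconst r * binary_form x y D q"
  by (simp add: binary_form_def sum_distrib_left mconst_mult mult.assoc)

lemma binary_form_Suc:
  assumes "degree q \<le> D"
  shows "binary_form x y (Suc D) q = y * binary_form x y D q"
proof -
  have "binary_form x y (Suc D) q = (\<Sum>i\<le>D. mconst (coeff q i) * x ^ i * y ^ (Suc D - i))"
    using assms by (simp add: binary_form_def coeff_eq_0)
  also have "\<dots> = (\<Sum>i\<le>D. y * (mconst (coeff q i) * x ^ i * y ^ (D - i)))"
    by (rule sum.cong) (auto simp: Suc_diff_le ac_simps)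
  finally show ?thesis by (simp add: binary_form_def sum_distrib_left)
qed

text \<open>Over an algebraically closed field a binary form is a product of linear forms, and a
  prime ideal contains one of the factors. A degree of \<open>p\<close> below \<open>D\<close>
  accounts for a factor \<open>y\<close>.\<close>

lemma binary_form_splits:
  fixes P :: "('v, 'a::alg_closed_field) mpol set"
  assumes P: "is_prime P"
  shows "binary_form x y D p \<in> P \<Longrightarrow> p \<noteq> 0 \<Longrightarrow> degree p \<le> D \<Longrightarrow>
    \<exists>\<alpha> \<beta>. (\<alpha> \<noteq> 0 \<or> \<beta> \<noteq> 0) \<and> mconst \<alpha> * x + mconst \<beta> * y \<in> P"
proof (induction D arbitrary: p)
  case 0
  then have "mconst (coeff p 0) \<in> P" and "coeff p 0 \<noteq> 0"
    by (auto simp: binary_form_def) (metis degree_0_id pCons_0_0 of_nat_0 degree_eq_zeroE coeff_pCons_0)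
  from rmod.subspace_scale[OF subspace_of_prime[OF P] this(1), of "mconst (inverse (coeff p 0))"]
    mconst_unit[OF this(2)]
  have "1 \<in> P" by (metis mult.commute)
  with P show ?case by (simp add: is_prime_def)
next
  case (Suc D)
  show ?case
  proof (cases "degree p \<le> D")
    case True
    with Suc.prems(1) have "y * binary_form x y D p \<in> P" by (simp add: binary_form_Suc)
    then consider "y \<in> P" | "binary_form x y D p \<in> P" by (auto simp: prime_mult_iff[OF P])
    then show ?thesis
    proof cases
      case 1
      then show ?thesis by (intro exI[of _ 0] exI[of _ 1]) simp
    next
      case 2
      from Suc.IH[OF this Suc.prems(2) True] show ?thesis .
    qed
  next
    case False
    then have "degree p > 0" by simp
    then obtain r where "poly p r = 0" using alg_closed_imp_poly_has_root by blast
    then obtain q where q: "p = [:- r, 1:] * q" by (auto simp: poly_eq_0_iff_dvd dvd_def)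
    with Suc.prems(2) have q0: "q \<noteq> 0" by auto
    then have "degree p = Suc (degree q)" unfolding q by (subst degree_mult_eq) auto
    with Suc.prems(3) have dq: "degree q \<le> D" by simp
    have "p = pCons 0 q + smult (- r) q" by (simp add: q)
    then have "binary_form x y (Suc D) p = (x - mconst r * y) * binary_form x y D q"
      by (simp only: binary_form_add binary_form_pCons_0 binary_form_smult binary_form_Suc[OF dq])
        (simp add: mconst_minus left_diff_distrib mult.assoc)
    with Suc.prems(1) consider "x - mconst r * y \<in> P" | "binary_form x y D q \<in> P"
      by (auto simp: prime_mult_iff[OF P])
    then show ?thesis
    proof cases
      case 1
      then show ?thesis by (intro exI[of _ 1] exI[of _ "- r"]) (simp add: mconst_minus)
    next
      case 2
      from Suc.IH[OF this q0 dq] show ?thesis .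
    qed
  qed
qed

lemma binary_relation_splits:
  fixes P :: "('v, 'a::alg_closed_field) mpol set"
  assumes P: "is_prime P" and a: "\<exists>i\<le>D. a i \<noteq> 0"
    and rel: "(\<Sum>i\<le>D. mconst (a i) * x ^ i * y ^ (D - i)) \<in> P"
  shows "\<exists>\<alpha> \<beta>. (\<alpha> \<noteq> 0 \<or> \<beta> \<noteq> 0) \<and> mconst \<alpha> * x + mconst \<beta> * y \<in> P"
proof -
  define p where "p = (\<Sum>i\<le>D. monom (a i) i)"
  have c: "coeff p i = (if i \<le> D then a i else 0)" for i
    by (simp add: p_def coeff_sum)
  have "binary_form x y D p \<in> P" using rel by (simp add: binary_form_def c)
  moreover have "p \<noteq> 0" using a c by (metis coeff_0)
  moreover have "degree p \<le> D" by (rule degree_le) (simp add: c)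
  ultimately show ?thesis by (rule binary_form_splits[OF P])
qed

subsection \<open>Nullstellensatz\<close>

text \<open>Pigeonhole: a monomial of degree at least \<open>N * CARD('v)\<close> contains some
  variable to the power \<open>N\<close>.\<close>

lemma high_degree_in_ideal:
  fixes K :: "('v::finite, 'a::comm_ring_1) mpol set"
  assumes K: "rmod.subspace K" and N: "\<And>j. mvar j ^ N \<in> K"
    and F: "homogeneous d F" "N * CARD('v) \<le> d" "0 < d"
  shows "F \<in> K"
proof -
  have "Poly_Mapping.single \<alpha> c \<in> K" if "mdegree \<alpha> = d" for \<alpha> :: "'v \<Rightarrow>\<^sub>0 nat" and c
  proof -
    have "\<exists>j. N \<le> Poly_Mapping.lookup \<alpha> j"
    proof (rule ccontr)
      assume "\<not> ?thesis"
      then have "Poly_Mapping.lookup \<alpha> j < N" for j by (simp add: not_le)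
      then have "(\<Sum>j\<in>UNIV. Poly_Mapping.lookup \<alpha> j) < (\<Sum>j\<in>(UNIV::'v set). N)"
        by (intro sum_strict_mono) auto
      with that F(2) show False by (simp add: mdegree_def mult.commute)
    qed
    then obtain j where j: "N \<le> Poly_Mapping.lookup \<alpha> j" ..
    define r where "r = mconst c * (\<Prod>k\<in>UNIV - {j}. mvar k ^ Poly_Mapping.lookup \<alpha> k)"
    have "Poly_Mapping.single \<alpha> c = r * mvar j ^ Poly_Mapping.lookup \<alpha> j"
      unfolding single_eq_prod r_def by (subst prod.remove[of UNIV j]) (auto simp: ac_simps)
    also have "mvar j ^ Poly_Mapping.lookup \<alpha> j = mvar j ^ (Poly_Mapping.lookup \<alpha> j - N) * mvar j ^ N"
      using j by (simp flip: power_add)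
    finally have "Poly_Mapping.single \<alpha> c = (r * mvar j ^ (Poly_Mapping.lookup \<alpha> j - N)) * mvar j ^ N"
      by (simp only: mult.assoc)
    then show ?thesis using rmod.subspace_scale[OF K N] by metis
  qed
  then have "(\<Sum>\<alpha>\<in>Poly_Mapping.keys F. Poly_Mapping.single \<alpha> (Poly_Mapping.lookup F \<alpha>)) \<in> K"
    using F(1) by (intro rmod.subspace_sum[OF K]) (auto simp: homogeneous_def)
  then show ?thesis by (simp add: mpol_sum_single)
qed

text \<open>If \<open>P\<close> and the form \<open>x\<close> have no common zero, repeated division
  by \<open>x\<close> writes every form of degree \<open>M + q * \<delta>\<close>, modulo
  \<open>P\<close>, as \<open>x ^ q\<close> times a form of the fixed degree \<open>M\<close>. This
  bounds the dimension of the forms modulo \<open>P\<close>, so monomials in \<open>y\<close> and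
  \<open>z\<close> become dependent, and the resulting binary relation splits.\<close>

lemma exists_scalar_relation:
  fixes P :: "('v::finite, 'a::alg_closed_field) mpol set"
  assumes P: "is_prime P" "homogeneous_ideal P"
    and x: "homogeneous \<delta> x" "0 < \<delta>" and N: "\<And>j. mvar j ^ N \<in> rmod.span (insert x P)"
    and yz: "homogeneous 1 y" "homogeneous 1 z"
  shows "\<exists>\<alpha> \<beta>. (\<alpha> \<noteq> 0 \<or> \<beta> \<noteq> 0) \<and> mconst \<alpha> * y + mconst \<beta> * z \<in> P"
proof -
  note sP = subspace_of_prime[OF P(1)]
  define M where "M = N * CARD('v)"
  have step: "\<exists>c. homogeneous d c \<and> F - c * x \<in> P"
    if F: "homogeneous (d + \<delta>) F" and d: "M \<le> d" for d F
  proof -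
    have "F \<in> rmod.span (insert x P)"
      by (rule high_degree_in_ideal[OF rmod.subspace_span N F]) (use d x(2) in \<open>auto simp: M_def\<close>)
    then obtain c where "F - c * x \<in> P" using in_span_insert_iff[OF sP] by blast
    from hom_component_in[OF P(2) this, of "d + \<delta>"]
    have "F - hom_component d c * x \<in> P"
      using F by (simp add: hom_component_diff hom_component_mult_homogeneous[OF x(1)] hom_component_homogeneous)
    then show ?thesis using homogeneous_hom_component by blast
  qed
  have iter: "\<exists>c. homogeneous M c \<and> F - c * x ^ q \<in> P" if "homogeneous (M + q * \<delta>) F" for q F
    using that
  proof (induction q arbitrary: F)
    case 0
    then show ?case by (intro exI[of _ F]) (auto simp: rmod.subspace_0[OF sP])
  next
    case (Suc q)
    have "homogeneous ((M + q * \<delta>) + \<delta>) F" using Suc.prems by (simp add: algebra_simps)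
    from step[OF this] obtain c where c: "homogeneous (M + q * \<delta>) c" "F - c * x \<in> P" by auto
    from Suc.IH[OF c(1)] obtain c' where c': "homogeneous M c'" "c - c' * x ^ q \<in> P" by auto
    have "F - c' * x ^ Suc q = (F - c * x) + x * (c - c' * x ^ q)" by (simp add: algebra_simps)
    also have "\<dots> \<in> P" by (rule rmod.subspace_add[OF sP c(2) rmod.subspace_scale[OF sP c'(2)]])
    finally show ?case using c'(1) by blast
  qed
  \<comment> \<open>The forms of degree \<open>M\<close> have dimension at most \<open>B\<close>, so
    \<open>B + 1\<close> products of degree \<open>D\<close> are dependent modulo \<open>P\<close>.
    The choice of \<open>D\<close> allows division by \<open>x ^ B\<close> and makes
    \<open>D - i\<close> a true difference for \<open>i \<le> B\<close>.\<close>
  define B where "B = card {\<alpha> :: 'v \<Rightarrow>\<^sub>0 nat. mdegree \<alpha> = M}"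
  define D where "D = M + B * \<delta>"
  have BD: "B \<le> D" using x(2) by (simp add: D_def trans_le_add2)
  have "\<exists>c. homogeneous M c \<and> y ^ i * z ^ (D - i) - c * x ^ B \<in> P" if "i \<le> B" for i
  proof (rule iter)
    have "homogeneous (1 * i + 1 * (D - i)) (y ^ i * z ^ (D - i))"
      by (intro homogeneous_mult homogeneous_power yz)
    then show "homogeneous (M + B * \<delta>) (y ^ i * z ^ (D - i))"
      using that BD by (simp add: D_def)
  qed
  then obtain c where c: "\<And>i. i \<le> B \<Longrightarrow> homogeneous M (c i)"
      "\<And>i. i \<le> B \<Longrightarrow> y ^ i * z ^ (D - i) - c i * x ^ B \<in> P" by metis
  define w where "w i = (if i \<le> B then c i else 0)" for i
  have w: "homogeneous M (w i)" for i using c(1) by (simp add: w_def)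
  obtain a where a: "\<exists>i\<le>B. a i \<noteq> 0" "(\<Sum>i\<le>B. mconst (a i) * w i) = 0"
    by (rule exists_linear_relation[of M w B]) (use w in \<open>auto simp: B_def\<close>)
  have "(\<Sum>i\<le>B. mconst (a i) * (y ^ i * z ^ (D - i))) - (\<Sum>i\<le>B. mconst (a i) * (w i * x ^ B)) \<in> P"
  proof (rule sum_diff_in_ideal[OF sP])
    fix i assume "i \<in> {..B}"
    then have "y ^ i * z ^ (D - i) - w i * x ^ B \<in> P" using c(2) by (simp add: w_def)
    from rmod.subspace_scale[OF sP this, of "mconst (a i)"]
    show "mconst (a i) * (y ^ i * z ^ (D - i)) - mconst (a i) * (w i * x ^ B) \<in> P"
      by (simp only: right_diff_distrib)
  qed
  moreover have "(\<Sum>i\<le>B. mconst (a i) * (w i * x ^ B)) = (\<Sum>i\<le>B. mconst (a i) * w i) * x ^ B"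
    by (simp add: sum_distrib_right mult.assoc)
  \<comment> \<open>All exponents of \<open>z\<close> are at least \<open>D - B\<close>; taking out
    this power leaves a binary form of degree \<open>B\<close>.\<close>
  moreover have "(\<Sum>i\<le>B. mconst (a i) * (y ^ i * z ^ (D - i)))
      = z ^ (D - B) * (\<Sum>i\<le>B. mconst (a i) * y ^ i * z ^ (B - i))"
  proof -
    have "z ^ (D - i) = z ^ (D - B) * z ^ (B - i)" if "i \<le> B" for i
      using that BD by (simp flip: power_add)
    note pw = this
    show ?thesis unfolding sum_distrib_left
    proof (rule sum.cong)
      fix i assume "i \<in> {..B}"
      then show "mconst (a i) * (y ^ i * z ^ (D - i)) = z ^ (D - B) * (mconst (a i) * y ^ i * z ^ (B - i))"
        by (subst pw) (auto simp only: atMost_iff ac_simps)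
    qed simp
  qed
  ultimately have "z ^ (D - B) * (\<Sum>i\<le>B. mconst (a i) * y ^ i * z ^ (B - i)) \<in> P"
    using a(2) by simp
  then consider "z \<in> P" | "(\<Sum>i\<le>B. mconst (a i) * y ^ i * z ^ (B - i)) \<in> P"
    by (auto simp: prime_mult_iff[OF P(1)] prime_power_iff[OF P(1)])
  then show ?thesis
  proof cases
    case 1
    then show ?thesis by (intro exI[of _ 0] exI[of _ 1]) simp
  next
    case 2
    from binary_relation_splits[OF P(1) a(1) this] show ?thesis .
  qed
qed

text \<open>The scalar relation between \<open>mvar j\<close> and \<open>mvar i\<close> can be
  solved for \<open>mvar j\<close> because \<open>mvar i\<close> is outside \<open>P\<close>; the
  coefficients are the coordinates of the point.\<close>

lemma rational_of_powers:
  fixes P :: "('v::finite, 'a::alg_closed_field) mpol set"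
  assumes P: "P \<in> proj_points" and i: "mvar i \<notin> P"
    and x: "homogeneous \<delta> x" "0 < \<delta>" and N: "\<And>j. mvar j ^ N \<in> rmod.span (insert x P)"
  shows "\<exists>a. a i = 1 \<and> P = hpt a"
proof -
  have pP: "is_prime P" "homogeneous_ideal P" using P by (auto simp: proj_points_iff)
  note sP = subspace_of_prime[OF pP(1)]
  have "\<exists>c. mvar j - mconst c * mvar i \<in> P" for j
  proof -
    obtain \<alpha> \<beta> where ab: "\<alpha> \<noteq> 0 \<or> \<beta> \<noteq> 0" "mconst \<alpha> * mvar j + mconst \<beta> * mvar i \<in> P"
      using exists_scalar_relation[OF pP x N homogeneous_mvar homogeneous_mvar] by blast
    have "\<alpha> \<noteq> 0"
    proof
      assume "\<alpha> = 0"
      with ab have b: "\<beta> \<noteq> 0" "mconst \<beta> * mvar i \<in> P" by auto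
      have "mconst (inverse \<beta>) * (mconst \<beta> * mvar i) = mvar i"
        by (simp add: mult.assoc[symmetric] mult.commute[of "mconst (inverse \<beta>)"] mconst_unit[OF b(1)])
      with rmod.subspace_scale[OF sP b(2), of "mconst (inverse \<beta>)"] have "mvar i \<in> P" by simp
      with i show False ..
    qed
    have "mconst (inverse \<alpha>) * (mconst \<alpha> * mvar j + mconst \<beta> * mvar i) \<in> P"
      by (rule rmod.subspace_scale[OF sP ab(2)])
    also have "mconst (inverse \<alpha>) * (mconst \<alpha> * mvar j + mconst \<beta> * mvar i)
        = mvar j - mconst (- inverse \<alpha> * \<beta>) * mvar i"
      by (simp add: distrib_left mconst_minus mconst_mult mult.assoc[symmetric]
          mult.commute[of "mconst (inverse \<alpha>)" "mconst \<alpha>"] mconst_unit[OF \<open>\<alpha> \<noteq> 0\<close>])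
    finally show ?thesis by blast
  qed
  then obtain c where c: "\<And>j. mvar j - mconst (c j) * mvar i \<in> P" by metis
  define a where "a = c(i := 1)"
  have "mvar j - mconst (a j) * mvar i \<in> P" for j
    using c[of j] rmod.subspace_0[OF sP] by (auto simp: a_def)
  from proj_point_eq_hpt(1)[where a = a, OF P _ this] have "P = hpt a" by (simp add: a_def)
  moreover have "a i = 1" by (simp add: a_def)
  ultimately show ?thesis by blast
qed

text \<open>By maximality \<open>Q\<close> and \<open>mvar i\<close> have no common zero, so
  \<open>mvar i\<close> can serve as the form in the preceding lemma.\<close>

lemma closed_point_rational:
  fixes K :: "('v::finite, 'a::alg_closed_field) mpol set"
  assumes Q: "Q \<in> closed_points K" and i: "mvar i \<notin> Q"
  shows "\<exists>a. a i = 1 \<and> Q = hpt a"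
proof -
  have Qp: "Q \<in> proj_points" and max: "\<And>R. R \<in> proj_points \<Longrightarrow> Q \<subseteq> R \<Longrightarrow> R = Q"
    using Q by (auto simp: closed_points_def zeros_def)
  have hQ: "homogeneous_ideal Q" using Qp by (simp add: proj_points_iff)
  have "zeros (rmod.span (insert (mvar i) Q)) = {}"
  proof (rule ccontr)
    assume "\<not> ?thesis"
    then obtain R where R: "R \<in> zeros (rmod.span (insert (mvar i) Q))" by blast
    have "insert (mvar i) Q \<subseteq> R" using zerosD(2)[OF R] rmod.span_superset[of "insert (mvar i) Q"] by blast
    with max[OF zerosD(1)[OF R]] i show False by blast
  qed
  from zeros_empty_imp_powers[OF homogeneous_ideal_span_insert[OF hQ homogeneous_mvar] this]
  obtain N where "\<And>j. mvar j ^ N \<in> rmod.span (insert (mvar i) Q)" by blast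
  from rational_of_powers[OF Qp i homogeneous_mvar _ this] show ?thesis by simp
qed

lemma closed_point_hpt:
  fixes K :: "('v::finite, 'a::alg_closed_field) mpol set"
  assumes "Q \<in> closed_points K"
  obtains a i where "a i = 1" "Q = hpt a" "mvar i \<notin> Q"
proof -
  obtain i where "mvar i \<notin> Q" using assms by (auto simp: closed_points_def zeros_def proj_points_iff)
  with closed_point_rational[OF assms] that show thesis by blast
qed

subsection \<open>Dimension\<close>

lemma chain_dim_ge:
  assumes "\<And>i. i \<le> r \<Longrightarrow> c i \<in> A" "\<And>i. i < r \<Longrightarrow> c i \<subset> c (Suc i)"
  shows "enat r \<le> chain_dim A"
  unfolding chain_dim_def by (rule Sup_upper) (use assms in blast)

lemma chain_dim_le:
  fixes A :: "'a set set"
  assumes "\<And>r c. (\<And>i. i \<le> r \<Longrightarrow> c i \<in> A) \<Longrightarrow> (\<And>i. i < r \<Longrightarrow> c i \<subset> c (Suc i)) \<Longrightarrow> r \<le> n"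
  shows "chain_dim A \<le> enat n"
proof -
  have "x \<le> enat n" if "x \<in> {enat r | r. \<exists>c :: nat \<Rightarrow> 'a set. (\<forall>i\<le>r. c i \<in> A) \<and> (\<forall>i<r. c i \<subset> c (Suc i))}" for x
  proof -
    from that obtain r and c :: "nat \<Rightarrow> 'a set" where x: "x = enat r"
      and c: "\<forall>i\<le>r. c i \<in> A" "\<forall>i<r. c i \<subset> c (Suc i)" by blast
    have "r \<le> n" by (rule assms[of r c]) (use c in blast)+
    with x show ?thesis by simp
  qed
  then show ?thesis unfolding chain_dim_def by (rule Sup_least)
qed

lemma chain_dim_hpt:
  fixes a :: "'v::finite \<Rightarrow> 'a::field"
  assumes "a i = 1"
  shows "chain_dim (zeros (hpt a)) \<noteq> enat 1"
proof -
  have "Q = hpt a" if "Q \<in> zeros (hpt a)" for Q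
    using hpt_maximal[where a = a and i = i] assms zerosD(1,2)[OF that] by blast
  note eq = this
  have "chain_dim (zeros (hpt a)) \<le> enat 0"
  proof (rule chain_dim_le)
    fix r and c :: "nat \<Rightarrow> ('v, 'a) mpol set"
    assume c: "\<And>i. i \<le> r \<Longrightarrow> c i \<in> zeros (hpt a)" "\<And>i. i < r \<Longrightarrow> c i \<subset> c (Suc i)"
    show "r \<le> 0"
    proof (rule ccontr)
      assume "\<not> r \<le> 0"
      then have "c 0 = hpt a" "c (Suc 0) = hpt a" "c 0 \<subset> c (Suc 0)" using c eq by auto
      then show False by blast
    qed
  qed
  then show ?thesis by auto
qed

lemma no_triple_chain:
  assumes d: "chain_dim (zeros P) = enat 1" and Q: "Q \<in> zeros P" "P \<subset> Q" "Q \<subseteq> R" "R \<in> proj_points"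
    and P: "P \<in> proj_points"
  shows "R = Q"
proof (rule ccontr)
  assume "R \<noteq> Q"
  with Q have QR: "Q \<subset> R" by blast
  define c where "c k = (if k = 0 then P else if k = 1 then Q else R)" for k :: nat
  have "enat 2 \<le> chain_dim (zeros P)"
  proof (rule chain_dim_ge)
    show "c k \<in> zeros P" for k using Q P by (auto simp: c_def zeros_def)
    show "c k \<subset> c (Suc k)" if "k < 2" for k using that Q QR by (auto simp: c_def less_2_cases_iff)
  qed
  with d show False by simp
qed

text \<open>A chain below \<open>P\<close> starts above some component point, so it is a chain
  inside that component, which has dimension one.\<close>

lemma local_dimension_le_1:
  assumes pd: "pure_dimension 1 K"
  shows "chain_dim {Q \<in> zeros K. Q \<subseteq> P} \<le> enat 1"
proof (rule chain_dim_le)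
  fix r and c :: "nat \<Rightarrow> ('a, 'b) mpol set"
  assume c: "\<And>i. i \<le> r \<Longrightarrow> c i \<in> {Q \<in> zeros K. Q \<subseteq> P}" "\<And>i. i < r \<Longrightarrow> c i \<subset> c (Suc i)"
  from c(1)[of 0] have "c 0 \<in> zeros K" by simp
  then obtain Q where Q: "Q \<in> component_points K" "Q \<subseteq> c 0" by (rule exists_component_point)
  have mono: "c 0 \<subseteq> c i" if "i \<le> r" for i
    using that
  proof (induction i)
    case (Suc i)
    then show ?case using c(2)[of i] by fastforce
  qed simp
  have "enat r \<le> chain_dim (zeros Q)"
  proof (rule chain_dim_ge)
    show "c i \<in> zeros Q" if "i \<le> r" for i
      using c(1)[OF that] mono[OF that] Q(2) by (auto simp: zeros_def)
  qed (use c(2) in auto)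
  also have "chain_dim (zeros Q) = enat 1" using pd Q(1) by (simp add: pure_dimension_def)
  finally show "r \<le> 1" by simp
qed

subsection \<open>Linear forms avoiding points\<close>

definition lin :: "('v::finite \<Rightarrow> 'a::comm_ring_1) \<Rightarrow> ('v, 'a) mpol" where
  "lin c = (\<Sum>k\<in>UNIV. mconst (c k) * mvar k)"

lemma homogeneous_lin: "homogeneous 1 (lin c)"
  unfolding lin_def by (intro homogeneous_sum homogeneous_mconst_mult homogeneous_mvar)

lemma peval_lin: "peval a (lin c) = (\<Sum>k\<in>UNIV. c k * a k)"
  by (simp add: lin_def peval_simps)

lemma alg_closed_infinite: "infinite (UNIV :: 'a::alg_closed_field set)"
proof
  assume fin: "finite (UNIV :: 'a set)"
  define p :: "'a poly" where "p = (\<Prod>a\<in>UNIV. [:- a, 1:]) + 1"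
  have "degree (\<Prod>a\<in>(UNIV::'a set). [:- a, 1:]) = (\<Sum>a\<in>(UNIV::'a set). degree [:- a, 1:])"
    by (rule degree_prod_eq_sum_degree) simp
  also have "\<dots> = card (UNIV :: 'a set)" by simp
  finally have "degree p > 0" unfolding p_def
    using fin by (subst degree_add_eq_left) (auto simp: card_gt_0_iff)
  then obtain z where "poly p z = 0" using alg_closed_imp_poly_has_root by blast
  moreover have "poly p z = 1" unfolding p_def using prod_zero[OF fin, of "\<lambda>a. poly [:- a, 1:] z"] by (simp add: poly_prod)
  ultimately show False by simp
qed

text \<open>Coefficient \<open>k\<close> of a form that works for the earlier points is perturbed by
  \<open>s\<close>, where the new point has a nonzero coordinate \<open>k\<close>. Each point with
  nonzero coordinate \<open>k\<close> forbids one value of \<open>s\<close>; the other points do not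
  notice the change.\<close>

lemma exists_form_avoiding:
  fixes A :: "('v::finite \<Rightarrow> 'a::alg_closed_field) set"
  assumes "finite A" and "\<And>a. a \<in> A \<Longrightarrow> \<exists>k. a k \<noteq> 0"
  shows "\<exists>c. \<forall>a\<in>A. peval a (lin c) \<noteq> 0"
  using assms
proof (induction A rule: finite_induct)
  case (insert b A)
  then obtain c where c: "\<And>a. a \<in> A \<Longrightarrow> peval a (lin c) \<noteq> 0" by auto
  obtain k where k: "b k \<noteq> 0" using insert.prems by auto
  have "finite ((\<lambda>a. - peval a (lin c) / a k) ` insert b A)" using insert.hyps by simp
  then obtain s where s: "s \<notin> (\<lambda>a. - peval a (lin c) / a k) ` insert b A" and "s \<noteq> 0"
    using ex_new_if_finite[OF alg_closed_infinite, of "insert 0 ((\<lambda>a. - peval a (lin c) / a k) ` insert b A)"]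
    by auto
  have p: "peval a (lin (c(k := c k + s))) = peval a (lin c) + s * a k" for a
    unfolding peval_lin by (subst (1 2) sum.remove[of _ k]) (auto simp: algebra_simps)
  have "peval a (lin (c(k := c k + s))) \<noteq> 0" if a: "a \<in> insert b A" for a
  proof (cases "a k = 0")
    case True
    with k a have "a \<in> A" by auto
    with c True show ?thesis by (simp add: p)
  next
    case False
    have "s \<noteq> - peval a (lin c) / a k" using s a by blast
    with False have "peval a (lin c) + s * a k \<noteq> 0" by (auto simp: field_simps add_eq_0_iff)
    then show ?thesis unfolding p .
  qed
  then show ?case by blast
qed simp

lemma linear_form_avoiding_zeros:
  fixes K :: "('v::finite, 'a::alg_closed_field) mpol set"
  assumes "finite Z" and "\<And>Q. Q \<in> Z \<Longrightarrow> \<exists>a i. a i = 1 \<and> Q = hpt a"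
  shows "\<exists>c :: 'v \<Rightarrow> 'a. \<forall>Q\<in>Z. lin c \<notin> Q"
proof -
  define pt where "pt Q = (SOME a. \<exists>i. a i = (1::'a) \<and> Q = hpt a)" for Q :: "('v, 'a) mpol set"
  have pt: "\<exists>i. pt Q i = 1" "Q = hpt (pt Q)" if "Q \<in> Z" for Q
    using someI_ex[of "\<lambda>a. \<exists>i. a i = (1::'a) \<and> Q = hpt a"] assms(2)[OF that] unfolding pt_def by auto
  have "\<exists>c. \<forall>a\<in>pt ` Z. peval a (lin c) \<noteq> 0"
    by (rule exists_form_avoiding) (use assms(1) pt(1) in \<open>auto, metis zero_neq_one\<close>)
  then obtain c where c: "\<And>Q. Q \<in> Z \<Longrightarrow> peval (pt Q) (lin c) \<noteq> 0" by auto
  have "lin c \<notin> Q" if "Q \<in> Z" for Q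
    using c[OF that] hpt_subset[of "lin c" "pt Q"] pt(2)[OF that] by auto
  then show ?thesis by blast
qed

text \<open>Finitely many closed points are avoided by one linear form. Then \<open>P\<close> would
  be a single rational point, of dimension zero.\<close>

lemma infinite_zeros_curve:
  fixes P :: "('v::finite, 'a::alg_closed_field) mpol set"
  assumes P: "P \<in> proj_points" and d: "chain_dim (zeros P) = enat 1"
  shows "infinite (zeros P)"
proof
  assume "finite (zeros P)"
  then have "finite (closed_points P)" by (rule rev_finite_subset) (auto simp: closed_points_def)
  then obtain c :: "'v \<Rightarrow> 'a" where c: "\<And>Q. Q \<in> closed_points P \<Longrightarrow> lin c \<notin> Q"
    using linear_form_avoiding_zeros[of "closed_points P"] closed_point_hpt[of _ P] by (metis (no_types, lifting))
  have hP: "homogeneous_ideal P" using P by (simp add: proj_points_iff)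
  have "zeros (rmod.span (insert (lin c) P)) = {}"
  proof (rule ccontr)
    assume "\<not> ?thesis"
    then obtain R where R: "R \<in> zeros (rmod.span (insert (lin c) P))" by blast
    have *: "insert (lin c) P \<subseteq> R" using zerosD(2)[OF R] rmod.span_superset[of "insert (lin c) P"] by blast
    then have "R \<in> zeros P" using zerosD(1)[OF R] by (auto simp: zeros_def)
    then obtain Q where "Q \<in> closed_points P" "R \<subseteq> Q" by (rule exists_closed_point)
    with c * show False by blast
  qed
  from zeros_empty_imp_powers[OF homogeneous_ideal_span_insert[OF hP homogeneous_lin] this]
  obtain N where N: "\<And>j. mvar j ^ N \<in> rmod.span (insert (lin c) P)" by blast
  obtain i where "mvar i \<notin> P" using P by (auto simp: proj_points_iff)
  from rational_of_powers[OF P this homogeneous_lin _ N] obtain a where "a i = 1" "P = hpt a" by auto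
  with chain_dim_hpt d show False by blast
qed

text \<open>Evaluate along an infinite sequence of distinct zeros: the preimage of a prime ideal of
  \<open>k\<^sup>\<nat>\<close> containing the finitely supported sequences is a further zero of \<open>K\<close>. As it is rational,
  all but finitely many terms of the sequence coincide with it.\<close>

lemma finite_zeros_of_rational:
  fixes K :: "('v::finite, 'a::alg_closed_field) mpol set"
  assumes K: "homogeneous_ideal K"
    and rat: "\<And>P i. P \<in> zeros K \<Longrightarrow> mvar i \<notin> P \<Longrightarrow> \<exists>a. a i = 1 \<and> P = hpt a"
  shows "finite (zeros K)"
proof (rule ccontr)
  assume inf: "infinite (zeros K)"
  have "zeros K = (\<Union>i\<in>UNIV. {P \<in> zeros K. mvar i \<notin> P})"
    by (auto simp: zeros_def proj_points_iff)
  then obtain i where "infinite {P \<in> zeros K. mvar i \<notin> P}" using inf finite_UN[of UNIV "\<lambda>i. {P \<in> zeros K. mvar i \<notin> P}"] by auto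
  then obtain p :: "nat \<Rightarrow> ('v, 'a) mpol set" where p: "inj p" "range p \<subseteq> {P \<in> zeros K. mvar i \<notin> P}"
    using infinite_countable_subset by blast
  have "\<exists>a. a i = 1 \<and> p s = hpt a" for s by (rule rat) (use p(2) in blast)+
  then obtain A where A: "\<And>s. A s i = 1" "\<And>s. p s = hpt (A s)" by metis
  have injA: "inj A" using p(1) A(2) by (metis injI inj_def)
  \<comment> \<open>The constant sequence \<open>1\<close> is not finitely supported, so a prime
    ideal above \<open>J\<close> exists; modulo it, finitely many terms of a sequence are
    irrelevant.\<close>
  define J :: "(nat \<Rightarrow> 'a) set" where "J = {f. finite {s. f s \<noteq> 0}}"
  have "rmod.subspace J"
  proof (rule rmod.subspaceI)
    show "f + g \<in> J" if "f \<in> J" "g \<in> J" for f g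
    proof -
      have "{s. (f + g) s \<noteq> 0} \<subseteq> {s. f s \<noteq> 0} \<union> {s. g s \<noteq> 0}" by auto
      then show ?thesis using that unfolding J_def by (auto intro: finite_subset)
    qed
    show "c * f \<in> J" if "f \<in> J" for c f
      using that unfolding J_def by (auto elim: rev_finite_subset)
  qed (simp add: J_def)
  moreover have "1 ^ N \<notin> J" for N :: nat by (simp add: J_def)
  ultimately obtain M where M: "is_prime M" "J \<subseteq> M" using exists_prime_avoiding[of J 1] by blast
  note sM = subspace_of_prime[OF M(1)]
  define ev where "ev F = (\<lambda>s. peval (A s) F)" for F
  have ev: "ev 0 = 0" "ev 1 = 1" "ev (F + G) = ev F + ev G" "ev (F * G) = ev F * ev G" for F G
    by (auto simp: ev_def peval_simps)
  define Pm where "Pm = {F. ev F \<in> M}"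
  have sPm: "rmod.subspace Pm"
    by (auto simp: Pm_def rmod.subspace_def ev intro: rmod.subspace_0[OF sM] rmod.subspace_add[OF sM] rmod.subspace_scale[OF sM])
  have 1: "1 \<notin> M" using M(1) by (simp add: is_prime_def)
  have "is_prime (hpart Pm)"
    by (rule is_prime_hpart[OF sPm]) (use 1 in \<open>auto simp: Pm_def ev prime_mult_iff[OF M(1)]\<close>)
  moreover have "ev (mvar i) = 1" by (auto simp: ev_def A)
  then have i: "mvar i \<notin> Pm" using 1 by (simp add: Pm_def)
  then have i: "mvar i \<notin> hpart Pm" using hpart_subset[OF sPm] by blast
  moreover have "K \<subseteq> Pm"
  proof
    fix F assume F: "F \<in> K"
    have "ev F = 0"
    proof
      fix s
      have "p s \<in> zeros K" using p(2) by blast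
      then have "F \<in> hpt (A s)" using F zerosD(2) A(2) by blast
      then show "ev F s = 0 s" using hpt_subset by (simp add: ev_def)
    qed
    then show "F \<in> Pm" by (simp add: Pm_def rmod.subspace_0[OF sM])
  qed
  ultimately have "hpart Pm \<in> zeros K"
    using homogeneous_ideal_hpart[OF sPm] subset_hpart[OF K] by (auto simp: zeros_def proj_points_iff)
  from rat[OF this i] obtain q where q: "q i = 1" "hpart Pm = hpt q" by blast
  have "mvar j - mconst (q j) * mvar i \<in> Pm" for j
    using generator_in_hpt[of q i j, OF q(1)] q(2) hpart_subset[OF sPm] by blast
  then have f: "(\<lambda>s. A s j - q j) \<in> M" for j
    by (simp add: Pm_def ev_def peval_simps A)
  \<comment> \<open>For a term different from \<open>q\<close> a coordinate is selected in which
    they differ. Dividing by that difference combines the members \<open>f\<close> of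
    \<open>M\<close> into the indicator \<open>h\<close> of these terms. Since \<open>A\<close> is
    injective, \<open>1 - h\<close> has finite support, so both \<open>h\<close> and
    \<open>1 - h\<close> lie in \<open>M\<close>.\<close>
  define J' where "J' s = (SOME j. A s j \<noteq> q j)" for s
  have J': "A s (J' s) \<noteq> q (J' s)" if "A s \<noteq> q" for s
    using that unfolding J'_def by (intro someI_ex[of "\<lambda>j. A s j \<noteq> q j"]) auto
  define h where "h = (\<Sum>j\<in>UNIV. (\<lambda>s. if A s \<noteq> q \<and> J' s = j then inverse (A s j - q j) else 0) * (\<lambda>s. A s j - q j))"
  have hM: "h \<in> M" unfolding h_def by (intro rmod.subspace_sum[OF sM] rmod.subspace_scale[OF sM] f)
  have fun_sum: "(\<Sum>j\<in>B. g j) s = (\<Sum>j\<in>B. g j s)" for B :: "'v set" and g :: "'v \<Rightarrow> nat \<Rightarrow> 'a" and s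
    by (induction B rule: infinite_finite_induct) auto
  have h: "h s = (if A s \<noteq> q then 1 else 0)" for s
  proof -
    have "h s = (\<Sum>j\<in>UNIV. if J' s = j then (if A s \<noteq> q then inverse (A s j - q j) * (A s j - q j) else 0) else 0)"
      unfolding h_def fun_sum by (rule sum.cong) auto
    also have "\<dots> = (if A s \<noteq> q then inverse (A s (J' s) - q (J' s)) * (A s (J' s) - q (J' s)) else 0)" by simp
    also have "\<dots> = (if A s \<noteq> q then 1 else 0)" using J'[of s] by auto
    finally show ?thesis .
  qed
  have "finite {s. A s = q}"
    using finite_vimageI[OF _ injA, of "{q}"] by (simp add: vimage_def)
  moreover have "{s. (1 - h) s \<noteq> 0} = {s. A s = q}" by (auto simp: h)
  ultimately have "1 - h \<in> M" using M(2) by (auto simp: J_def)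
  from rmod.subspace_add[OF sM this hM] 1 show False by simp
qed

section \<open>Determinants over commutative rings\<close>

lemma det_diff_in_ideal:
  fixes A B :: "'a::comm_ring_1^'n^'n"
  assumes K: "rmod.subspace K" and AB: "\<And>i j. A $ i $ j - B $ i $ j \<in> K"
  shows "det A - det B \<in> K"
  unfolding det_def
proof (rule sum_diff_in_ideal[OF K])
  fix p :: "'n \<Rightarrow> 'n"
  have "(\<Prod>i\<in>UNIV. A $ i $ p i) - (\<Prod>i\<in>UNIV. B $ i $ p i) \<in> K"
    by (rule prod_diff_in_ideal[OF K AB])
  from rmod.subspace_scale[OF K this, of "of_int (sign p)"]
  show "of_int (sign p) * (\<Prod>i\<in>UNIV. A $ i $ p i) - of_int (sign p) * (\<Prod>i\<in>UNIV. B $ i $ p i) \<in> K"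
    by (simp only: right_diff_distrib)
qed

text \<open>Both determinants are the entry at \<open>l\<close>, \<open>k\<close> times the same
  cofactor, for \<open>A\<close> by its column \<open>k\<close> and for \<open>B\<close> by its row
  \<open>l\<close>. In the Leibniz sums only permutations with \<open>p l = k\<close>
  contribute.\<close>

lemma det_eq_minor:
  fixes A B :: "'a::comm_ring_1^'n^'n"
  assumes eq: "\<And>i j. i \<noteq> l \<Longrightarrow> j \<noteq> k \<Longrightarrow> A $ i $ j = B $ i $ j" and kk: "A $ l $ k = B $ l $ k"
    and A: "\<And>i. i \<noteq> l \<Longrightarrow> A $ i $ k = 0" and B: "\<And>j. j \<noteq> k \<Longrightarrow> B $ l $ j = 0"
  shows "det A = det B"
  unfolding det_def
proof (rule sum.cong)
  fix p assume "p \<in> {p. p permutes (UNIV :: 'n set)}"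
  then have p: "p permutes UNIV" by simp
  have "(\<Prod>i\<in>UNIV. A $ i $ p i) = (\<Prod>i\<in>UNIV. B $ i $ p i)"
  proof (cases "p l = k")
    case True
    have "A $ i $ p i = B $ i $ p i" for i
    proof (cases "i = l")
      case False
      then have "p i \<noteq> k" using True permutes_inj[OF p] by (metis injD)
      with False show ?thesis by (rule eq)
    qed (simp add: True kk)
    then show ?thesis by simp
  next
    case False
    obtain i where i: "p i = k" using permutes_surj[OF p] by (metis surj_def)
    with False have "i \<noteq> l" by auto
    with i A have "A $ i $ p i = 0" by simp
    then have "(\<Prod>i\<in>UNIV. A $ i $ p i) = 0" by (intro prod_zero) auto
    moreover have "(\<Prod>i\<in>UNIV. B $ i $ p i) = 0" using B[OF False] by (intro prod_zero) auto
    ultimately show ?thesis by simp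
  qed
  then show "of_int (sign p) * (\<Prod>i\<in>UNIV. A $ i $ p i) = of_int (sign p) * (\<Prod>i\<in>UNIV. B $ i $ p i)" by simp
qed simp

text \<open>The matrix on the left is \<open>A\<close> times the identity matrix with column
  \<open>k\<close> replaced by \<open>x\<close>, and the latter has determinant \<open>x k\<close>.
  No inverse of \<open>A\<close> is involved.\<close>

lemma cramer_comm_ring:
  fixes A :: "'a::comm_ring_1^'n^'n"
  shows "det (\<chi> i j. if j = k then (\<Sum>s\<in>UNIV. A $ i $ s * x s) else A $ i $ j) = x k * det A"
proof -
  define E :: "'a^'n^'n" where "E = (\<chi> i j. if j = k then x i else if i = j then 1 else 0)"
  define D :: "'a^'n^'n" where "D = (\<chi> i j. if i = j then (if i = k then x k else 1) else 0)"
  have "det E = det D"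
    by (rule det_eq_minor[symmetric, where k = k and l = k]) (auto simp: D_def E_def)
  also have "\<dots> = (\<Prod>i\<in>UNIV. D $ i $ i)" by (rule det_diagonal) (simp add: D_def)
  also have "\<dots> = x k" by (simp add: D_def)
  finally have E: "det E = x k" .
  have "(\<chi> i j. if j = k then (\<Sum>s\<in>UNIV. A $ i $ s * x s) else A $ i $ j) = A ** E"
  proof -
    have "(\<Sum>s\<in>UNIV. A $ i $ s * E $ s $ j) = (if j = k then (\<Sum>s\<in>UNIV. A $ i $ s * x s) else A $ i $ j)" for i j
    proof (cases "j = k")
      case False
      then have "(\<Sum>s\<in>UNIV. A $ i $ s * E $ s $ j) = (\<Sum>s\<in>UNIV. if s = j then A $ i $ s else 0)"
        by (intro sum.cong) (auto simp: E_def)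
      with False show ?thesis by simp
    qed (simp add: E_def)
    then show ?thesis by (simp add: vec_eq_iff matrix_matrix_mult_def)
  qed
  then show ?thesis by (simp add: det_mul E mult.commute)
qed

section \<open>Systems of parameters are regular\<close>

definition positive_forms :: "('v::finite \<Rightarrow> ('v, 'a::comm_ring_1) mpol) \<Rightarrow> bool" where
  "positive_forms x \<longleftrightarrow> (\<forall>r. \<exists>\<delta>>0. homogeneous \<delta> (x r))"

text \<open>Regularity in every order and for every subfamily; this symmetric form allows members to
  be exchanged one at a time.\<close>

definition regular_system :: "('v::finite \<Rightarrow> ('v, 'a::comm_ring_1) mpol) \<Rightarrow> bool" where
  "regular_system x \<longleftrightarrow> (\<forall>T k s. k \<notin> T \<longrightarrow> x k * s \<in> rmod.span (x ` T) \<longrightarrow> s \<in> rmod.span (x ` T))"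

lemma regular_systemD:
  "regular_system x \<Longrightarrow> k \<notin> T \<Longrightarrow> x k * s \<in> rmod.span (x ` T) \<Longrightarrow> s \<in> rmod.span (x ` T)"
  unfolding regular_system_def by blast

lemma lookup_mvar_mult:
  "Poly_Mapping.lookup (mvar k * F) (\<alpha> + Poly_Mapping.single k 1) = Poly_Mapping.lookup F \<alpha>"
proof (induction F rule: mpol_induct)
  case (single \<beta> c)
  have "Poly_Mapping.single k 1 + \<beta> = \<alpha> + Poly_Mapping.single k 1 \<longleftrightarrow> \<beta> = \<alpha>"
    by (metis add.commute add_right_cancel)
  then show ?case by (simp add: mvar_def mult_single lookup_single)
qed (simp add: lookup_add distrib_left)

lemma in_span_mvar_iff:
  "F \<in> rmod.span (mvar ` T) \<longleftrightarrow> (\<forall>\<alpha>\<in>Poly_Mapping.keys F. \<exists>j\<in>T. Poly_Mapping.lookup \<alpha> (j::'v::finite) > 0)"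
proof
  assume "F \<in> rmod.span (mvar ` T)"
  then show "\<forall>\<alpha>\<in>Poly_Mapping.keys F. \<exists>j\<in>T. Poly_Mapping.lookup \<alpha> j > 0"
  proof (induction rule: rmod.span_induct_alt)
    case (step c x y)
    then obtain j where j: "j \<in> T" "x = mvar j" by auto
    show ?case
    proof
      fix \<alpha> assume "\<alpha> \<in> Poly_Mapping.keys (c * x + y)"
      then consider "\<alpha> \<in> Poly_Mapping.keys (c * x)" | "\<alpha> \<in> Poly_Mapping.keys y"
        using keys_add[of "c * x" y] by blast
      then show "\<exists>j\<in>T. Poly_Mapping.lookup \<alpha> j > 0"
      proof cases
        case 1
        then obtain \<beta> where "\<alpha> = \<beta> + Poly_Mapping.single j 1"
          using keys_mult[of c x] unfolding j mvar_def by auto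
        with j(1) show ?thesis by (intro bexI[of _ j]) (auto simp: lookup_add)
      qed (use step in blast)
    qed
  qed simp
next
  assume F: "\<forall>\<alpha>\<in>Poly_Mapping.keys F. \<exists>j\<in>T. Poly_Mapping.lookup \<alpha> j > 0"
  have "Poly_Mapping.single \<alpha> c \<in> rmod.span (mvar ` T)" if "j \<in> T" "Poly_Mapping.lookup \<alpha> j > 0" for \<alpha> c j
  proof -
    have "\<alpha> = (\<alpha> - Poly_Mapping.single j 1) + Poly_Mapping.single j 1"
      using that(2) by (auto simp: poly_mapping_eq_iff fun_eq_iff lookup_add lookup_minus lookup_single when_def)
    then have "Poly_Mapping.single \<alpha> c = Poly_Mapping.single (\<alpha> - Poly_Mapping.single j 1) c * mvar j"
      by (simp add: mvar_def mult_single)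
    then show ?thesis using that(1) by (auto intro: rmod.span_scale rmod.span_base)
  qed
  then have "(\<Sum>\<alpha>\<in>Poly_Mapping.keys F. Poly_Mapping.single \<alpha> (Poly_Mapping.lookup F \<alpha>)) \<in> rmod.span (mvar ` T)"
    using F by (intro rmod.span_sum) blast
  then show "F \<in> rmod.span (mvar ` T)" by (simp add: mpol_sum_single)
qed

lemma regular_system_mvar: "regular_system (mvar :: 'v::finite \<Rightarrow> ('v, 'a::comm_ring_1) mpol)"
  unfolding regular_system_def in_span_mvar_iff
proof (intro allI impI ballI)
  fix T k and s :: "('v, 'a) mpol" and \<alpha>
  assume k: "k \<notin> T" and *: "\<forall>\<alpha>\<in>Poly_Mapping.keys (mvar k * s). \<exists>j\<in>T. 0 < Poly_Mapping.lookup \<alpha> j"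
    and \<alpha>: "\<alpha> \<in> Poly_Mapping.keys s"
  then have "\<alpha> + Poly_Mapping.single k 1 \<in> Poly_Mapping.keys (mvar k * s)"
    by (simp add: in_keys_iff lookup_mvar_mult del: One_nat_def)
  with * obtain j where "j \<in> T" "0 < Poly_Mapping.lookup (\<alpha> + Poly_Mapping.single k 1) j" by blast
  with k show "\<exists>j\<in>T. 0 < Poly_Mapping.lookup \<alpha> j"
    by (intro bexI[of _ j]) (auto simp: lookup_add lookup_single when_def split: if_splits)
qed

lemma homogeneous_ideal_span_forms: "positive_forms x \<Longrightarrow> homogeneous_ideal (rmod.span (x ` T))"
  by (rule homogeneous_ideal_span) (auto simp: positive_forms_def)

lemma in_span_insert_span_iff: "F \<in> rmod.span (insert x B) \<longleftrightarrow> (\<exists>c. F - c * x \<in> rmod.span B)"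
  by (simp add: rmod.span_insert)

lemma range_fun_upd_span: "range (x(k := z)) = insert z (x ` (- {k}))"
  by auto

text \<open>Modulo the forms other than \<open>x k\<close>, some power of \<open>x k\<close> is a
  multiple of \<open>z\<close>. As \<open>x k\<close> is a nonzerodivisor there, so is
  \<open>z\<close>. The property then descends to smaller subfamilies by an induction on degrees in
  the style of Nakayama's lemma.\<close>

lemma regular_system_exchange:
  fixes x :: "'v::finite \<Rightarrow> ('v, 'a::comm_ring_1) mpol"
  assumes x: "regular_system x" "positive_forms x" and z: "homogeneous \<epsilon> z"
    and fin: "\<And>j. mvar j ^ N \<in> rmod.span (insert z (x ` (- {k})))"
  shows "regular_system (x(k := z))"
proof -
  have full: "s \<in> rmod.span (x ` (- {k}))" if zs: "z * s \<in> rmod.span (x ` (- {k}))" for s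
  proof -
    let ?L = "rmod.span (x ` (- {k}))"
    obtain \<delta> where \<delta>: "0 < \<delta>" "homogeneous \<delta> (x k)" using x(2) unfolding positive_forms_def by blast
    define M where "M = Suc (N * CARD('v))"
    have "x k ^ M \<in> rmod.span (insert z (x ` (- {k})))"
    proof (rule high_degree_in_ideal[OF rmod.subspace_span fin homogeneous_power[OF \<delta>(2)]])
      have "M \<le> \<delta> * M" using \<delta>(1) by simp
      then show "N * CARD('v) \<le> \<delta> * M" by (simp add: M_def)
    qed (use \<delta>(1) in \<open>simp add: M_def\<close>)
    then obtain c where c: "x k ^ M - c * z \<in> ?L" by (auto simp: in_span_insert_span_iff)
    have "x k ^ M * s = s * (x k ^ M - c * z) + c * (z * s)" by (simp add: algebra_simps)
    also have "\<dots> \<in> ?L" by (rule rmod.span_add[OF rmod.span_scale[OF c] rmod.span_scale[OF zs]])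
    finally have "x k ^ M * s \<in> ?L" .
    then show "s \<in> ?L"
    proof (induction M)
      case (Suc M)
      have "x k * (x k ^ M * s) \<in> ?L" using Suc.prems by (simp add: mult.assoc)
      then have "x k ^ M * s \<in> ?L" by (rule regular_systemD[OF x(1), rotated]) simp
      then show ?case by (rule Suc.IH)
    qed simp
  qed
  \<comment> \<open>The subfamily shrinks by one form \<open>x j\<close> at a time, beginning with
    the complement of \<open>k\<close>.\<close>
  have step: "s \<in> rmod.span (x ` T)" if "k \<notin> T" "z * s \<in> rmod.span (x ` T)" for T s
    using that
  proof (induction "card (- insert k T)" arbitrary: T s)
    case 0
    then have "T = - {k}" by auto
    with full 0 show ?case by simp
  next
    case (Suc n)
    then obtain j where j: "j \<noteq> k" "j \<notin> T" by (metis Compl_iff card.empty ex_in_conv insertCI nat.distinct(1))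
    have card: "n = card (- insert k (insert j T))"
    proof -
      have "- insert k T = insert j (- insert k (insert j T))" using j by auto
      then have "card (- insert k T) = Suc (card (- insert k (insert j T)))" by (metis ComplD card_insert_disjoint finite insertCI)
      with Suc.hyps(2) show ?thesis by simp
    qed
    have big: "s \<in> rmod.span (x ` insert j T)" if "z * s \<in> rmod.span (x ` insert j T)" for s
      using Suc.hyps(1)[OF card] that j Suc.prems(1) by blast
    let ?L = "rmod.span (x ` T)"
    have hL: "homogeneous_ideal ?L" by (rule homogeneous_ideal_span_forms[OF x(2)])
    obtain \<delta> where \<delta>: "0 < \<delta>" "homogeneous \<delta> (x j)" using x(2) unfolding positive_forms_def by blast
    \<comment> \<open>Modulo \<open>?L\<close> the form \<open>s\<close> is a multiple
      \<open>c' * x j\<close>. Cancelling \<open>x j\<close> shows that \<open>z * c'\<close> lies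
      in \<open>?L\<close>, and \<open>c'\<close> has smaller degree because \<delta> is
      positive.\<close>
    have hom: "s \<in> ?L" if "homogeneous d s" "z * s \<in> ?L" for d s
      using that
    proof (induction d arbitrary: s rule: less_induct)
      case (less d)
      have "?L \<subseteq> rmod.span (x ` insert j T)" by (rule rmod.span_mono) auto
      then have "z * s \<in> rmod.span (x ` insert j T)" using less.prems(2) by blast
      then have "s \<in> rmod.span (x ` insert j T)" by (rule big)
      then obtain c where c: "s - c * x j \<in> ?L" by (auto simp: in_span_insert_span_iff)
      have sc: "s - hom_component d (c * x j) \<in> ?L"
        using hom_component_in[OF hL c, of d] by (simp add: hom_component_diff hom_component_homogeneous[OF less.prems(1)])
      show ?case
      proof (cases "\<delta> \<le> d")
        case False
        with sc show ?thesis by (simp add: hom_component_mult_homogeneous[OF \<delta>(2)])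
      next
        case True
        define c' where "c' = hom_component (d - \<delta>) c"
        have sc': "s - c' * x j \<in> ?L" using sc True by (simp add: hom_component_mult_homogeneous[OF \<delta>(2)] c'_def)
        have "x j * (z * c') = z * s - z * (s - c' * x j)" by (simp add: algebra_simps)
        also have "\<dots> \<in> ?L" by (rule rmod.span_diff[OF less.prems(2) rmod.span_scale[OF sc']])
        finally have "z * c' \<in> ?L" by (rule regular_systemD[OF x(1) j(2)])
        then have "c' \<in> ?L"
          using less.IH[of "d - \<delta>" c'] \<delta>(1) True by (simp add: c'_def homogeneous_hom_component)
        then have "x j * c' \<in> ?L" by (rule rmod.span_scale)
        from rmod.span_add[OF sc' this] show ?thesis by (simp add: mult.commute)
      qed
    qed
    show ?case
    proof (rule in_subspace_of_components[OF rmod.subspace_span])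
      fix e
      have "hom_component (e + \<epsilon>) (s * z) \<in> ?L"
        using hom_component_in[OF hL Suc.prems(2)] by (simp add: mult.commute)
      then have "z * hom_component e s \<in> ?L"
        by (simp add: hom_component_mult_homogeneous[OF z] mult.commute)
      then show "hom_component e s \<in> ?L" by (rule hom[OF homogeneous_hom_component])
    qed
  qed
  show ?thesis
    unfolding regular_system_def
  proof (intro allI impI)
    fix T r s
    assume r: "r \<notin> T" and rs: "(x(k := z)) r * s \<in> rmod.span ((x(k := z)) ` T)"
    show "s \<in> rmod.span ((x(k := z)) ` T)"
    proof (cases "k \<in> T")
      case False
      then have im: "(x(k := z)) ` T = x ` T" by auto
      show ?thesis
      proof (cases "r = k")
        case True
        with step[OF False] rs im show ?thesis by simp
      next
        case False
        with regular_systemD[OF x(1) r] rs im show ?thesis by simp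
      qed
    next
      case True
      \<comment> \<open>Now \<open>z\<close> is among the generators and \<open>x r\<close> is to be
        cancelled. The coefficient \<open>c\<close> of \<open>z\<close> turns out to be a multiple
        of \<open>x r\<close>, after which regularity of the old system applies.\<close>
      with r have rk: "r \<noteq> k" by auto
      define U where "U = T - {k}"
      have T: "T = insert k U" "k \<notin> U" using True by (auto simp: U_def)
      have im: "(x(k := z)) ` T = insert z (x ` U)" using T by auto
      let ?L = "rmod.span (x ` U)"
      have "x r * s \<in> rmod.span (insert z (x ` U))" using rs rk unfolding im by simp
      then obtain c where c: "x r * s - c * z \<in> ?L" by (auto simp: in_span_insert_span_iff)
      have "z * c - s * x r = - (x r * s - c * z)" by (simp add: algebra_simps)
      with rmod.span_neg[OF c] have "z * c - s * x r \<in> ?L" by metis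
      then have "z * c \<in> rmod.span (x ` insert r U)" by (auto simp: in_span_insert_span_iff)
      then have "c \<in> rmod.span (x ` insert r U)" by (rule step[rotated]) (use rk T in auto)
      then obtain c' where c': "c - c' * x r \<in> ?L" by (auto simp: in_span_insert_span_iff)
      have "x r * (s - c' * z) = (x r * s - c * z) + z * (c - c' * x r)" by (simp add: algebra_simps)
      also have "\<dots> \<in> ?L" by (rule rmod.span_add[OF c rmod.span_scale[OF c']])
      finally have "s - c' * z \<in> ?L" by (rule regular_systemD[OF x(1), rotated]) (use r T in auto)
      then show ?thesis unfolding im in_span_insert_span_iff by blast
    qed
  qed
qed

section \<open>Deforming a system of parameters into linear forms\<close>

lemma finite_zeros_of_system:
  fixes x :: "'v::finite \<Rightarrow> ('v, 'a::alg_closed_field) mpol"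
  assumes x: "positive_forms x" and z: "zeros (rmod.span (range x)) = {}"
  shows "finite (zeros (rmod.span (x ` (- {k}))))"
    and "P \<in> zeros (rmod.span (x ` (- {k}))) \<Longrightarrow> mvar i \<notin> P \<Longrightarrow> \<exists>a. a i = 1 \<and> P = hpt a"
proof -
  obtain \<delta> where \<delta>: "0 < \<delta>" "homogeneous \<delta> (x k)" using x unfolding positive_forms_def by blast
  obtain N where N: "\<And>j. mvar j ^ N \<in> rmod.span (range x)"
    using zeros_empty_imp_powers[OF homogeneous_ideal_span_forms[OF x] z] by blast
  show rat: "\<exists>a. a i = 1 \<and> P = hpt a" if P: "P \<in> zeros (rmod.span (x ` (- {k})))" "mvar i \<notin> P" for P i
  proof (rule rational_of_powers[OF zerosD(1)[OF P(1)] P(2) \<delta>(2,1)])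
    have "range x \<subseteq> rmod.span (insert (x k) P)"
    proof
      fix f assume "f \<in> range x"
      then obtain r where r: "f = x r" by blast
      have "x r \<in> insert (x k) P" if "r \<noteq> k"
        using zerosD(2)[OF P(1)] rmod.span_superset[of "x ` (- {k})"] that by auto
      then show "f \<in> rmod.span (insert (x k) P)" unfolding r by (cases "r = k") (auto intro: rmod.span_base)
    qed
    then have "rmod.span (range x) \<subseteq> rmod.span (insert (x k) P)"
      by (simp add: rmod.span_minimal rmod.subspace_span)
    with N show "mvar j ^ N \<in> rmod.span (insert (x k) P)" for j by blast
  qed
  show "finite (zeros (rmod.span (x ` (- {k}))))"
    by (rule finite_zeros_of_rational[OF homogeneous_ideal_span_forms[OF x] rat])
qed

text \<open>Without the form at \<open>k\<close> either system has finitely many zeros, all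
  rational, and one linear form avoids them all. It has to be common to both systems because their
  paths are to end in the same linear forms.\<close>

lemma exists_linear_exchange:
  fixes x y :: "'v::finite \<Rightarrow> ('v, 'a::alg_closed_field) mpol"
  assumes x: "positive_forms x" "zeros (rmod.span (range x)) = {}"
    and y: "positive_forms y" "zeros (rmod.span (range y)) = {}"
  shows "\<exists>c. zeros (rmod.span (range (x(k := lin c)))) = {} \<and> zeros (rmod.span (range (y(k := lin c)))) = {}"
proof -
  let ?Z = "\<lambda>x::'v \<Rightarrow> ('v, 'a) mpol. zeros (rmod.span (x ` (- {k})))"
  have "finite (?Z x \<union> ?Z y)" using finite_zeros_of_system(1)[OF x] finite_zeros_of_system(1)[OF y] by blast
  moreover have "\<exists>a i. a i = 1 \<and> Q = hpt a" if Q: "Q \<in> ?Z x \<union> ?Z y" for Q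
  proof -
    obtain i where "mvar i \<notin> Q" using Q by (auto simp: zeros_def proj_points_iff)
    then have "\<exists>a. a i = 1 \<and> Q = hpt a"
      using Q finite_zeros_of_system(2)[OF x, of Q k i] finite_zeros_of_system(2)[OF y, of Q k i] by (elim UnE)
    then show ?thesis by blast
  qed
  ultimately have "\<exists>c :: 'v \<Rightarrow> 'a. \<forall>Q\<in>?Z x \<union> ?Z y. lin c \<notin> Q" by (rule linear_form_avoiding_zeros)
  then obtain c :: "'v \<Rightarrow> 'a" where c: "\<And>Q. Q \<in> ?Z x \<union> ?Z y \<Longrightarrow> lin c \<notin> Q" by blast
  have "zeros (rmod.span (range (w(k := lin c)))) = {}" if w: "?Z w \<subseteq> ?Z x \<union> ?Z y" for w
  proof (rule ccontr)
    assume "\<not> ?thesis"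
    then obtain R where R: "R \<in> zeros (rmod.span (range (w(k := lin c))))" by blast
    have "rmod.span (w ` (- {k})) \<subseteq> rmod.span (range (w(k := lin c)))"
      by (rule rmod.span_mono) auto
    then have "R \<in> ?Z w" using R by (auto simp: zeros_def)
    moreover have "lin c \<in> R"
      using zerosD(2)[OF R] rmod.span_base[of "lin c" "range (w(k := lin c))"] by (auto simp: range_fun_upd_span)
    ultimately show False using c w by blast
  qed
  then show ?thesis by blast
qed

text \<open>The stage of the deformation at which the members indexed by \<open>T\<close> have
  become linear.\<close>

definition mix :: "('v::finite \<Rightarrow> 'v \<Rightarrow> 'a) \<Rightarrow> 'v set \<Rightarrow> ('v \<Rightarrow> ('v, 'a::comm_ring_1) mpol) \<Rightarrow> 'v \<Rightarrow> ('v, 'a) mpol" where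
  "mix l T x = (\<lambda>r. if r \<in> T then lin (l r) else x r)"

lemma mix_insert: "k \<notin> T \<Longrightarrow> mix (l(k := c)) (insert k T) x = (mix l T x)(k := lin c)"
  by (auto simp: mix_def fun_eq_iff)

lemma positive_forms_mix: "positive_forms x \<Longrightarrow> positive_forms (mix l T x)"
  using homogeneous_lin unfolding positive_forms_def mix_def by (metis zero_less_one)

lemma positive_forms_mvar: "positive_forms mvar"
  unfolding positive_forms_def using homogeneous_mvar zero_less_one by blast

lemma zeros_span_mvar: "zeros (rmod.span (range mvar)) = {}"
  by (rule zeros_empty_of_powers) (metis power_one_right rangeI rmod.span_base)

lemma exists_linear_path:
  fixes x y :: "'v::finite \<Rightarrow> ('v, 'a::alg_closed_field) mpol"
  assumes x: "positive_forms x" "zeros (rmod.span (range x)) = {}"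
    and y: "positive_forms y" "zeros (rmod.span (range y)) = {}"
  shows "distinct ks \<Longrightarrow> \<exists>l. \<forall>j\<le>length ks.
    zeros (rmod.span (range (mix l (set (take j ks)) x))) = {} \<and>
    zeros (rmod.span (range (mix l (set (take j ks)) y))) = {}"
proof (induction ks rule: rev_induct)
  case Nil
  then show ?case using x y by (simp add: mix_def)
next
  case (snoc k ks)
  then obtain l where l: "\<And>j. j \<le> length ks \<Longrightarrow> zeros (rmod.span (range (mix l (set (take j ks)) x))) = {}"
    "\<And>j. j \<le> length ks \<Longrightarrow> zeros (rmod.span (range (mix l (set (take j ks)) y))) = {}" by auto
  have k: "k \<notin> set ks" using snoc.prems by simp
  have "zeros (rmod.span (range (mix l (set ks) x))) = {}" "zeros (rmod.span (range (mix l (set ks) y))) = {}"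
    using l[of "length ks"] by simp_all
  from exists_linear_exchange[OF positive_forms_mix[OF x(1)] this(1) positive_forms_mix[OF y(1)] this(2), of k]
  obtain c where
    c: "zeros (rmod.span (range ((mix l (set ks) x)(k := lin c)))) = {}"
      "zeros (rmod.span (range ((mix l (set ks) y)(k := lin c)))) = {}"
    by blast
  have m: "mix (l(k := c)) (set (take j ks)) w = mix l (set (take j ks)) w" for j w
  proof -
    have "k \<notin> set (take j ks)" using k set_take_subset[of j ks] by blast
    then show ?thesis by (auto simp: mix_def fun_eq_iff)
  qed
  show ?case
  proof (intro exI[of _ "l(k := c)"] allI impI)
    fix j assume j: "j \<le> length (ks @ [k])"
    show "zeros (rmod.span (range (mix (l(k := c)) (set (take j (ks @ [k]))) x))) = {} \<and>
      zeros (rmod.span (range (mix (l(k := c)) (set (take j (ks @ [k]))) y))) = {}"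
    proof (cases "j \<le> length ks")
      case True
      with l m show ?thesis by simp
    next
      case False
      then have "set (take j (ks @ [k])) = insert k (set ks)" using j by auto
      then show ?thesis using c unfolding \<open>set (take j (ks @ [k])) = insert k (set ks)\<close> mix_insert[OF k] by blast
    qed
  qed
qed

lemma regular_system_fun_upd:
  fixes x :: "'v::finite \<Rightarrow> ('v, 'a::comm_ring_1) mpol"
  assumes "regular_system x" "positive_forms x" "positive_forms (x(k := z))"
    and "zeros (rmod.span (range (x(k := z)))) = {}"
  shows "regular_system (x(k := z))"
proof -
  obtain N where N: "\<And>j. mvar j ^ N \<in> rmod.span (range (x(k := z)))"
    using zeros_empty_imp_powers[OF homogeneous_ideal_span_forms[OF assms(3)] assms(4)] by blast
  obtain \<epsilon> where "homogeneous \<epsilon> z" using assms(3) unfolding positive_forms_def by (metis fun_upd_same)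
  from regular_system_exchange[OF assms(1,2) this] N show ?thesis by (metis range_fun_upd_span)
qed

text \<open>Regularity is known for the variables. It travels along their path to the linear forms,
  and from there backwards along the path of \<open>x\<close>, which ends in the same linear
  forms.\<close>

lemma linear_path_regular:
  fixes x :: "'v::finite \<Rightarrow> ('v, 'a::alg_closed_field) mpol"
  assumes x: "positive_forms x" "zeros (rmod.span (range x)) = {}"
  obtains l ks where "distinct ks" "set ks = UNIV"
    "\<And>j. j \<le> length ks \<Longrightarrow> regular_system (mix l (set (take j ks)) x)"
    "zeros (rmod.span (range (\<lambda>r. lin (l r)))) = {}"
proof -
  obtain ks where ks: "set ks = (UNIV :: 'v set)" "distinct ks" using finite_distinct_list[of "UNIV :: 'v set"] by auto
  from exists_linear_path[OF x positive_forms_mvar zeros_span_mvar ks(2)]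
  obtain l where l: "\<And>j. j \<le> length ks \<Longrightarrow> zeros (rmod.span (range (mix l (set (take j ks)) x))) = {}"
      "\<And>j. j \<le> length ks \<Longrightarrow> zeros (rmod.span (range (mix l (set (take j ks)) mvar))) = {}" by auto
  have take_Suc: "set (take (Suc j) ks) = insert (ks ! j) (set (take j ks))" "ks ! j \<notin> set (take j ks)" if "j < length ks" for j
  proof -
    show "set (take (Suc j) ks) = insert (ks ! j) (set (take j ks))" using that by (simp add: take_Suc_conv_app_nth)
    have "distinct (take (Suc j) ks)" using ks(2) by simp
    then show "ks ! j \<notin> set (take j ks)" using that by (simp add: take_Suc_conv_app_nth)
  qed
  have mS: "mix l (set (take (Suc j) ks)) w = (mix l (set (take j ks)) w)(ks ! j := lin (l (ks ! j)))"
    if "j < length ks" for j w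
    using mix_insert[OF take_Suc(2)[OF that], of l "l (ks ! j)" w] take_Suc(1)[OF that] by simp
  have mS': "mix l (set (take j ks)) w = (mix l (set (take (Suc j) ks)) w)(ks ! j := w (ks ! j))"
    if "j < length ks" for j w
    using take_Suc(2)[OF that] unfolding mS[OF that] by (auto simp: mix_def fun_eq_iff)
  have "regular_system (mix l (set (take j ks)) mvar)" if "j \<le> length ks" for j
    using that
  proof (induction j)
    case 0
    show ?case by (simp add: mix_def regular_system_mvar)
  next
    case (Suc j)
    then have j: "j < length ks" by simp
    show ?case unfolding mS[OF j]
      by (rule regular_system_fun_upd) (use Suc l(2)[OF Suc.prems] positive_forms_mix[OF positive_forms_mvar, of l "set (take (Suc j) ks)"]
        in \<open>auto simp: mS[OF j] intro: positive_forms_mix[OF positive_forms_mvar]\<close>)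
  qed
  from this[of "length ks"] ks(1) have reg: "regular_system (\<lambda>r. lin (l r))" by (simp add: mix_def)
  \<comment> \<open>\<open>i\<close> counts the steps back from the linear end; truncated
    subtraction makes the claim constant once \<open>x\<close> is reached.\<close>
  have "regular_system (mix l (set (take (length ks - i) ks)) x)" for i
  proof (induction i)
    case 0
    show ?case using reg ks(1) by (simp add: mix_def)
  next
    case (Suc i)
    show ?case
    proof (cases "i < length ks")
      case True
      then have j: "length ks - Suc i < length ks" and Sj: "Suc (length ks - Suc i) = length ks - i" by auto
      show ?thesis unfolding mS'[OF j] Sj
      proof (rule regular_system_fun_upd[OF Suc positive_forms_mix[OF x(1)]])
        show "positive_forms ((mix l (set (take (length ks - i) ks)) x)(ks ! (length ks - Suc i) := x (ks ! (length ks - Suc i))))"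
          using positive_forms_mix[OF x(1), of l "set (take (length ks - Suc i) ks)"] unfolding mS'[OF j] Sj .
        show "zeros (rmod.span (range ((mix l (set (take (length ks - i) ks)) x)(ks ! (length ks - Suc i) := x (ks ! (length ks - Suc i)))))) = {}"
          using l(1)[of "length ks - Suc i"] unfolding mS'[OF j] Sj by simp
      qed
    next
      case False
      then have "length ks - Suc i = length ks - i" by simp
      with Suc show ?thesis by simp
    qed
  qed
  note r = this
  have "regular_system (mix l (set (take j ks)) x)" if "j \<le> length ks" for j
    using r[of "length ks - j"] that by simp
  moreover have "zeros (rmod.span (range (\<lambda>r. lin (l r)))) = {}" using l(1)[of "length ks"] ks(1) by (simp add: mix_def)
  ultimately show thesis using that[OF ks(2,1)] by blast
qed

text \<open>The Cohen-Macaulay property of the polynomial ring in graded form, read off at the start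
  of the path.\<close>

lemma system_of_parameters_regular:
  fixes x :: "'v::finite \<Rightarrow> ('v, 'a::alg_closed_field) mpol"
  assumes x: "positive_forms x" "zeros (rmod.span (range x)) = {}"
  shows "regular_system x"
proof -
  obtain l ks where "\<And>j. j \<le> length ks \<Longrightarrow> regular_system (mix l (set (take j ks)) x)"
    using linear_path_regular[OF x] by metis
  from this[of 0] show ?thesis by (simp add: mix_def)
qed

section \<open>Transition determinants and Jacobian determinants\<close>

lemma mconst_sum: "mconst (sum g A) = (\<Sum>u\<in>A. mconst (g u))"
  by (induction A rule: infinite_finite_induct) (auto simp: mconst_add)

lemma peval_lin_kernel_imp_zero:
  fixes l :: "'v::finite \<Rightarrow> 'v \<Rightarrow> 'a::field"
  assumes "zeros (rmod.span (range (\<lambda>r. lin (l r)))) = {}" and "\<And>r. peval a (lin (l r)) = 0"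
  shows "a j = 0"
proof (rule ccontr)
  assume "a j \<noteq> 0"
  then have P: "hpt a \<in> proj_points" by (rule hpt_in_proj_points)
  have "rmod.span (range (\<lambda>r. lin (l r))) \<subseteq> hpt a"
    using P assms(2) homogeneous_in_hpt_iff[OF homogeneous_lin]
    by (intro rmod.span_minimal) (auto simp: proj_points_iff subspace_of_prime)
  with P assms(1) show False by (auto simp: zeros_def)
qed

text \<open>Wiebe's theorem for the irrelevant ideal. Along the path from \<open>l\<close> to \<open>F\<close> the forms
  \<open>lin (l r)\<close> are replaced by the \<open>F r\<close> one at a time, and Cramer's rule relates the
  transition determinants of consecutive steps.\<close>

lemma transition_det_notin:
  fixes F :: "'v::finite \<Rightarrow> ('v, 'a::alg_closed_field) mpol" and a :: "'v \<Rightarrow> 'v \<Rightarrow> ('v, 'a) mpol"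
  assumes ks: "distinct ks" "set ks = UNIV"
    and reg: "\<And>j. j \<le> length ks \<Longrightarrow> regular_system (mix l (set (take j ks)) F)"
    and a: "\<And>r. F r = (\<Sum>s\<in>UNIV. a r s * lin (l s))"
  shows "det (\<chi> r s. a r s) \<notin> rmod.span (range F)"
proof
  define y where "y s = lin (l s)" for s
  \<comment> \<open>\<open>A T\<close> expresses \<open>mix l T F\<close> by the linear forms: its
    rows in \<open>T\<close> are unit vectors.\<close>
  define A :: "'v set \<Rightarrow> ('v, 'a) mpol^'v^'v" where
    "A T = (\<chi> r s. if r \<in> T then (if r = s then 1 else 0) else a r s)" for T
  have Ay: "(\<Sum>s\<in>UNIV. A T $ r $ s * y s) = mix l T F r" for T r
  proof (cases "r \<in> T")
    case True
    then have "(\<Sum>s\<in>UNIV. A T $ r $ s * y s) = (\<Sum>s\<in>UNIV. if r = s then y s else 0)"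
      by (intro sum.cong) (auto simp: A_def)
    with True show ?thesis by (simp add: mix_def y_def)
  qed (simp add: A_def mix_def a y_def)
  \<comment> \<open>Modulo the forms other than number \<open>k\<close>, Cramer's rule in column
    \<open>k\<close> identifies \<open>y k * det (A T)\<close> with
    \<open>F k * det (A (insert k T))\<close>. Cancelling the nonzerodivisor \<open>F k\<close>
    carries the membership one step towards the linear end.\<close>
  have step: "det (A (insert k T)) * s \<in> rmod.span (range (mix l (insert k T) F))"
    if k: "k \<notin> T" and T: "regular_system (mix l T F)" and s: "det (A T) * s \<in> rmod.span (range (mix l T F))" for k T s
  proof -
    let ?m = "mix l T F"
    define Q where "Q = rmod.span (?m ` (- {k}))"
    have sQ: "rmod.subspace Q" by (simp add: Q_def rmod.subspace_span)
    have mk: "?m k = F k" using k by (simp add: mix_def)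
    have rng: "range f = insert (f k) (f ` (- {k}))" for f :: "'v \<Rightarrow> ('v, 'a) mpol" by auto
    have "range ?m = insert (F k) (?m ` (- {k}))" using rng[of ?m] unfolding mk .
    with s obtain c where c: "det (A T) * s - c * F k \<in> Q" by (auto simp: in_span_insert_span_iff Q_def)
    define B :: "('v, 'a) mpol^'v^'v" where
      "B = (\<chi> i j. if j = k then (\<Sum>s\<in>UNIV. A T $ i $ s * y s) else A T $ i $ j)"
    define B' :: "('v, 'a) mpol^'v^'v" where
      "B' = (\<chi> i j. if j = k then (if i = k then F k else 0) else A T $ i $ j)"
    have detB: "det B = y k * det (A T)" unfolding B_def by (rule cramer_comm_ring)
    have "det B - det B' \<in> Q"
    proof (rule det_diff_in_ideal[OF sQ])
      fix i j
      have "?m i \<in> Q" if "i \<noteq> k" unfolding Q_def using that by (intro rmod.span_base) auto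
      then show "B $ i $ j - B' $ i $ j \<in> Q"
        using rmod.subspace_0[OF sQ] mk by (auto simp: B_def B'_def Ay)
    qed
    moreover have "det B' = F k * det (A (insert k T))"
    proof -
      have "det B' = det (\<chi> i. if i = k then F k *s (A (insert k T) $ i) else A (insert k T) $ i)"
        by (rule det_eq_minor[where k = k and l = k]) (auto simp: B'_def A_def)
      also have "\<dots> = F k * det (\<chi> i. if i = k then A (insert k T) $ i else A (insert k T) $ i)"
        by (rule det_row_mul)
      also have "(\<chi> i. if i = k then A (insert k T) $ i else A (insert k T) $ i) = A (insert k T)"
        by (simp add: vec_eq_iff)
      finally show ?thesis .
    qed
    ultimately have 1: "y k * det (A T) - F k * det (A (insert k T)) \<in> Q" by (simp add: detB)
    have "F k * (det (A (insert k T)) * s - c * y k)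
        = y k * (det (A T) * s - c * F k) - s * (y k * det (A T) - F k * det (A (insert k T)))"
      by (simp add: algebra_simps)
    also have "\<dots> \<in> Q" by (intro rmod.subspace_diff[OF sQ] rmod.subspace_scale[OF sQ] c 1)
    finally have "det (A (insert k T)) * s - c * y k \<in> Q"
      unfolding Q_def mk[symmetric] by (rule regular_systemD[OF T, rotated]) simp
    moreover have "range (mix l (insert k T) F) = insert (y k) (?m ` (- {k}))"
    proof -
      have "mix l (insert k T) F ` (- {k}) = ?m ` (- {k})" by (rule image_cong) (auto simp: mix_def)
      moreover have "mix l (insert k T) F k = y k" by (simp add: mix_def y_def)
      ultimately show ?thesis using rng[of "mix l (insert k T) F"] by simp
    qed
    ultimately show ?thesis by (auto simp: in_span_insert_span_iff Q_def)
  qed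
  assume "det (\<chi> r s. a r s) \<in> rmod.span (range F)"
  then have 0: "det (A {}) * 1 \<in> rmod.span (range (mix l {} F))" by (simp add: A_def mix_def)
  have "det (A (set (take j ks))) * 1 \<in> rmod.span (range (mix l (set (take j ks)) F))" if "j \<le> length ks" for j
    using that
  proof (induction j)
    case (Suc j)
    then have j: "j < length ks" by simp
    then have tk: "set (take (Suc j) ks) = insert (ks ! j) (set (take j ks))" by (simp add: take_Suc_conv_app_nth)
    have "distinct (take (Suc j) ks)" using ks(1) by simp
    then have "ks ! j \<notin> set (take j ks)" using j by (simp add: take_Suc_conv_app_nth)
    from step[OF this reg[of j], of 1] Suc.IH j show ?case unfolding tk by simp
  qed (use 0 in simp)
  \<comment> \<open>At the linear end the matrix is the identity, so \<open>1\<close> would lie in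
    an ideal whose members vanish at the origin.\<close>
  from this[of "length ks"] ks(2) have "det (A UNIV) \<in> rmod.span (range (\<lambda>r. lin (l r)))"
    by (simp add: mix_def)
  moreover have "A UNIV = mat 1" by (simp add: A_def mat_def)
  ultimately have "1 \<in> rmod.span (range (\<lambda>r. lin (l r)))" by simp
  moreover have "rmod.span (range (\<lambda>r. lin (l r))) \<subseteq> {F. peval (\<lambda>_. 0) F = 0}"
    by (intro rmod.span_minimal subspace_peval_kernel) (auto simp: peval_lin)
  ultimately show False by auto
qed

text \<open>Euler's formula divided by the degrees expresses the \<open>F r\<close> by the
  variables; the transition matrix is the Jacobian matrix with rows scaled by units. A linear change
  of coordinates passes from the variables to the linear forms at the end of the path.\<close>

lemma jacobian_notin:
  fixes F :: "'v::finite \<Rightarrow> ('v, 'a::alg_closed_field) mpol"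
  assumes F: "\<And>r. homogeneous (d r) (F r)" and d: "\<And>r. of_nat (d r) \<noteq> (0::'a)"
    and z: "zeros (rmod.span (range F)) = {}"
  shows "det (\<chi> r s. partial s (F r)) \<notin> rmod.span (range F)"
proof
  assume J: "det (\<chi> r s. partial s (F r)) \<in> rmod.span (range F)"
  have "d r > 0" for r using d[of r] by (cases "d r") auto
  then have pF: "positive_forms F" using F unfolding positive_forms_def by blast
  obtain l ks where l: "distinct ks" "set ks = (UNIV :: 'v set)"
    "\<And>j. j \<le> length ks \<Longrightarrow> regular_system (mix l (set (take j ks)) F)"
    "zeros (rmod.span (range (\<lambda>r. lin (l r)))) = {}"
    using linear_path_regular[OF pF z] by metis
  \<comment> \<open>A nonzero kernel vector of the coefficient matrix would be a common projective
    zero of the linear forms.\<close>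
  define L :: "'a^'v^'v" where "L = (\<chi> r k. l r k)"
  have "v = 0" if "L *v v = 0" for v
  proof -
    have "peval (\<lambda>k. v $ k) (lin (l r)) = 0" for r
      using that by (simp add: peval_lin vec_eq_iff matrix_vector_mult_def L_def)
    from peval_lin_kernel_imp_zero[OF l(4) this] show ?thesis by (simp add: vec_eq_iff)
  qed
  then obtain B where B: "B ** L = mat 1" using matrix_left_invertible_ker[of L] by blast
  have mv: "mvar s = (\<Sum>u\<in>UNIV. mconst (B $ s $ u) * lin (l u))" for s
  proof -
    have BL: "(\<Sum>u\<in>UNIV. mconst (B $ s $ u * l u k)) = mconst (if s = k then 1 else 0)" for k
    proof -
      have "(\<Sum>u\<in>UNIV. B $ s $ u * l u k) = (if s = k then 1 else 0)"
        using B by (simp add: vec_eq_iff matrix_matrix_mult_def mat_def L_def)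
      then show ?thesis by (simp only: mconst_sum[symmetric])
    qed
    have "(\<Sum>u\<in>UNIV. mconst (B $ s $ u) * lin (l u))
      = (\<Sum>k\<in>UNIV. (\<Sum>u\<in>UNIV. mconst (B $ s $ u * l u k)) * mvar k)"
      unfolding lin_def sum_distrib_left sum_distrib_right mconst_mult mult.assoc by (rule sum.swap)
    also have "\<dots> = (\<Sum>k\<in>UNIV. if s = k then mvar k else 0)"
      unfolding BL by (rule sum.cong) auto
    finally show ?thesis by simp
  qed
  define a where "a r u = mconst (inverse (of_nat (d r))) * (\<Sum>s\<in>UNIV. partial s (F r) * mconst (B $ s $ u))" for r u
  have "F r = (\<Sum>u\<in>UNIV. a r u * lin (l u))" for r
  proof -
    have "(\<Sum>u\<in>UNIV. a r u * lin (l u)) = mconst (inverse (of_nat (d r))) *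
        (\<Sum>u\<in>UNIV. \<Sum>s\<in>UNIV. partial s (F r) * (mconst (B $ s $ u) * lin (l u)))"
      unfolding a_def by (simp add: sum_distrib_left sum_distrib_right mult.assoc)
    also have "(\<Sum>u\<in>UNIV. \<Sum>s\<in>UNIV. partial s (F r) * (mconst (B $ s $ u) * lin (l u)))
        = (\<Sum>s\<in>UNIV. mvar s * partial s (F r))"
      by (subst sum.swap) (simp only: sum_distrib_left[symmetric] mv[symmetric],
        simp only: mult.commute)
    also have "\<dots> = mconst (of_nat (d r)) * F r" using euler[OF F] by (simp add: mconst_of_nat)
    finally show ?thesis
      using d[of r] by (simp add: mult.assoc[symmetric] mconst_mult[symmetric])
  qed
  note aF = this
  have "det (\<chi> r u. a r u) = (\<Prod>r\<in>UNIV. mconst (inverse (of_nat (d r)))) *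
      (det (\<chi> r s. partial s (F r)) * det (\<chi> s u. mconst (B $ s $ u)))"
  proof -
    have "(\<chi> r u. a r u) = (\<chi> r. mconst (inverse (of_nat (d r))) *s
        (((\<chi> r s. partial s (F r)) ** (\<chi> s u. mconst (B $ s $ u))) $ r))"
      by (simp add: vec_eq_iff a_def matrix_matrix_mult_def)
    then show ?thesis by (simp only: det_rows_mul vec_lambda_eta det_mul)
  qed
  then have "det (\<chi> r u. a r u) = ((\<Prod>r\<in>UNIV. mconst (inverse (of_nat (d r)))) *
      det (\<chi> s u. mconst (B $ s $ u))) * det (\<chi> r s. partial s (F r))"
    by (simp only: mult.assoc mult.commute mult.left_commute)
  then have "det (\<chi> r u. a r u) \<in> rmod.span (range F)" by (simp only: rmod.span_scale[OF J])
  with transition_det_notin[OF l(1,2,3) aF] show False by simp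
qed

section \<open>The Jacobian bracket\<close>

text \<open>The rows form a function, so that \<open>fun_upd\<close> replaces a single row.\<close>

definition rowdet :: "('n \<Rightarrow> 'a^'n) \<Rightarrow> 'a::comm_ring_1" where
  "rowdet M = det (\<chi> r. M r)"

lemma rowdet_upd_if: "rowdet (M(k := w)) = det (\<chi> r. if r = k then w else M r)"
  by (simp add: rowdet_def fun_upd_def)

lemma rowdet_add: "rowdet (M(k := u + w)) = rowdet (M(k := u)) + rowdet (M(k := w))"
  unfolding rowdet_upd_if by (rule det_row_add)

lemma rowdet_scale: "rowdet (M(k := c *s w)) = c * rowdet (M(k := w))"
  unfolding rowdet_upd_if by (rule det_row_mul)

lemma rowdet_0: "rowdet (M(k := 0)) = 0"
  using rowdet_scale[of M k 0 0] by simp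

lemma rowdet_uminus: "rowdet (M(k := - w)) = - rowdet (M(k := w))"
  using rowdet_add[of M k w "- w"] rowdet_0[of M k] by (simp add: add_eq_0_iff)

lemma rowdet_diff: "rowdet (M(k := u - w)) = rowdet (M(k := u)) - rowdet (M(k := w))"
  using rowdet_add[of M k u "- w"] by (simp add: rowdet_uminus)

lemma rowdet_sum: "rowdet (M(k := (\<Sum>x\<in>S. c x *s w x))) = (\<Sum>x\<in>S. c x * rowdet (M(k := w x)))"
proof (induction S rule: infinite_finite_induct)
  case (insert x S)
  show ?case unfolding sum.insert[OF insert.hyps] rowdet_add rowdet_scale insert.IH ..
next
  case (infinite S)
  show ?case unfolding sum.infinite[OF infinite] by (rule rowdet_0)
qed (simp only: sum.empty rowdet_0)

lemma rowdet_same: "r \<noteq> k \<Longrightarrow> M r = M k \<Longrightarrow> rowdet M = 0"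
  unfolding rowdet_def by (rule det_identical_rows[of r k]) (simp_all add: row_def)

lemma rowdet_swap:
  assumes "j \<noteq> k"
  shows "rowdet (M(j := u, k := w)) = - rowdet (M(j := w, k := u))"
proof -
  have *: "rowdet (M(j := x, k := y + z)) = rowdet (M(j := x, k := y)) + rowdet (M(j := x, k := z))" for x y z
    by (rule rowdet_add)
  have **: "rowdet (M(j := y + z, k := x)) = rowdet (M(j := y, k := x)) + rowdet (M(j := z, k := x))" for x y z
    using rowdet_add[of "M(k := x)" j y z] assms by (simp add: fun_upd_twist)
  have 0: "rowdet (M(j := x, k := x)) = 0" for x
    by (rule rowdet_same[OF assms]) (use assms in simp)
  have "rowdet (M(j := u + w, k := u + w)) = rowdet (M(j := u, k := w)) + rowdet (M(j := w, k := u))"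
    unfolding * ** by (simp add: 0)
  with 0 show ?thesis by (simp add: eq_neg_iff_add_eq_0)
qed

lemma rowdet_diff_in_ideal:
  assumes K: "rmod.subspace K" and uw: "\<And>s. u $ s - w $ s \<in> K"
  shows "rowdet (M(k := u)) - rowdet (M(k := w)) \<in> K"
  unfolding rowdet_def by (rule det_diff_in_ideal[OF K]) (use uw rmod.subspace_0[OF K] in auto)

lemma vec_eq_sum_axis: "v = (\<Sum>k\<in>UNIV. v $ k *s axis k (1::'a::comm_ring_1))"
  by (simp add: vec_eq_iff sum_component axis_def if_distrib cong: if_cong)

definition grad :: "('v::finite, 'a::comm_ring_1) mpol \<Rightarrow> ('v, 'a) mpol^'v" where
  "grad f = (\<chi> s. partial s f)"

lemma grad_nth [simp]: "grad f $ s = partial s f" by (simp add: grad_def)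
lemma grad_mvar: "grad (mvar k) = axis k 1" by (simp add: vec_eq_iff partial_mvar axis_def)

text \<open>A Jacobian determinant in which \<open>a\<close> and \<open>b\<close> occupy the slots
  \<open>p\<close> and \<open>q\<close>, whatever \<open>F\<close> is there. On two variables it is
  the minor \<open>J\<^sub>k\<^sub>l\<close> with its sign; in general it contracts that bivector
  with the differentials of \<open>a\<close> and \<open>b\<close>.\<close>

definition jac :: "'v \<Rightarrow> 'v \<Rightarrow> ('v::finite \<Rightarrow> ('v, 'a::comm_ring_1) mpol) \<Rightarrow> ('v, 'a) mpol \<Rightarrow> ('v, 'a) mpol \<Rightarrow> ('v, 'a) mpol" where
  "jac p q F a b = rowdet ((\<lambda>r. grad (F r))(p := grad a, q := grad b))"

lemma jac_right: "jac p q F a b = (\<Sum>k\<in>UNIV. partial k b * jac p q F a (mvar k))"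
  unfolding jac_def grad_mvar by (subst (2) vec_eq_sum_axis) (simp add: rowdet_sum)

lemma jac_swap: "p \<noteq> q \<Longrightarrow> jac p q F b a = - jac p q F a b"
  unfolding jac_def by (rule rowdet_swap)

lemma jac_left: "p \<noteq> q \<Longrightarrow> jac p q F a b = (\<Sum>k\<in>UNIV. partial k a * jac p q F (mvar k) b)"
  using jac_right[of p q F b a] by (simp add: jac_swap[of p q F _ b] sum_negf)

lemma jac_in_span:
  assumes "p \<noteq> q"
  shows "jac p q F a b \<in> rmod.span {jac p q F (mvar k) (mvar l) | k l. True}"
  unfolding jac_left[OF assms, of F a] jac_right[of p q F _ b]
  by (intro rmod.span_sum rmod.span_scale rmod.span_base) auto

lemma apply_field_mvar: "apply_field Y (mvar k) = Y k"
  by (simp add: apply_field_def partial_mvar if_distrib cong: if_cong)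

lemma apply_field_add: "apply_field Y (f + g) = apply_field Y f + apply_field Y g"
  by (simp add: apply_field_def partial_add distrib_left sum.distrib)

lemma apply_field_mult: "apply_field Y (f * g) = f * apply_field Y g + apply_field Y f * g"
  by (simp add: apply_field_def partial_mult distrib_left sum.distrib sum_distrib_left sum_distrib_right ac_simps)

lemma apply_field_1 [simp]: "apply_field Y 1 = 0" and apply_field_0 [simp]: "apply_field Y 0 = 0"
  by (simp_all add: apply_field_def)

lemma apply_field_diff: "apply_field Y (f - g) = apply_field Y f - apply_field Y g"
  by (simp add: apply_field_def partial_diff right_diff_distrib sum_subtractf)

text \<open>Cramer's rule with \<open>Y\<close> in column \<open>k\<close>: modulo \<open>K\<close>
  the new column is supported in the rows \<open>p\<close> and \<open>q\<close>, and the determinant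
  is linear in that column.\<close>

lemma jac_star_mvar:
  assumes pq: "p \<noteq> q" and K: "rmod.subspace K"
    and Y: "\<And>r. r \<notin> {p, q} \<Longrightarrow> apply_field Y (F r) \<in> K"
  shows "Y k * jac p q F a b - (apply_field Y a * jac p q F (mvar k) b + apply_field Y b * jac p q F a (mvar k)) \<in> K"
proof -
  define M where "M = (\<lambda>r. grad (F r))(p := grad a, q := grad b)"
  define A where "A = (\<chi> r. M r)"
  define C where "C w = (\<chi> i j. if j = k then w i else A $ i $ j)" for w :: "'a \<Rightarrow> ('a, 'b) mpol"
  have AY: "(\<Sum>s\<in>UNIV. A $ r $ s * Y s) = apply_field Y (if r = q then b else if r = p then a else F r)" for r
    by (simp add: A_def M_def apply_field_def mult.commute)
  have 1: "det (C (\<lambda>r. \<Sum>s\<in>UNIV. A $ r $ s * Y s)) = Y k * jac p q F a b"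
    unfolding C_def cramer_comm_ring by (simp add: A_def jac_def rowdet_def M_def)
  have 2: "det (C (\<lambda>r. \<Sum>s\<in>UNIV. A $ r $ s * Y s))
      - det (C (\<lambda>r. if r = p then apply_field Y a else if r = q then apply_field Y b else 0)) \<in> K"
  proof (rule det_diff_in_ideal[OF K])
    fix i j
    show "C (\<lambda>r. \<Sum>s\<in>UNIV. A $ r $ s * Y s) $ i $ j
      - C (\<lambda>r. if r = p then apply_field Y a else if r = q then apply_field Y b else 0) $ i $ j \<in> K"
      using pq Y rmod.subspace_0[OF K] by (auto simp: C_def AY)
  qed
  have col: "det (C (\<lambda>r. u * f r + w * g r)) = u * det (C f) + w * det (C g)" for u w f g
  proof -
    have tr: "det (C h) = rowdet ((\<lambda>j. column j A)(k := (\<chi> i. h i)))" for h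
    proof -
      have "transpose (C h) = (\<chi> r. ((\<lambda>j. column j A)(k := (\<chi> i. h i))) r)"
        by (simp add: vec_eq_iff transpose_def C_def column_def)
      then show ?thesis unfolding rowdet_def by (metis det_transpose)
    qed
    have "(\<chi> i. u * f i + w * g i) = u *s (\<chi> i. f i) + w *s (\<chi> i. g i)" by (simp add: vec_eq_iff)
    then show ?thesis unfolding tr by (simp only: rowdet_add rowdet_scale)
  qed
  have unit: "det (C (\<lambda>r. if r = p then 1 else 0)) = jac p q F (mvar k) b"
    unfolding jac_def rowdet_def
    by (rule det_eq_minor[where k = k and l = p]) (use pq in \<open>auto simp: C_def A_def M_def grad_mvar axis_def\<close>)
  have unit': "det (C (\<lambda>r. if r = q then 1 else 0)) = jac p q F a (mvar k)"
    unfolding jac_def rowdet_def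
    by (rule det_eq_minor[where k = k and l = q]) (use pq in \<open>auto simp: C_def A_def M_def grad_mvar axis_def\<close>)
  have "(\<lambda>r. if r = p then apply_field Y a else if r = q then apply_field Y b else 0)
    = (\<lambda>r. apply_field Y a * (if r = p then 1 else 0) + apply_field Y b * (if r = q then 1 else 0))"
    using pq by auto
  with 2 show ?thesis unfolding 1 by (simp only: col unit unit')
qed

text \<open>This is the contraction of \<open>Y\<close> with the product of the differentials of
  \<open>c\<close>, \<open>a\<close>, \<open>b\<close> and the remaining \<open>F r\<close>. The
  product vanishes because it has one factor more than there are variables, and the terms where
  \<open>Y\<close> meets some \<open>F r\<close> lie in \<open>K\<close>.\<close>

lemma jac_star:
  assumes pq: "p \<noteq> q" and K: "rmod.subspace K"
    and Y: "\<And>r. r \<notin> {p, q} \<Longrightarrow> apply_field Y (F r) \<in> K"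
  shows "apply_field Y c * jac p q F a b - (apply_field Y a * jac p q F c b + apply_field Y b * jac p q F a c) \<in> K"
proof -
  have "(\<Sum>k\<in>UNIV. partial k c * (Y k * jac p q F a b))
      - (\<Sum>k\<in>UNIV. partial k c * (apply_field Y a * jac p q F (mvar k) b + apply_field Y b * jac p q F a (mvar k))) \<in> K"
  proof (rule sum_diff_in_ideal[OF K])
    fix k
    from rmod.subspace_scale[OF K jac_star_mvar[where k = k, OF assms], where c = "partial k c"]
    show "partial k c * (Y k * jac p q F a b)
      - partial k c * (apply_field Y a * jac p q F (mvar k) b + apply_field Y b * jac p q F a (mvar k)) \<in> K"
      by (simp only: right_diff_distrib)
  qed
  moreover have "(\<Sum>k\<in>UNIV. partial k c * (Y k * jac p q F a b)) = apply_field Y c * jac p q F a b"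
    unfolding apply_field_def sum_distrib_right by (rule sum.cong) (simp_all add: ac_simps)
  moreover have "(\<Sum>k\<in>UNIV. partial k c * (apply_field Y a * jac p q F (mvar k) b + apply_field Y b * jac p q F a (mvar k)))
      = apply_field Y a * jac p q F c b + apply_field Y b * jac p q F a c"
    unfolding jac_left[OF pq, of F c] jac_right[of p q F a c]
    by (simp add: distrib_left sum.distrib sum_distrib_left mult.left_commute)
  ultimately show ?thesis by simp
qed

text \<open>The product of the vector field and the radial field, evaluated on the differentials of
  \<open>a\<close> and \<open>b\<close>. On variables it gives, up to sign, the minors that define
  the singularities.\<close>

definition wedge :: "('v::finite \<Rightarrow> ('v, 'a::comm_ring_1) mpol) \<Rightarrow> ('v, 'a) mpol \<Rightarrow> ('v, 'a) mpol \<Rightarrow> ('v, 'a) mpol" where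
  "wedge G a b = apply_field G a * apply_field mvar b - apply_field G b * apply_field mvar a"

text \<open>Both bivectors annihilate the differentials of the \<open>F r\<close>, whose common kernel has rank two.\<close>

lemma jac_wedge_proportional:
  assumes pq: "p \<noteq> q" and K: "rmod.subspace K"
    and G: "\<And>r. r \<notin> {p, q} \<Longrightarrow> apply_field G (F r) \<in> K"
    and E: "\<And>r. r \<notin> {p, q} \<Longrightarrow> apply_field mvar (F r) \<in> K"
  shows "jac p q F c d * wedge G a b - jac p q F a b * wedge G c d \<in> K"
proof -
  let ?J = "jac p q F" and ?Y = "apply_field G" and ?E = "apply_field mvar"
  \<comment> \<open>Two identities use \<open>G\<close> and two the radial field. Weighted with the
    values of the other field, their mixed brackets cancel in pairs.\<close>
  define S1 where "S1 = ?Y a * ?J c d - (?Y c * ?J a d + ?Y d * ?J c a)"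
  define S2 where "S2 = ?Y b * ?J c d - (?Y c * ?J b d + ?Y d * ?J c b)"
  define S3 where "S3 = ?E b * ?J a d - (?E a * ?J b d + ?E d * ?J a b)"
  define S4 where "S4 = ?E b * ?J a c - (?E a * ?J b c + ?E c * ?J a b)"
  have S: "S1 \<in> K" "S2 \<in> K" "S3 \<in> K" "S4 \<in> K"
    unfolding S1_def S2_def S3_def S4_def by (rule jac_star[OF pq K]; use G E in blast)+
  have sw: "?J c a = - ?J a c" "?J c b = - ?J b c" by (rule jac_swap[OF pq])+
  have "?J c d * wedge G a b - ?J a b * wedge G c d = ?E b * S1 - ?E a * S2 + ?Y c * S3 - ?Y d * S4"
    unfolding wedge_def S1_def S2_def S3_def S4_def sw by (simp add: algebra_simps)
  also have "\<dots> \<in> K"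
    by (intro rmod.subspace_diff[OF K] rmod.subspace_add[OF K] rmod.subspace_scale[OF K] S)
  finally show ?thesis .
qed

lemma homogeneous_det:
  assumes "\<And>r s. homogeneous (g r) (A $ r $ s)"
  shows "homogeneous (\<Sum>r\<in>UNIV. g r) (det (A :: ('v::finite, 'a::comm_ring_1) mpol^'n^'n))"
  unfolding det_def
proof (rule homogeneous_sum)
  fix \<pi> :: "'n \<Rightarrow> 'n"
  have "homogeneous 0 (of_int (sign \<pi>) :: ('v, 'a) mpol)"
    by (cases \<pi> rule: sign_cases) (auto intro: homogeneous_uminus)
  from homogeneous_mult[OF this homogeneous_prod[of UNIV g "\<lambda>r. A $ r $ \<pi> r"]] assms
  show "homogeneous (\<Sum>r\<in>UNIV. g r) (of_int (sign \<pi>) * (\<Prod>r\<in>UNIV. A $ r $ \<pi> r))" by simp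
qed

lemma homogeneous_jac:
  assumes pq: "p \<noteq> q" and F: "\<And>r. r \<notin> {p, q} \<Longrightarrow> homogeneous (d r) (F r)"
  shows "homogeneous (\<Sum>r\<in>- {p, q}. d r - 1) (jac p q F (mvar k) (mvar l))"
proof -
  \<comment> \<open>The rows \<open>p\<close> and \<open>q\<close> hold gradients of variables, so
    they contribute degree zero.\<close>
  define g where "g r = (if r \<in> {p, q} then 0 else d r - 1)" for r
  have "homogeneous (\<Sum>r\<in>UNIV. g r) (jac p q F (mvar k) (mvar l))"
    unfolding jac_def rowdet_def
  proof (rule homogeneous_det)
    fix r s
    show "homogeneous (g r) ((\<chi> r. ((\<lambda>r. grad (F r))(p := grad (mvar k), q := grad (mvar l))) r) $ r $ s)"
      using homogeneous_partial[OF F[of r], of s] by (auto simp: g_def partial_mvar)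
  qed
  also have "(\<Sum>r\<in>UNIV. g r) = (\<Sum>r\<in>- {p, q}. d r - 1)"
    by (rule sum.mono_neutral_cong_right) (auto simp: g_def)
  finally show ?thesis .
qed

lemma peval_det: "peval a (det A) = det (\<chi> i j. peval a (A $ i $ j))"
proof -
  have "peval a (of_int z) = of_int z" for z
    by (cases z) (simp_all add: peval_simps)
  then show ?thesis by (simp add: det_def peval_simps)
qed

section \<open>Jets\<close>

lemma type_coset_eq: "J +>\<^bsub>ring_of_type_algebra\<^esub> F = {x::'b::comm_ring_1. x - F \<in> J}"
proof -
  have "x \<in> (\<Union>h\<in>J. {h + F}) \<longleftrightarrow> x - F \<in> J" for x
    by (auto simp: algebra_simps) (metis add_diff_cancel_left' diff_add_cancel add.commute)
  then show ?thesis unfolding a_r_coset_def' ring_of_type_algebra_simps by blast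
qed

lemma type_coset_eq_iff:
  assumes J: "rmod.subspace (J :: 'b::comm_ring_1 set)"
  shows "J +>\<^bsub>ring_of_type_algebra\<^esub> F = J +>\<^bsub>ring_of_type_algebra\<^esub> G \<longleftrightarrow> F - G \<in> J"
proof
  assume "J +>\<^bsub>ring_of_type_algebra\<^esub> F = J +>\<^bsub>ring_of_type_algebra\<^esub> G"
  then have "F \<in> {x. x - G \<in> J}" using rmod.subspace_0[OF J] unfolding type_coset_eq by auto
  then show "F - G \<in> J" by simp
next
  assume FG: "F - G \<in> J"
  have "x - F \<in> J \<longleftrightarrow> x - G \<in> J" for x
    using rmod.subspace_add[OF J _ FG, of "x - F"] rmod.subspace_diff[OF J _ FG, of "x - G"] by auto
  then show "J +>\<^bsub>ring_of_type_algebra\<^esub> F = J +>\<^bsub>ring_of_type_algebra\<^esub> G" unfolding type_coset_eq by auto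
qed

lemma type_quot_simps:
  assumes J: "rmod.subspace (J :: 'b::comm_ring_1 set)"
  defines "R \<equiv> ring_of_type_algebra :: 'b ring"
  shows "carrier (R Quot J) = range (\<lambda>F. J +>\<^bsub>R\<^esub> F)"
    and "(J +>\<^bsub>R\<^esub> F) \<otimes>\<^bsub>R Quot J\<^esub> (J +>\<^bsub>R\<^esub> G) = J +>\<^bsub>R\<^esub> (F * G)"
    and "(J +>\<^bsub>R\<^esub> F) \<oplus>\<^bsub>R Quot J\<^esub> (J +>\<^bsub>R\<^esub> G) = J +>\<^bsub>R\<^esub> (F + G)"
    and "\<zero>\<^bsub>R Quot J\<^esub> = J +>\<^bsub>R\<^esub> 0" and "\<one>\<^bsub>R Quot J\<^esub> = J +>\<^bsub>R\<^esub> 1"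
proof -
  interpret ideal J R using J unfolding R_def by (simp add: ideal_iff_subspace)
  note s = ring_of_type_algebra_simps R_def
  show "carrier (R Quot J) = range (\<lambda>F. J +>\<^bsub>R\<^esub> F)"
    by (auto simp: FactRing_def A_RCOSETS_def' s)
  show "(J +>\<^bsub>R\<^esub> F) \<otimes>\<^bsub>R Quot J\<^esub> (J +>\<^bsub>R\<^esub> G) = J +>\<^bsub>R\<^esub> (F * G)"
    using rcoset_mult_add[of F G] by (simp add: FactRing_def s)
  show "(J +>\<^bsub>R\<^esub> F) \<oplus>\<^bsub>R Quot J\<^esub> (J +>\<^bsub>R\<^esub> G) = J +>\<^bsub>R\<^esub> (F + G)"
    using a_rcos_sum[of F G] by (simp add: FactRing_def s)
  show "\<zero>\<^bsub>R Quot J\<^esub> = J +>\<^bsub>R\<^esub> 0"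
    by (auto simp: FactRing_def R_def type_coset_eq)
  show "\<one>\<^bsub>R Quot J\<^esub> = J +>\<^bsub>R\<^esub> 1" by (simp add: FactRing_def s)
qed

lemma ring_type_quot: "rmod.subspace (J :: 'b::comm_ring_1 set) \<Longrightarrow> ring (ring_of_type_algebra Quot J)"
  by (rule ideal.quotient_is_ring) (simp add: ideal_iff_subspace)

section \<open>The adic filtration in an affine chart\<close>

definition chart_power :: "'v \<Rightarrow> ('v, 'a::comm_ring_1) mpol set \<Rightarrow> nat \<Rightarrow> ('v, 'a) mpol set" where
  "chart_power i P r = chart_max i P [^]\<^bsub>ideals_set S_ring\<^esub> r"

lemma chart_power_0: "chart_power i P 0 = UNIV"
  by (simp add: chart_power_def nat_pow_def ideals_set_def ring_of_type_algebra_simps)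

lemma chart_power_Suc: "chart_power i P (Suc r) = ideal_prod S_ring (chart_power i P r) (chart_max i P)"
  by (simp add: chart_power_def nat_pow_def ideals_set_def)

lemma subspace_chart_max: "rmod.subspace (chart_max i P)"
  by (simp add: chart_max_def Idl_eq_span rmod.subspace_span)

lemma subspace_chart_power:
  fixes P :: "('v, 'a::comm_ring_1) mpol set"
  shows "rmod.subspace (chart_power i P r)"
proof (induction r)
  case (Suc r)
  interpret ring "S_ring :: ('v, 'a) mpol ring" by (rule ring_from_type_algebra)
  show ?case
    using ideal_prod_is_ideal[of "chart_power i P r" "chart_max i P"] Suc subspace_chart_max[of i P]
    by (simp add: chart_power_Suc ideal_iff_subspace)
qed (simp add: chart_power_0)

lemma chart_power_prod: "x \<in> chart_power i P r \<Longrightarrow> y \<in> chart_max i P \<Longrightarrow> x * y \<in> chart_power i P (Suc r)"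
  unfolding chart_power_Suc using ideal_prod.prod[of x "chart_power i P r" y "chart_max i P" S_ring]
  by (simp add: ring_of_type_algebra_simps)

lemma chart_power_induct [consumes 1, case_names prod sum]:
  assumes "x \<in> chart_power i P (Suc r)"
    and "\<And>x y. x \<in> chart_power i P r \<Longrightarrow> y \<in> chart_max i P \<Longrightarrow> Q (x * y)"
    and "\<And>x y. x \<in> chart_power i P (Suc r) \<Longrightarrow> y \<in> chart_power i P (Suc r) \<Longrightarrow> Q x \<Longrightarrow> Q y \<Longrightarrow> Q (x + y)"
  shows "Q x"
  using assms(1) unfolding chart_power_Suc
proof (induction rule: ideal_prod.induct)
  case (prod x y)
  then show ?case using assms(2) by (simp add: ring_of_type_algebra_simps)
next
  case (sum x y)
  then show ?case using assms(3) by (simp add: ring_of_type_algebra_simps chart_power_Suc)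
qed

lemma chart_power_1: "chart_power i P 1 = chart_max i P"
proof
  show "chart_power i P 1 \<subseteq> chart_max i P"
  proof
    fix x assume "x \<in> chart_power i P 1"
    then have "x \<in> chart_power i P (Suc 0)" by simp
    then show "x \<in> chart_max i P"
    proof (induction rule: chart_power_induct)
      case (prod x y)
      show ?case by (rule rmod.subspace_scale[OF subspace_chart_max prod(2)])
    next
      case (sum x y)
      show ?case by (rule rmod.subspace_add[OF subspace_chart_max sum(3,4)])
    qed
  qed
  show "chart_max i P \<subseteq> chart_power i P 1"
  proof
    fix y assume "y \<in> chart_max i P"
    from chart_power_prod[of 1 i P 0 y, OF _ this] show "y \<in> chart_power i P 1" by (simp add: chart_power_0)
  qed
qed

lemma chart_power_2: "x \<in> chart_max i P \<Longrightarrow> y \<in> chart_max i P \<Longrightarrow> x * y \<in> chart_power i P 2"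
  using chart_power_prod[of x i P 1 y] unfolding chart_power_1 by (simp add: numeral_2_eq_2)

lemma chart_power_antimono: "chart_power i P (Suc r) \<subseteq> chart_power i P r"
proof
  fix x assume "x \<in> chart_power i P (Suc r)"
  then show "x \<in> chart_power i P r"
  proof (induction rule: chart_power_induct)
    case (prod x y)
    then show ?case using rmod.subspace_scale[OF subspace_chart_power, of x i P r y] by (simp add: mult.commute)
  next
    case (sum x y)
    show ?case by (rule rmod.subspace_add[OF subspace_chart_power sum(3,4)])
  qed
qed

text \<open>By the Leibniz rule a derivation lowers the adic order by at most one.\<close>

lemma apply_field_chart_power: "x \<in> chart_power i P (Suc r) \<Longrightarrow> apply_field H x \<in> chart_power i P r"
proof (induction r arbitrary: x)
  case (Suc r)
  note IH = Suc.IH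
  note sP = subspace_chart_power
  from Suc.prems show ?case
  proof (induction rule: chart_power_induct)
    case (prod x y)
    have "apply_field H x * y \<in> chart_power i P (Suc r)" using IH[OF prod(1)] prod(2) by (rule chart_power_prod)
    moreover have "x * apply_field H y \<in> chart_power i P (Suc r)"
      using rmod.subspace_scale[OF sP prod(1), of "apply_field H y"] by (simp add: mult.commute)
    ultimately show ?case unfolding apply_field_mult by (intro rmod.subspace_add[OF sP])
  next
    case (sum x y)
    then show ?case unfolding apply_field_add by (intro rmod.subspace_add[OF sP])
  qed
qed (simp add: chart_power_0)

lemma jet_ideal_eq: "jet_ideal I i P r = rmod.span (I \<union> {mvar i - 1} \<union> chart_power i P r)"
  by (simp add: jet_ideal_def Idl_eq_span chart_power_def)

lemma subspace_jet_ideal: "rmod.subspace (jet_ideal I i P r)"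
  by (simp add: jet_ideal_eq rmod.subspace_span)

lemma jet_ideal_antimono: "jet_ideal I i P (Suc r) \<subseteq> jet_ideal I i P r"
  unfolding jet_ideal_eq using chart_power_antimono[of i P r] by (intro rmod.span_mono) blast

lemma jet_ideal_decompose:
  assumes I: "rmod.subspace I" and F: "F \<in> jet_ideal I i P r"
  obtains f c w where "F = f + c * (mvar i - 1) + w" "f \<in> I" "w \<in> chart_power i P r"
proof -
  have "I \<union> {mvar i - 1} \<union> chart_power i P r = insert (mvar i - 1) (I \<union> chart_power i P r)" by blast
  with F have "F \<in> rmod.span (insert (mvar i - 1) (I \<union> chart_power i P r))"
    unfolding jet_ideal_eq by metis
  then obtain c where "F - c * (mvar i - 1) \<in> rmod.span (I \<union> chart_power i P r)"
    by (auto simp: in_span_insert_span_iff)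
  then obtain f w where "F - c * (mvar i - 1) = f + w" "f \<in> I" "w \<in> chart_power i P r"
    unfolding rmod.span_Un rmod.span_eq_iff[THEN iffD2, OF I]
      rmod.span_eq_iff[THEN iffD2, OF subspace_chart_power] by blast
  with that[of f c w] show thesis by (simp add: algebra_simps)
qed

text \<open>\<open>H i = 0\<close> makes the derivation kill \<open>mvar i - 1\<close>, so that it
  acts on the affine chart; one adic order is lost.\<close>

lemma apply_field_jet_ideal:
  assumes I: "rmod.subspace I" and T: "\<And>f. f \<in> I \<Longrightarrow> apply_field H f \<in> I" and Hi: "H i = 0"
    and F: "F \<in> jet_ideal I i P (Suc r)"
  shows "apply_field H F \<in> jet_ideal I i P r"
proof -
  obtain f c w where F: "F = f + c * (mvar i - 1) + w" "f \<in> I" "w \<in> chart_power i P (Suc r)"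
    using jet_ideal_decompose[OF I F] by metis
  have t: "apply_field H (mvar i - 1) = 0" using Hi by (simp add: apply_field_diff apply_field_mvar)
  have "apply_field H F = apply_field H f + apply_field H c * (mvar i - 1) + apply_field H w"
    by (simp add: F(1) apply_field_add apply_field_mult t)
  also have "\<dots> \<in> jet_ideal I i P r"
    unfolding jet_ideal_eq
    by (intro rmod.span_add rmod.span_scale rmod.span_base)
      (use T[OF F(2)] apply_field_chart_power[OF F(3)] in auto)
  finally show ?thesis .
qed

text \<open>With the normalisation \<open>a i = 1\<close>, evaluation at \<open>a\<close> is the
  residue map of the chart at the point.\<close>

lemma chart_max_hpt:
  fixes a :: "'v::finite \<Rightarrow> 'a::field"
  assumes ai: "a i = 1"
  shows "chart_max i (hpt a) = {F. peval a F = 0}"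
proof
  show "chart_max i (hpt a) \<subseteq> {F. peval a F = 0}"
    unfolding chart_max_def Idl_eq_span
    by (intro rmod.span_minimal subspace_peval_kernel) (use hpt_subset ai in \<open>auto simp: peval_simps\<close>)
  show "{F. peval a F = 0} \<subseteq> chart_max i (hpt a)"
  proof
    fix F assume F: "F \<in> {F. peval a F = 0}"
    let ?K = "chart_max i (hpt a)"
    have sub: "hpt a \<union> {mvar i - 1} \<subseteq> ?K" unfolding chart_max_def Idl_eq_span by (rule rmod.span_superset)
    have "mvar k - mconst (a k) \<in> ?K" for k
    proof -
      have "mvar k - mconst (a k) = (mvar k - mconst (a k) * mvar i) + mconst (a k) * (mvar i - 1)"
        by (simp add: algebra_simps)
      also have "\<dots> \<in> ?K"
        using sub generator_in_hpt[of a i k, OF ai]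
        by (intro rmod.subspace_add[OF subspace_chart_max] rmod.subspace_scale[OF subspace_chart_max]) auto
      finally show ?thesis .
    qed
    from mpol_diff_peval_in_ideal[OF subspace_chart_max this, of F] F show "F \<in> ?K" by simp
  qed
qed

lemma peval_jet_ideal:
  fixes a :: "'v::finite \<Rightarrow> 'a::field"
  assumes ai: "a i = 1" and I: "I \<subseteq> hpt a" and F: "F \<in> jet_ideal I i (hpt a) (Suc r)"
  shows "peval a F = 0"
proof -
  have "chart_power i (hpt a) (Suc r) \<subseteq> chart_power i (hpt a) 1"
  proof (induction r)
    case (Suc r)
    then show ?case using chart_power_antimono[of i "hpt a" "Suc r"] by (rule subset_trans[rotated])
  qed simp
  then have "chart_power i (hpt a) (Suc r) \<subseteq> {F. peval a F = 0}" by (simp only: chart_power_1 chart_max_hpt[where a = a and i = i, OF ai])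
  then have "jet_ideal I i (hpt a) (Suc r) \<subseteq> {F. peval a F = 0}"
    unfolding jet_ideal_eq
    by (intro rmod.span_minimal subspace_peval_kernel) (use I hpt_subset ai in \<open>auto simp: peval_simps\<close>)
  with F show ?thesis by blast
qed

lemma jet_eq_iff: "jet I i P r F = jet I i P r G \<longleftrightarrow> F - G \<in> jet_ideal I i P r"
  unfolding jet_def by (rule type_coset_eq_iff[OF subspace_jet_ideal])

lemma jet_ring_simps:
  "carrier (jet_ring I i P r) = range (jet I i P r)"
  "jet I i P r F \<otimes>\<^bsub>jet_ring I i P r\<^esub> jet I i P r G = jet I i P r (F * G)"
  "jet I i P r F \<oplus>\<^bsub>jet_ring I i P r\<^esub> jet I i P r G = jet I i P r (F + G)"
  "\<zero>\<^bsub>jet_ring I i P r\<^esub> = jet I i P r 0" "\<one>\<^bsub>jet_ring I i P r\<^esub> = jet I i P r 1"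
  unfolding jet_ring_def jet_def by (rule type_quot_simps[OF subspace_jet_ideal])+

text \<open>Regularity in dimension at most one bounds the dimension of the cotangent space by one;
  in dimension zero the generator is \<open>0\<close>.\<close>

lemma regular_at_cotangent:
  fixes I :: "('v::finite, 'a::field) mpol set"
  assumes reg: "regular_at I i P" and dim: "chain_dim {Q \<in> zeros I. Q \<subseteq> P} \<le> enat 1"
  obtains v where "\<And>x. x \<in> chart_max i P \<Longrightarrow> \<exists>c. x - mconst c * v \<in> jet_ideal I i P 2"
proof -
  let ?R = "jet_ring I i P 2" and ?j = "jet I i P 2"
  interpret R: ring ?R unfolding jet_ring_def by (rule ring_type_quot[OF subspace_jet_ideal])
  obtain e where e: "chain_dim {Q \<in> zeros I. Q \<subseteq> P} = enat e"
    and d: "R.dimension e (?j ` range mconst) (?j ` chart_max i P)"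
    using reg unfolding regular_at_def by blast
  have "e \<le> 1" using e dim by simp
  then consider "e = 0" | "e = Suc 0" by linarith
  then show thesis
  proof cases
    case 1
    have E: "?j ` chart_max i P = {\<zero>\<^bsub>?R\<^esub>}" using d[unfolded 1] by (cases rule: R.dimension.cases) auto
    show thesis
    proof (rule that[of 0])
      fix x assume "x \<in> chart_max i P"
      then have "?j x = ?j 0" using E by (auto simp: jet_ring_simps)
      then show "\<exists>c. x - mconst c * 0 \<in> jet_ideal I i P 2" by (simp add: jet_eq_iff)
    qed
  next
    case 2
    with d have "R.dimension (Suc 0) (?j ` range mconst) (?j ` chart_max i P)" by simp
    then obtain v E where v: "v \<in> carrier ?R" "R.dimension 0 (?j ` range mconst) E"
      and eq: "?j ` chart_max i P = R.line_extension (?j ` range mconst) v E"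
      by (cases rule: R.dimension.cases) auto
    have E: "E = {\<zero>\<^bsub>?R\<^esub>}" using v(2) by (cases rule: R.dimension.cases) auto
    obtain v' where v': "v = ?j v'" using v(1) by (auto simp: jet_ring_simps)
    show thesis
    proof (rule that[of v'])
      fix x assume "x \<in> chart_max i P"
      then have "?j x \<in> R.line_extension (?j ` range mconst) v E" using eq by blast
      then obtain c where "?j x = ?j (mconst c) \<otimes>\<^bsub>?R\<^esub> v \<oplus>\<^bsub>?R\<^esub> \<zero>\<^bsub>?R\<^esub>"
        unfolding R.line_extension_def E set_add_def' r_coset_def by auto
      then have "?j x = ?j (mconst c * v')" by (simp add: v' jet_ring_simps)
      then show "\<exists>c. x - mconst c * v' \<in> jet_ideal I i P 2" by (auto simp: jet_eq_iff)
    qed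
  qed
qed

subsection \<open>Completed local rings of nodes\<close>

text \<open>Elements of the inverse limit are handled through sequences of polynomial
  representatives, with congruences in place of inclusions of cosets.\<close>

definition compatible_seq :: "('v, 'a::comm_ring_1) mpol set \<Rightarrow> 'v \<Rightarrow> ('v, 'a) mpol set \<Rightarrow> (nat \<Rightarrow> ('v, 'a) mpol) \<Rightarrow> bool" where
  "compatible_seq I i P s \<longleftrightarrow> (\<forall>r. s (Suc r) - s r \<in> jet_ideal I i P r)"

definition seq_class :: "('v, 'a::comm_ring_1) mpol set \<Rightarrow> 'v \<Rightarrow> ('v, 'a) mpol set \<Rightarrow> (nat \<Rightarrow> ('v, 'a) mpol) \<Rightarrow> nat \<Rightarrow> ('v, 'a) mpol set" where
  "seq_class I i P s = (\<lambda>r. jet I i P r (s r))"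

lemma jet_subset_iff: "jet I i P (Suc r) F \<subseteq> jet I i P r G \<longleftrightarrow> F - G \<in> jet_ideal I i P r"
proof
  assume "jet I i P (Suc r) F \<subseteq> jet I i P r G"
  moreover have "F \<in> jet I i P (Suc r) F"
    by (simp add: jet_def type_coset_eq rmod.subspace_0[OF subspace_jet_ideal])
  ultimately have "F \<in> jet I i P r G" by blast
  then show "F - G \<in> jet_ideal I i P r" by (simp add: jet_def type_coset_eq)
next
  assume FG: "F - G \<in> jet_ideal I i P r"
  show "jet I i P (Suc r) F \<subseteq> jet I i P r G"
  proof
    fix x assume "x \<in> jet I i P (Suc r) F"
    then have "x - F \<in> jet_ideal I i P r" using jet_ideal_antimono[of I i P r] by (auto simp: jet_def type_coset_eq)
    from rmod.subspace_add[OF subspace_jet_ideal this FG] show "x \<in> jet I i P r G"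
      by (simp add: jet_def type_coset_eq)
  qed
qed

lemma carrier_completed: "carrier (completed_local_ring I i P) = seq_class I i P ` {s. compatible_seq I i P s}"
proof
  show "carrier (completed_local_ring I i P) \<subseteq> seq_class I i P ` {s. compatible_seq I i P s}"
  proof
    fix f assume f: "f \<in> carrier (completed_local_ring I i P)"
    have "\<exists>F. f r = jet I i P r F" for r
    proof -
      have "f r \<in> range (jet I i P r)" using f by (simp add: completed_local_ring_def jet_ring_simps)
      then show ?thesis by blast
    qed
    then obtain s where s: "\<And>r. f r = jet I i P r (s r)" by metis
    have "f (Suc r) \<subseteq> f r" for r using f by (simp add: completed_local_ring_def)
    then have "compatible_seq I i P s" by (simp add: compatible_seq_def s jet_subset_iff)
    moreover have "f = seq_class I i P s" by (auto simp: seq_class_def s)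
    ultimately show "f \<in> seq_class I i P ` {s. compatible_seq I i P s}" by blast
  qed
  show "seq_class I i P ` {s. compatible_seq I i P s} \<subseteq> carrier (completed_local_ring I i P)"
  proof
    fix f assume "f \<in> seq_class I i P ` {s. compatible_seq I i P s}"
    then obtain s where s: "compatible_seq I i P s" "f = seq_class I i P s" by blast
    have "jet I i P (Suc r) (s (Suc r)) \<subseteq> jet I i P r (s r)" for r
      using s(1) unfolding jet_subset_iff compatible_seq_def by blast
    then show "f \<in> carrier (completed_local_ring I i P)"
      by (simp add: completed_local_ring_def jet_ring_simps seq_class_def s(2))
  qed
qed

lemma completed_simps:
  "seq_class I i P s \<otimes>\<^bsub>completed_local_ring I i P\<^esub> seq_class I i P t = seq_class I i P (\<lambda>r. s r * t r)"
  "seq_class I i P s \<oplus>\<^bsub>completed_local_ring I i P\<^esub> seq_class I i P t = seq_class I i P (\<lambda>r. s r + t r)"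
  "\<one>\<^bsub>completed_local_ring I i P\<^esub> = seq_class I i P (\<lambda>r. 1)"
  by (simp_all add: completed_local_ring_def seq_class_def jet_ring_simps)

lemma seq_class_eq_iff: "seq_class I i P s = seq_class I i P t \<longleftrightarrow> (\<forall>r. s r - t r \<in> jet_ideal I i P r)"
  by (simp add: seq_class_def fun_eq_iff jet_eq_iff)

lemma compatible_seq_mult:
  "compatible_seq I i P s \<Longrightarrow> compatible_seq I i P t \<Longrightarrow> compatible_seq I i P (\<lambda>r. s r * t r)"
  unfolding compatible_seq_def by (blast intro: mult_diff_in_ideal[OF subspace_jet_ideal])

lemma compatible_seq_add:
  assumes "compatible_seq I i P s" "compatible_seq I i P t"
  shows "compatible_seq I i P (\<lambda>r. s r + t r)"
  unfolding compatible_seq_def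
proof
  fix r
  have "(s (Suc r) - s r) + (t (Suc r) - t r) \<in> jet_ideal I i P r"
    using assms unfolding compatible_seq_def by (intro rmod.subspace_add[OF subspace_jet_ideal]) auto
  then show "s (Suc r) + t (Suc r) - (s r + t r) \<in> jet_ideal I i P r" by (simp add: algebra_simps)
qed

lemma compatible_seq_const: "compatible_seq I i P (\<lambda>r. c)"
  by (simp add: compatible_seq_def rmod.subspace_0[OF subspace_jet_ideal])

abbreviation fps_u :: "'a::field fps fps" where "fps_u \<equiv> fps_const fps_X"
abbreviation fps_v :: "'a::field fps fps" where "fps_v \<equiv> fps_X"
abbreviation cterm :: "'a::field fps fps \<Rightarrow> 'a" where "cterm f \<equiv> fps_nth (fps_nth f 0) 0"

lemma node_ideal_eq: "node_ideal = range (\<lambda>w. w * (fps_u * fps_v) :: 'a::field fps fps)"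
  by (auto simp: node_ideal_def cgenideal_def ring_of_type_algebra_simps)

lemma subspace_node_ideal: "rmod.subspace (node_ideal :: 'a::field fps fps set)"
proof (rule rmod.subspaceI)
  show "0 \<in> (node_ideal :: 'a fps fps set)" unfolding node_ideal_eq by (rule range_eqI[of _ _ 0]) simp
  show "x + y \<in> node_ideal" if "x \<in> node_ideal" "y \<in> node_ideal" for x y :: "'a fps fps"
    using that unfolding node_ideal_eq by (auto simp flip: distrib_right)
  show "c * x \<in> node_ideal" if "x \<in> node_ideal" for c x :: "'a fps fps"
    using that unfolding node_ideal_eq by (auto simp flip: mult.assoc)
qed

text \<open>Compare coefficients with respect to \<open>v\<close>: the constant one forces
  \<open>q\<close> to vanish at \<open>v = 0\<close>, the linear one makes \<open>p\<close> at
  \<open>v = 0\<close> divisible by \<open>u\<close>. The intended \<open>p\<close> and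
  \<open>q\<close> are the derivatives of \<open>u\<close> and \<open>v\<close>.\<close>

lemma node_ideal_coeffs:
  assumes "p * fps_v + q * fps_u \<in> (node_ideal :: 'a::field fps fps set)"
  shows "cterm p = 0" "cterm q = 0"
proof -
  obtain w where w: "p * fps_v + q * fps_u = w * (fps_u * fps_v)" using assms unfolding node_ideal_eq by blast
  have l0: "fps_nth (p * fps_v + q * fps_u) 0 = fps_nth q 0 * fps_X"
    and l1: "fps_nth (p * fps_v + q * fps_u) 1 = fps_nth p 0 + fps_nth q 1 * fps_X"
    by (simp_all add: fps_mult_nth)
  have r0: "fps_nth (w * (fps_u * fps_v)) 0 = 0" by simp
  have r1: "fps_nth (w * (fps_u * fps_v)) 1 = fps_nth w 0 * fps_X"
    by (simp add: fps_mult_nth)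
  from l0 r0 w have "fps_nth q 0 * fps_X = (0 :: 'a fps)" by simp
  then show "cterm q = 0" by simp
  from l1 r1 w have "fps_nth (fps_nth p 0 + fps_nth q 1 * fps_X) 0 = fps_nth (fps_nth w 0 * fps_X) 0" by simp
  then show "cterm p = 0" by simp
qed

lemma cterm_node_ideal: "x \<in> node_ideal \<Longrightarrow> cterm x = 0"
  unfolding node_ideal_eq by auto

lemma cterm_unit:
  assumes "cterm f \<noteq> 0"
  obtains g where "f * g = 1"
proof -
  have "fps_nth f 0 dvd 1" using assms by simp
  then obtain y where "fps_nth f 0 * y = 1" by (metis dvdE)
  then have "f * fps_right_inverse f y = 1" by (rule fps_right_inverse)
  then show thesis by (rule that)
qed

lemma cterm_zero_decompose:
  assumes "cterm f = 0"
  obtains \<alpha> \<beta> where "f = \<alpha> * fps_u + \<beta> * fps_v"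
proof -
  have 1: "fps_nth f 0 = fps_shift 1 (fps_nth f 0) * fps_X"
    by (rule fps_ext) (use assms in \<open>auto simp: fps_X_mult_right_nth\<close>)
  have "f = fps_const (fps_nth f 0) + fps_shift 1 f * fps_v"
    by (rule fps_ext) (auto simp: fps_X_mult_right_nth)
  also have "fps_const (fps_nth f 0) = fps_const (fps_shift 1 (fps_nth f 0)) * fps_u"
    by (subst 1) (simp only: fps_const_mult)
  finally show thesis using that by blast
qed

text \<open>\<open>U\<close> and \<open>V\<close> represent, at a finite level, the elements of the
  completed local ring that correspond to \<open>u\<close> and \<open>v\<close>. Order
  \<open>3\<close> for their product allows differentiating it twice. The last conclusion says that
  a derivation preserving \<open>I\<close> maps the maximal ideal of the node into itself.\<close>

lemma ordinary_node_coordinates: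
  fixes I :: "('v::finite, 'a::field) mpol set"
  assumes ai: "a i = 1" and I: "rmod.subspace I" "I \<subseteq> hpt a" and node: "ordinary_node_at I i (hpt a)"
  obtains U V where "peval a U = 0" "peval a V = 0" "U * V \<in> jet_ideal I i (hpt a) 3"
    "\<And>x. peval a x = 0 \<Longrightarrow> \<exists>\<alpha> \<beta>. x - (\<alpha> * U + \<beta> * V) \<in> jet_ideal I i (hpt a) 2"
    "\<And>H x. (\<And>f. f \<in> I \<Longrightarrow> apply_field H f \<in> I) \<Longrightarrow> H i = 0 \<Longrightarrow> peval a x = 0 \<Longrightarrow> peval a (apply_field H x) = 0"
proof -
  let ?P = "hpt a" and ?N = "node_ideal :: 'a fps fps set"
  let ?C = "completed_local_ring I i ?P" and ?B = "ring_of_type_algebra :: 'a fps fps ring"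
  let ?j = "jet_ideal I i ?P"
  define cl where "cl f = ?N +>\<^bsub>?B\<^esub> f" for f
  define cls where "cls = seq_class I i ?P"
  define comp where "comp = compatible_seq I i ?P"
  note sN = subspace_node_ideal
  note sj = subspace_jet_ideal[of I i ?P]
  have qc: "carrier (?B Quot ?N) = range cl" by (simp add: type_quot_simps(1)[OF sN] cl_def)
  have qm: "cl f \<otimes>\<^bsub>?B Quot ?N\<^esub> cl g = cl (f * g)" for f g
    unfolding cl_def by (rule type_quot_simps(2)[OF sN])
  have qa: "cl f \<oplus>\<^bsub>?B Quot ?N\<^esub> cl g = cl (f + g)" for f g
    unfolding cl_def by (rule type_quot_simps(3)[OF sN])
  have qo: "\<one>\<^bsub>?B Quot ?N\<^esub> = cl 1"
    unfolding cl_def by (rule type_quot_simps(5)[OF sN])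
  obtain \<phi> where "\<phi> \<in> ring_iso ?C (?B Quot ?N)" using node unfolding ordinary_node_at_def by blast
  then have hom: "\<phi> \<in> ring_hom ?C (?B Quot ?N)" and bij: "bij_betw \<phi> (carrier ?C) (carrier (?B Quot ?N))"
    by (auto simp: ring_iso_def)
  have car: "carrier ?C = cls ` {s. comp s}" unfolding cls_def comp_def by (rule carrier_completed)
  have cin: "cls s \<in> carrier ?C" if "comp s" for s using car that by blast
  have cl_eq: "cl f = cl g \<longleftrightarrow> f - g \<in> ?N" for f g unfolding cl_def by (rule type_coset_eq_iff[OF sN])
  have surj: "\<exists>s. comp s \<and> \<phi> (cls s) = cl f" for f
  proof -
    have "cl f \<in> \<phi> ` carrier ?C" using bij unfolding bij_betw_def qc by blast
    then show ?thesis unfolding car by auto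
  qed
  have rep: "\<exists>f. \<phi> (cls s) = cl f" if "comp s" for s
    using bij_betwE[OF bij] cin[OF that] unfolding qc by blast
  have mult: "\<phi> (cls (\<lambda>r. s r * t r)) = cl (f * g)"
    if "comp s" "comp t" "\<phi> (cls s) = cl f" "\<phi> (cls t) = cl g" for s t f g
    using ring_hom_mult[OF hom cin[OF that(1)] cin[OF that(2)]] that(3,4)
    by (simp add: completed_simps cls_def qm)
  have add: "\<phi> (cls (\<lambda>r. s r + t r)) = cl (f + g)"
    if "comp s" "comp t" "\<phi> (cls s) = cl f" "\<phi> (cls t) = cl g" for s t f g
    using ring_hom_add[OF hom cin[OF that(1)] cin[OF that(2)]] that(3,4)
    by (simp add: completed_simps cls_def qa)
  have one: "\<phi> (cls (\<lambda>r. 1)) = cl 1"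
    using ring_hom_one[OF hom] by (simp add: completed_simps cls_def qo)
  have inj: "s r - t r \<in> ?j r" if "comp s" "comp t" "\<phi> (cls s) = \<phi> (cls t)" for s t r
  proof -
    have "cls s = cls t"
      by (rule inj_onD[OF bij_betw_imp_inj_on[OF bij] that(3) cin[OF that(1)] cin[OF that(2)]])
    then show ?thesis by (simp add: cls_def seq_class_eq_iff)
  qed
  have cconst: "comp (\<lambda>r. c)" for c unfolding comp_def by (rule compatible_seq_const)
  have cmult: "comp (\<lambda>r. s r * t r)" and cadd: "comp (\<lambda>r. s r + t r)" if "comp s" "comp t" for s t
    using that unfolding comp_def by (auto intro: compatible_seq_mult compatible_seq_add)
  have pj: "peval a F = 0" if "F \<in> ?j (Suc r)" for F r by (rule peval_jet_ideal[where I = I and i = i, OF ai I(2) that])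
  have zero: "\<phi> (cls (\<lambda>r. 0)) = cl 0"
  proof -
    obtain h where h: "\<phi> (cls (\<lambda>r. 0)) = cl h" using rep[OF cconst] by blast
    from add[OF cconst cconst h h] have "cl (h + h) = cl h" using h by simp
    then show ?thesis unfolding h cl_eq by simp
  qed
  \<comment> \<open>A power series with nonzero constant term is a unit, so its preimage is
    invertible modulo the maximal ideal of the point.\<close>
  have N0a: "peval a (s (Suc 0)) \<noteq> 0" if s: "comp s" "\<phi> (cls s) = cl f" "cterm f \<noteq> 0" for s f
  proof -
    obtain g where g: "f * g = 1" using cterm_unit[OF s(3)] by blast
    obtain t where t: "comp t" "\<phi> (cls t) = cl g" using surj by blast
    have "\<phi> (cls (\<lambda>r. s r * t r)) = \<phi> (cls (\<lambda>r. 1))" using mult[OF s(1) t(1) s(2) t(2)] g one by simp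
    from inj[OF cmult[OF s(1) t(1)] cconst this] have "s (Suc 0) * t (Suc 0) - 1 \<in> ?j (Suc 0)" .
    from pj[OF this] show ?thesis by (auto simp: peval_simps)
  qed
  \<comment> \<open>Otherwise adding a constant \<open>c\<close> would cancel the value at the
    point. As a unit, \<open>c\<close> has an image with nonzero constant term, and so has the sum,
    against the previous step.\<close>
  have N0b: "peval a (s (Suc 0)) = 0" if s: "comp s" "\<phi> (cls s) = cl f" "cterm f = 0" for s f
  proof (rule ccontr)
    define c where "c = - peval a (s (Suc 0))"
    assume "peval a (s (Suc 0)) \<noteq> 0"
    then have c: "c \<noteq> 0" by (simp add: c_def)
    obtain h where h: "\<phi> (cls (\<lambda>r. mconst c)) = cl h" using rep[OF cconst] by blast
    obtain h' where h': "\<phi> (cls (\<lambda>r. mconst (inverse c))) = cl h'" using rep[OF cconst] by blast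
    have "cl (h * h') = cl 1" using mult[OF cconst cconst h h'] one by (simp add: mconst_unit[OF c])
    then have "cterm (h * h' - 1) = 0" unfolding cl_eq by (rule cterm_node_ideal)
    then have "cterm h \<noteq> 0" by auto
    then have "cterm (f + h) \<noteq> 0" using s(3) by simp
    from N0a[OF cadd[OF s(1) cconst] add[OF s(1) cconst s(2) h] this] show False
      by (simp add: peval_simps c_def)
  qed
  obtain sU where sU: "comp sU" "\<phi> (cls sU) = cl fps_u" using surj by blast
  obtain sV where sV: "comp sV" "\<phi> (cls sV) = cl fps_v" using surj by blast
  have p23: "peval a (s 2) = peval a (s (Suc 0))" "peval a (s 3) = peval a (s (Suc 0))" "s 3 - s 2 \<in> ?j 2"
    if "comp s" for s
  proof -
    have *: "s (Suc r) - s r \<in> ?j r" for r using that unfolding comp_def compatible_seq_def by blast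
    have 1: "s (Suc (Suc 0)) - s (Suc 0) \<in> ?j (Suc 0)" by (rule *)
    show "s 3 - s 2 \<in> ?j 2" using *[of 2] by simp
    from pj[OF 1] show "peval a (s 2) = peval a (s (Suc 0))" by (simp add: peval_simps numeral_2_eq_2)
    moreover have "peval a (s 3 - s 2) = 0"
      by (rule pj[of _ 1]) (use \<open>s 3 - s 2 \<in> ?j 2\<close> in \<open>simp add: numeral_2_eq_2\<close>)
    ultimately show "peval a (s 3) = peval a (s (Suc 0))" by (simp add: peval_simps)
  qed
  have pU: "peval a (sU (Suc 0)) = 0" by (rule N0b[OF sU]) simp
  have pV: "peval a (sV (Suc 0)) = 0" by (rule N0b[OF sV]) simp
  have "cl (fps_u * fps_v) = cl 0" unfolding cl_eq node_ideal_eq by (rule range_eqI[of _ _ 1]) simp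
  then have "\<phi> (cls (\<lambda>r. sU r * sV r)) = \<phi> (cls (\<lambda>r. 0))" using mult[OF sU(1) sV(1) sU(2) sV(2)] zero by simp
  from inj[OF cmult[OF sU(1) sV(1)] cconst this] have UV: "sU r * sV r \<in> ?j r" for r by simp
  have N2: "\<exists>\<alpha> \<beta>. x - (\<alpha> * sU 2 + \<beta> * sV 2) \<in> ?j 2" if x: "peval a x = 0" for x
  proof -
    obtain f where f: "\<phi> (cls (\<lambda>r. x)) = cl f" using rep[OF cconst] by blast
    have "cterm f = 0" using N0a[OF cconst f] x by blast
    then obtain \<alpha> \<beta> where ab: "f = \<alpha> * fps_u + \<beta> * fps_v" by (rule cterm_zero_decompose)
    obtain s where s: "comp s" "\<phi> (cls s) = cl \<alpha>" using surj by blast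
    obtain t where t: "comp t" "\<phi> (cls t) = cl \<beta>" using surj by blast
    have "\<phi> (cls (\<lambda>r. x)) = \<phi> (cls (\<lambda>r. s r * sU r + t r * sV r))"
      using add[OF cmult[OF s(1) sU(1)] cmult[OF t(1) sV(1)] mult[OF s(1) sU(1) s(2) sU(2)]
          mult[OF t(1) sV(1) t(2) sV(2)]] f ab by simp
    from inj[OF cconst cadd[OF cmult[OF s(1) sU(1)] cmult[OF t(1) sV(1)]] this]
    show ?thesis by blast
  qed
  show thesis
  \<comment> \<open>Level \<open>3\<close> is chosen because the product is wanted modulo the third
    power; modulo the second power nothing changes against level \<open>2\<close>.\<close>
  proof (rule that[of "sU 3" "sV 3"])
    show "peval a (sU 3) = 0" "peval a (sV 3) = 0" using p23(2) sU(1) sV(1) pU pV by auto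
    show "sU 3 * sV 3 \<in> ?j 3" by (rule UV)
    show "\<exists>\<alpha> \<beta>. x - (\<alpha> * sU 3 + \<beta> * sV 3) \<in> ?j 2" if x: "peval a x = 0" for x
    proof -
      obtain \<alpha> \<beta> where ab: "x - (\<alpha> * sU 2 + \<beta> * sV 2) \<in> ?j 2" using N2[OF x] by blast
      have "x - (\<alpha> * sU 3 + \<beta> * sV 3)
          = (x - (\<alpha> * sU 2 + \<beta> * sV 2)) - (\<alpha> * (sU 3 - sU 2) + \<beta> * (sV 3 - sV 2))"
        by (simp add: algebra_simps)
      also have "\<dots> \<in> ?j 2"
        by (intro rmod.subspace_diff[OF sj] rmod.subspace_add[OF sj] rmod.subspace_scale[OF sj] ab p23(3) sU(1) sV(1))
      finally show ?thesis by blast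
    qed
    fix H x
    assume HI: "\<And>f. f \<in> I \<Longrightarrow> apply_field H f \<in> I" and Hi: "H i = 0" and x: "peval a x = 0"
    let ?T = "apply_field H"
    have T: "?T F \<in> ?j r" if "F \<in> ?j (Suc r)" for F r by (rule apply_field_jet_ideal[OF I(1) HI Hi that])
    \<comment> \<open>Differentiation loses one order, so the index is shifted to obtain a
      compatible sequence again.\<close>
    have cT: "comp (\<lambda>r. ?T (s (Suc r)))" if "comp s" for s
      using that T unfolding comp_def compatible_seq_def apply_field_diff[symmetric] by blast
    obtain p where p: "\<phi> (cls (\<lambda>r. ?T (sU (Suc r)))) = cl p" using rep[OF cT[OF sU(1)]] by blast
    obtain q' where q': "\<phi> (cls (\<lambda>r. ?T (sV (Suc r)))) = cl q'" using rep[OF cT[OF sV(1)]] by blast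
    \<comment> \<open>The derivative of \<open>u v = 0\<close> at a finite level; the mismatch of
      indices costs only members of \<open>?j r\<close>.\<close>
    have "?T (sU (Suc r)) * sV r + ?T (sV (Suc r)) * sU r \<in> ?j r" for r
    proof -
      have d: "sU (Suc r) - sU r \<in> ?j r" "sV (Suc r) - sV r \<in> ?j r"
        using sU(1) sV(1) unfolding comp_def compatible_seq_def by auto
      have "?T (sU (Suc r)) * sV r + ?T (sV (Suc r)) * sU r = ?T (sU (Suc r) * sV (Suc r))
          - (?T (sU (Suc r)) * (sV (Suc r) - sV r) + ?T (sV (Suc r)) * (sU (Suc r) - sU r))"
        by (simp add: apply_field_mult algebra_simps)
      also have "\<dots> \<in> ?j r"
        by (intro rmod.subspace_diff[OF sj] rmod.subspace_add[OF sj] rmod.subspace_scale[OF sj] d T UV)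
      finally show ?thesis .
    qed
    then have "cls (\<lambda>r. ?T (sU (Suc r)) * sV r + ?T (sV (Suc r)) * sU r) = cls (\<lambda>r. 0)"
      by (simp add: cls_def seq_class_eq_iff)
    moreover have "\<phi> (cls (\<lambda>r. ?T (sU (Suc r)) * sV r + ?T (sV (Suc r)) * sU r)) = cl (p * fps_v + q' * fps_u)"
      by (rule add[OF cmult[OF cT[OF sU(1)] sV(1)] cmult[OF cT[OF sV(1)] sU(1)]
        mult[OF cT[OF sU(1)] sV(1) p sV(2)] mult[OF cT[OF sV(1)] sU(1) q' sU(2)]])
    ultimately have "cl (p * fps_v + q' * fps_u) = cl 0" using zero by simp
    then have "p * fps_v + q' * fps_u \<in> ?N" by (simp add: cl_eq)
    note c = node_ideal_coeffs[OF this]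
    have TU: "peval a (?T (sU 2)) = 0" using N0b[OF cT[OF sU(1)] p c(1)] by (simp add: numeral_2_eq_2)
    have TV: "peval a (?T (sV 2)) = 0" using N0b[OF cT[OF sV(1)] q' c(2)] by (simp add: numeral_2_eq_2)
    obtain \<alpha> \<beta> where "x - (\<alpha> * sU 2 + \<beta> * sV 2) \<in> ?j 2" using N2[OF x] by blast
    then have "?T (x - (\<alpha> * sU 2 + \<beta> * sV 2)) \<in> ?j (Suc 0)" by (intro T) (simp add: numeral_2_eq_2)
    from pj[OF this] show "peval a (?T x) = 0"
      using p23(1)[OF sU(1)] p23(1)[OF sV(1)]
      by (simp add: apply_field_diff apply_field_add apply_field_mult peval_simps TU TV pU pV)
  qed
qed

section \<open>Comparison of the two bivectors at a closed point\<close>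

lemma exists_hom_component_bound: "\<exists>M. \<forall>e\<ge>M. hom_component e (w :: ('v::finite, 'a::comm_ring_1) mpol) = 0"
proof -
  define M where "M = Suc (Max (insert 0 (mdegree ` Poly_Mapping.keys w)))"
  have "hom_component e w = 0" if "M \<le> e" for e
  proof (rule poly_mapping_eqI)
    fix \<alpha>
    have le: "mdegree \<alpha> \<le> Max (insert 0 (mdegree ` Poly_Mapping.keys w))" if "\<alpha> \<in> Poly_Mapping.keys w"
      using that by (intro Max_ge) auto
    have "mdegree \<alpha> \<noteq> e" if "\<alpha> \<in> Poly_Mapping.keys w" using le[OF that] \<open>M \<le> e\<close> by (simp add: M_def)
    then show "Poly_Mapping.lookup (hom_component e w) \<alpha> = Poly_Mapping.lookup 0 \<alpha>"
      by (auto simp: lookup_hom_component in_keys_iff)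
  qed
  then show ?thesis by blast
qed

text \<open>Compare components: below degree \<open>d\<close> those of \<open>w\<close> lie in
  \<open>K\<close>, and the one in degree \<open>d + k\<close> is congruent to minus
  \<open>mvar i ^ k * f\<close>. The components of \<open>w\<close> eventually vanish, which leaves
  a power of \<open>mvar i\<close> times \<open>f\<close> in \<open>K\<close>.\<close>

lemma dehomogenize:
  assumes K: "homogeneous_ideal K" and f: "homogeneous d f" and w: "f - w * (mvar i - 1) \<in> K"
  shows "\<exists>N. mvar i ^ N * f \<in> K"
proof -
  have sK: "rmod.subspace K" by (rule subspace_of_homogeneous[OF K])
  have c: "hom_component e f - (if 1 \<le> e then hom_component (e - 1) w * mvar i else 0) + hom_component e w \<in> K" for e
  proof -
    have "f - w * (mvar i - 1) = f - w * mvar i + w" by (simp add: algebra_simps)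
    with hom_component_in[OF K w, of e] show ?thesis
      by (simp only: hom_component_add hom_component_diff hom_component_mult_homogeneous[OF homogeneous_mvar])
  qed
  have low: "hom_component e w \<in> K" if "e < d" for e
    using that
  proof (induction e)
    case 0
    with c[of 0] show ?case by (simp add: hom_component_homogeneous[OF f])
  next
    case (Suc e)
    then have "mvar i * hom_component e w \<in> K" by (intro rmod.subspace_scale[OF sK]) simp
    moreover have "- (mvar i * hom_component e w) + hom_component (Suc e) w \<in> K"
      using c[of "Suc e"] Suc.prems by (simp add: hom_component_homogeneous[OF f] mult.commute)
    ultimately show ?case using rmod.subspace_add[OF sK] by fastforce
  qed
  have "hom_component (d + k) w + mvar i ^ k * f \<in> K" for k
  proof (induction k)
    case 0
    show ?case
    proof (cases d)
      case 0
      with c[of 0] show ?thesis by (simp add: hom_component_homogeneous[OF f] add.commute)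
    next
      case (Suc d')
      have "mvar i * hom_component d' w \<in> K" using low[of d'] Suc by (intro rmod.subspace_scale[OF sK]) simp
      from rmod.subspace_add[OF sK c[of d] this] Suc show ?thesis
        by (simp add: hom_component_homogeneous[OF f] algebra_simps)
    qed
  next
    case (Suc k)
    have "mvar i * (hom_component (d + k) w + mvar i ^ k * f) \<in> K" by (rule rmod.subspace_scale[OF sK Suc])
    from rmod.subspace_add[OF sK c[of "Suc (d + k)"] this] show ?case
      by (simp add: hom_component_homogeneous[OF f] algebra_simps)
  qed
  note high = this
  obtain M where "\<And>e. M \<le> e \<Longrightarrow> hom_component e w = 0" using exists_hom_component_bound[of w] by blast
  with high[of M] show ?thesis by (intro exI[of _ M]) simp
qed

text \<open>Padding the components with powers of \<open>mvar i\<close> reaches a common degree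
  without changing the function on the chart.\<close>

lemma homogenize_unit:
  fixes u :: "('v::finite, 'a::comm_ring_1) mpol"
  obtains u' D w where "homogeneous D u'" "u' - u = w * (mvar i - 1)"
proof -
  define S where "S = mdegree ` Poly_Mapping.keys u"
  define D where "D = Max (insert 0 S)"
  define u' where "u' = (\<Sum>e\<in>S. mvar i ^ (D - e) * hom_component e u)"
  have le: "e \<le> D" if "e \<in> S" for e using that unfolding D_def by (intro Max_ge) (auto simp: S_def)
  have "homogeneous D u'" unfolding u'_def
  proof (rule homogeneous_sum)
    fix e assume "e \<in> S"
    have "homogeneous (1 * (D - e) + e) (mvar i ^ (D - e) * hom_component e u)"
      by (intro homogeneous_mult homogeneous_power homogeneous_mvar homogeneous_hom_component)
    with le[OF \<open>e \<in> S\<close>] show "homogeneous D (mvar i ^ (D - e) * hom_component e u)" by simp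
  qed
  moreover have "u' - u \<in> rmod.span {mvar i - 1}"
  proof -
    let ?K = "rmod.span {mvar i - 1 :: ('v, 'a) mpol}"
    have sK: "rmod.subspace ?K" by (rule rmod.subspace_span)
    have "mvar i - 1 \<in> ?K" by (rule rmod.span_base) simp
    then have p: "mvar i ^ k - 1 \<in> ?K" for k using power_diff_in_ideal[OF sK, of "mvar i" 1 k] by simp
    have "u' - (\<Sum>e\<in>S. hom_component e u) \<in> ?K" unfolding u'_def
    proof (rule sum_diff_in_ideal[OF sK])
      fix e
      from rmod.subspace_scale[OF sK p[of "D - e"], of "hom_component e u"]
      show "mvar i ^ (D - e) * hom_component e u - hom_component e u \<in> ?K" by (simp add: algebra_simps)
    qed
    then show ?thesis by (simp add: S_def hom_component_sum_self)
  qed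
  ultimately show thesis using that by (auto simp: rmod.span_singleton)
qed

lemma in_span_image:
  assumes T: "finite T" and x: "x \<in> rmod.span (F ` T)"
  obtains h where "x = (\<Sum>r\<in>T. h r * F r)"
proof -
  have "rmod.span (F ` T) \<subseteq> {x. \<exists>h. x = (\<Sum>r\<in>T. h r * F r)}"
  proof (rule rmod.span_minimal)
    show "F ` T \<subseteq> {x. \<exists>h. x = (\<Sum>r\<in>T. h r * F r)}"
    proof clarify
      fix r assume r: "r \<in> T"
      have "F r = (\<Sum>s\<in>T. if s = r then F s else 0)" using r T by simp
      also have "\<dots> = (\<Sum>s\<in>T. (if s = r then 1 else 0) * F s)" by (rule sum.cong) auto
      finally show "\<exists>h. F r = (\<Sum>s\<in>T. h s * F s)" by (rule exI[of _ "\<lambda>s. if s = r then 1 else 0"])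
    qed
    show "rmod.subspace {x. \<exists>h. x = (\<Sum>r\<in>T. h r * F r)}"
    proof (rule rmod.subspaceI)
      show "0 \<in> {x. \<exists>h. x = (\<Sum>r\<in>T. h r * F r)}" by (intro CollectI exI[of _ "\<lambda>_. 0"]) simp
      show "x + y \<in> {x. \<exists>h. x = (\<Sum>r\<in>T. h r * F r)}"
        if xy: "x \<in> {x. \<exists>h. x = (\<Sum>r\<in>T. h r * F r)}" "y \<in> {x. \<exists>h. x = (\<Sum>r\<in>T. h r * F r)}" for x y
      proof -
        obtain h h' where "x = (\<Sum>r\<in>T. h r * F r)" "y = (\<Sum>r\<in>T. h' r * F r)" using xy by blast
        then have "x + y = (\<Sum>r\<in>T. (h r + h' r) * F r)" by (simp add: distrib_right sum.distrib)
        then show ?thesis by (intro CollectI exI)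
      qed
      show "c * x \<in> {x. \<exists>h. x = (\<Sum>r\<in>T. h r * F r)}" if x: "x \<in> {x. \<exists>h. x = (\<Sum>r\<in>T. h r * F r)}" for c x
      proof -
        obtain h where "x = (\<Sum>r\<in>T. h r * F r)" using x by blast
        then have "c * x = (\<Sum>r\<in>T. (c * h r) * F r)" by (simp add: sum_distrib_left mult.assoc)
        then show ?thesis by (intro CollectI exI)
      qed
    qed
  qed
  with x that show thesis by blast
qed

lemma peval_zero_decompose:
  assumes "peval a x = (0 :: 'a::comm_ring_1)"
  obtains c where "x = (\<Sum>k\<in>(UNIV::'v::finite set). c k * (mvar k - mconst (a k)))"
proof -
  let ?K = "rmod.span (range (\<lambda>k. mvar k - mconst (a k)))"
  have "x - mconst (peval a x) \<in> ?K"
    by (rule mpol_diff_peval_in_ideal[OF rmod.subspace_span]) (auto intro: rmod.span_base)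
  with assms have "x \<in> ?K" by simp
  then show thesis using in_span_image[of UNIV x "\<lambda>k. mvar k - mconst (a k)"] that by auto
qed

lemma chart_power_2_decompose:
  fixes a :: "'v::finite \<Rightarrow> 'a::field"
  assumes ai: "a i = 1" and y: "y \<in> chart_power i (hpt a) 2"
  shows "\<exists>n. (\<forall>l. peval a (n l) = 0) \<and> y = (\<Sum>l\<in>UNIV. n l * (mvar l - mconst (a l)))"
proof -
  note m = chart_max_hpt[where a = a and i = i, OF ai]
  have "y \<in> chart_power i (hpt a) (Suc (Suc 0))" using y by (simp add: numeral_2_eq_2)
  then show ?thesis
  proof (induction rule: chart_power_induct)
    case (prod x y)
    have x: "peval a x = 0" using prod(1) chart_power_1[of i "hpt a"] m by auto
    have "peval a y = 0" using prod(2) m by auto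
    then obtain c where c: "y = (\<Sum>k\<in>UNIV. c k * (mvar k - mconst (a k)))" by (rule peval_zero_decompose)
    show ?case
      by (intro exI[of _ "\<lambda>l. x * c l"]) (simp add: c x peval_simps sum_distrib_left mult.assoc)
  next
    case (sum x y)
    then obtain n n' where "\<forall>l. peval a (n l) = 0" "x = (\<Sum>l\<in>UNIV. n l * (mvar l - mconst (a l)))"
      "\<forall>l. peval a (n' l) = 0" "y = (\<Sum>l\<in>UNIV. n' l * (mvar l - mconst (a l)))" by blast
    then show ?case
      by (intro exI[of _ "\<lambda>l. n l + n' l"]) (simp add: peval_simps distrib_right sum.distrib)
  qed
qed

text \<open>Nakayama's lemma by the determinant trick: modulo \<open>K\<close> the coordinates
  centred at \<open>a\<close> are combinations of themselves with coefficients \<open>n k l\<close>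
  vanishing at \<open>a\<close>. The determinant of the identity minus \<open>n\<close> has value
  \<open>1\<close> at \<open>a\<close> and multiplies the coordinates into \<open>K\<close>.\<close>

lemma local_nakayama:
  fixes a :: "'v::finite \<Rightarrow> 'a::field"
  assumes ai: "a i = 1" and K: "rmod.subspace K"
    and gen: "\<And>x. peval a x = 0 \<Longrightarrow> \<exists>y\<in>chart_power i (hpt a) 2. x - y \<in> K"
  obtains u where "peval a u = 1" "\<And>x. peval a x = 0 \<Longrightarrow> u * x \<in> K"
proof -
  define g where "g k = mvar k - mconst (a k)" for k :: 'v
  have "\<exists>n. (\<forall>l. peval a (n l) = 0) \<and> g k - (\<Sum>l\<in>UNIV. n l * g l) \<in> K" for k
  proof -
    have "peval a (g k) = 0" by (simp add: g_def peval_simps)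
    then obtain y where y: "y \<in> chart_power i (hpt a) 2" "g k - y \<in> K" using gen by blast
    obtain n where "\<forall>l. peval a (n l) = 0" "y = (\<Sum>l\<in>UNIV. n l * g l)"
      using chart_power_2_decompose[where a = a and i = i, OF ai y(1)] unfolding g_def by blast
    with y(2) show ?thesis by blast
  qed
  then obtain n where n: "\<And>k l. peval a (n k l) = 0" "\<And>k. g k - (\<Sum>l\<in>UNIV. n k l * g l) \<in> K" by metis
  define D :: "('v, 'a) mpol^'v^'v" where "D = (\<chi> k l. (if k = l then 1 else 0) - n k l)"
  have Dg: "(\<Sum>l\<in>UNIV. D $ k $ l * g l) \<in> K" for k
  proof -
    have "(\<Sum>l\<in>UNIV. D $ k $ l * g l) = (\<Sum>l\<in>UNIV. (if k = l then g l else 0) - n k l * g l)"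
      unfolding D_def by (rule sum.cong) (auto simp: left_diff_distrib)
    also have "\<dots> = g k - (\<Sum>l\<in>UNIV. n k l * g l)" by (simp add: sum_subtractf)
    finally show ?thesis using n(2) by simp
  qed
  have Dgk: "det D * g k \<in> K" for k
  proof -
    define C where "C f = (\<chi> i j. if j = k then f i else D $ i $ j)" for f :: "'v \<Rightarrow> ('v, 'a) mpol"
    have "det (C (\<lambda>r. \<Sum>s\<in>UNIV. D $ r $ s * g s)) - det (C (\<lambda>_. 0)) \<in> K"
      by (rule det_diff_in_ideal[OF K]) (use Dg rmod.subspace_0[OF K] in \<open>auto simp: C_def\<close>)
    moreover have "det (C (\<lambda>r. \<Sum>s\<in>UNIV. D $ r $ s * 0)) = 0 * det D" unfolding C_def by (rule cramer_comm_ring)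
    then have C0: "det (C (\<lambda>_. 0)) = 0" by (simp only: mult_zero_right mult_zero_left sum.neutral_const)
    moreover have "det (C (\<lambda>r. \<Sum>s\<in>UNIV. D $ r $ s * g s)) = g k * det D" unfolding C_def by (rule cramer_comm_ring)
    ultimately show ?thesis using C0 by (simp add: mult.commute)
  qed
  have "det D - det (mat 1 :: ('v, 'a) mpol^'v^'v) \<in> {F. peval a F = 0}"
    by (rule det_diff_in_ideal[OF subspace_peval_kernel]) (use n(1) in \<open>auto simp: D_def mat_def peval_simps\<close>)
  then have "peval a (det D) = 1" by (simp add: peval_simps)
  moreover have "det D * x \<in> K" if x: "peval a x = 0" for x
  proof -
    obtain c where c: "x = (\<Sum>k\<in>UNIV. c k * g k)" using peval_zero_decompose[OF x] unfolding g_def by blast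
    have "(\<Sum>k\<in>UNIV. c k * (det D * g k)) \<in> K" by (intro rmod.subspace_sum[OF K] rmod.subspace_scale[OF K] Dgk)
    then show ?thesis by (simp add: c sum_distrib_left mult.left_commute)
  qed
  ultimately show thesis using that by blast
qed

subsection \<open>Cotangent vectors\<close>

definition pgrad :: "('v::finite \<Rightarrow> 'a) \<Rightarrow> ('v, 'a::comm_ring_1) mpol \<Rightarrow> 'a^'v" where
  "pgrad a f = (\<chi> k. peval a (partial k f))"

lemma pgrad_add: "pgrad a (f + g) = pgrad a f + pgrad a g"
  by (simp add: pgrad_def vec_eq_iff partial_add peval_simps)
lemma pgrad_diff: "pgrad a (f - g) = pgrad a f - pgrad a g"
  by (simp add: pgrad_def vec_eq_iff partial_diff peval_simps)
lemma pgrad_mult: "pgrad a (f * g) = peval a f *s pgrad a g + peval a g *s pgrad a f"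
  by (simp add: pgrad_def vec_eq_iff partial_mult peval_simps mult.commute)
lemma pgrad_sum: "pgrad a (sum f A) = (\<Sum>x\<in>A. pgrad a (f x))"
  by (simp add: pgrad_def vec_eq_iff partial_sum peval_simps)
lemma pgrad_mvar: "pgrad a (mvar i) = axis i 1"
  by (simp add: pgrad_def vec_eq_iff partial_mvar axis_def)
lemma pgrad_mconst: "pgrad a (mconst c) = 0"
  by (simp add: pgrad_def vec_eq_iff)
lemma pgrad_1: "pgrad a 1 = 0"
  by (simp add: pgrad_def vec_eq_iff)

lemma partial_eq_apply_field: "partial k f = apply_field (\<lambda>j. if j = k then 1 else 0) f"
  by (simp add: apply_field_def if_distrib[of "\<lambda>x. x * _"] cong: if_cong)

lemma peval_jac: "peval a (jac p q F x y) = rowdet ((\<lambda>r. pgrad a (F r))(p := pgrad a x, q := pgrad a y))"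
  unfolding jac_def rowdet_def peval_det
  by (rule arg_cong[of _ _ det]) (auto simp: vec_eq_iff pgrad_def)

lemma rowdet_nonzero_of_spanning:
  fixes M :: "'n::finite \<Rightarrow> 'a::field^'n"
  assumes "\<And>k. \<exists>c. axis k 1 = (\<Sum>r\<in>UNIV. c r *s M r)"
  shows "rowdet M \<noteq> 0"
proof -
  obtain c where c: "\<And>k. axis k 1 = (\<Sum>r\<in>UNIV. c k r *s M r)" using assms by metis
  have "(\<chi> k r. c k r) ** (\<chi> r. M r) = mat 1"
    using c by (simp add: vec_eq_iff matrix_matrix_mult_def mat_def axis_def sum_component) metis
  then have "det (\<chi> k r. c k r) * rowdet M = 1" unfolding rowdet_def by (metis det_mul det_I)
  then show ?thesis by auto
qed

lemma rowdet_zero_relation: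
  fixes M :: "'n::finite \<Rightarrow> 'a::field^'n"
  assumes "rowdet M = 0"
  obtains x where "x \<noteq> 0" "(\<Sum>r\<in>UNIV. (x $ r) *s M r) = 0"
proof -
  have "\<nexists>B. B ** transpose (\<chi> r. M r) = mat 1"
  proof
    assume "\<exists>B. B ** transpose (\<chi> r. M r) = mat 1"
    then obtain B where "B ** transpose (\<chi> r. M r) = mat 1" by blast
    then have "det B * det (\<chi> r. M r) = 1" by (metis det_mul det_I det_transpose)
    with assms show False by (simp add: rowdet_def)
  qed
  then obtain x where x: "x \<noteq> 0" "transpose (\<chi> r. M r) *v x = 0"
    unfolding matrix_left_invertible_ker by blast
  from x(2) have "(\<Sum>r\<in>UNIV. (x $ r) *s M r) = 0"
    by (simp add: vec_eq_iff matrix_vector_mult_def transpose_def sum_component mult.commute)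
  with x(1) show thesis by (rule that)
qed

lemma sum_split_two: "p \<noteq> q \<Longrightarrow> (\<Sum>r\<in>(UNIV::'v::finite set). f r) = f p + (f q + (\<Sum>r\<in>- {p, q}. f r))"
proof -
  assume pq: "p \<noteq> q"
  have "(UNIV :: 'v set) = insert p (insert q (- {p, q}))" by auto
  then have "(\<Sum>r\<in>(UNIV::'v set). f r) = (\<Sum>r\<in>insert p (insert q (- {p, q})). f r)" by simp
  with pq show ?thesis by simp
qed

text \<open>Elements of \<open>I\<close> are combinations of the \<open>F r\<close> only after
  multiplication by a power of \<open>mvar i\<close>. This power has value \<open>1\<close> at
  \<open>a\<close> and the element has value \<open>0\<close>, so the differential is
  unchanged.\<close>

lemma jet_ideal_2_pgrad:
  fixes a :: "'v::finite \<Rightarrow> 'a::field" and T :: "'v set"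
  assumes ai: "a i = 1" and I: "rmod.subspace I" "I \<subseteq> hpt a"
    and F: "\<And>r. r \<in> T \<Longrightarrow> F r \<in> I" "I \<subseteq> saturation (rmod.span (F ` T))"
    and x: "x \<in> jet_ideal I i (hpt a) 2"
  obtains h c where "pgrad a x = (\<Sum>r\<in>T. h r *s pgrad a (F r)) + c *s axis i 1"
proof -
  note m = chart_max_hpt[where a = a and i = i, OF ai]
  obtain f c w where x: "x = f + c * (mvar i - 1) + w" "f \<in> I" "w \<in> chart_power i (hpt a) 2"
    by (rule jet_ideal_decompose[OF I(1) x])
  have "pgrad a w = 0"
  proof -
    have "partial k w \<in> chart_power i (hpt a) 1" for k
      unfolding partial_eq_apply_field by (rule apply_field_chart_power) (use x(3) in \<open>simp add: numeral_2_eq_2\<close>)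
    then show ?thesis by (simp add: chart_power_1[unfolded One_nat_def] m pgrad_def vec_eq_iff)
  qed
  moreover have "pgrad a (c * (mvar i - 1)) = peval a c *s axis i 1"
    by (simp add: pgrad_mult pgrad_diff pgrad_mvar pgrad_1 peval_simps ai)
  moreover obtain h where "pgrad a f = (\<Sum>r\<in>T. h r *s pgrad a (F r))"
  proof -
    obtain N where "mvar i ^ N * f \<in> rmod.span (F ` T)" using F(2) x(2) unfolding saturation_def by blast
    then obtain h where h: "mvar i ^ N * f = (\<Sum>r\<in>T. h r * F r)" using in_span_image[of T, OF finite] by metis
    have "peval a f = 0" using x(2) I(2) hpt_subset by blast
    then have "pgrad a f = pgrad a (mvar i ^ N * f)" by (simp add: pgrad_mult peval_simps ai)
    also have "\<dots> = (\<Sum>r\<in>T. peval a (h r) *s pgrad a (F r))"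
      unfolding h pgrad_sum
    proof (rule sum.cong)
      fix r assume "r \<in> T"
      then have "peval a (F r) = 0" using F(1) I(2) hpt_subset by blast
      then show "pgrad a (h r * F r) = peval a (h r) *s pgrad a (F r)" by (simp add: pgrad_mult)
    qed simp
    finally show thesis by (rule that)
  qed
  ultimately have "pgrad a x = (\<Sum>r\<in>T. h r *s pgrad a (F r)) + peval a c *s axis i 1"
    by (simp add: x(1) pgrad_add)
  then show thesis by (rule that)
qed

text \<open>The differentials of the equations, of \<open>mvar i\<close> and of the cotangent
  generator \<open>v\<close> span the whole space, and their number is its dimension.\<close>

lemma jacobian_at_regular_point:
  fixes a :: "'v::finite \<Rightarrow> 'a::field"
  assumes pq: "p \<noteq> q" and ai: "a i = 1" and I: "rmod.subspace I" "I \<subseteq> hpt a"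
    and F: "\<And>r. r \<in> - {p, q} \<Longrightarrow> F r \<in> I" "I \<subseteq> saturation (rmod.span (F ` (- {p, q})))"
    and v: "\<And>x. peval a x = 0 \<Longrightarrow> \<exists>c. x - mconst c * v \<in> jet_ideal I i (hpt a) 2"
  shows "peval a (jac p q F (mvar i) v) \<noteq> 0"
  unfolding peval_jac pgrad_mvar
proof (rule rowdet_nonzero_of_spanning)
  fix k
  let ?M = "(\<lambda>r. pgrad a (F r))(p := axis i 1, q := pgrad a v)"
  define g where "g = mvar k - mconst (a k)"
  have "peval a g = 0" by (simp add: g_def peval_simps)
  then obtain c where "g - mconst c * v \<in> jet_ideal I i (hpt a) 2" using v by blast
  then obtain h c' where hc: "pgrad a (g - mconst c * v) = (\<Sum>r\<in>- {p, q}. h r *s pgrad a (F r)) + c' *s axis i 1"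
    using jet_ideal_2_pgrad[where a = a and i = i, OF ai I F] by metis
  have "pgrad a (g - mconst c * v) = axis k 1 - c *s pgrad a v"
    by (simp add: g_def pgrad_diff pgrad_mvar pgrad_mconst pgrad_mult)
  with hc have "axis k 1 = c' *s axis i 1 + (c *s pgrad a v + (\<Sum>r\<in>- {p, q}. h r *s pgrad a (F r)))"
    by (simp add: algebra_simps)
  also have "\<dots> = (\<Sum>r\<in>UNIV. (if r = p then c' else if r = q then c else h r) *s ?M r)"
    unfolding sum_split_two[OF pq] using pq by (auto intro!: sum.cong)
  finally show "\<exists>c. axis k 1 = (\<Sum>r\<in>UNIV. c r *s ?M r)"
    by (intro exI[of _ "\<lambda>r. if r = p then c' else if r = q then c else h r"])
qed

lemma exists_mvar_jac_nonzero:
  assumes "peval a (jac p q F x v) \<noteq> 0"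
  shows "\<exists>k. peval a (jac p q F x (mvar k)) \<noteq> 0"
proof (rule ccontr)
  assume "\<not> ?thesis"
  then have "peval a (jac p q F x v) = 0" by (subst jac_right) (simp add: peval_simps)
  with assms show False by simp
qed

text \<open>At a node the tangent space is two-dimensional, so one of the equations \<open>F r0\<close> is singular and
  its second-order part is a unit times \<open>U * V\<close>. Up to units the Hamiltonian field
  \<open>jac (mvar i)\<close> is then \<open>V \<partial>/\<partial>V - U \<partial>/\<partial>U\<close>, so its components generate the maximal ideal.\<close>

lemma jacobian_at_node:
  fixes a :: "'v::finite \<Rightarrow> 'a::field"
  assumes pq: "p \<noteq> q" and ai: "a i = 1" and I: "rmod.subspace I" "I \<subseteq> hpt a"
    and F: "\<And>r. r \<in> - {p, q} \<Longrightarrow> F r \<in> I" "I \<subseteq> saturation (rmod.span (F ` (- {p, q})))"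
    and UV: "peval a U = 0" "peval a V = 0" "U * V \<in> jet_ideal I i (hpt a) 3"
    and gen: "\<And>x. peval a x = 0 \<Longrightarrow> \<exists>\<alpha> \<beta>. x - (\<alpha> * U + \<beta> * V) \<in> jet_ideal I i (hpt a) 2"
    and sing: "\<And>k. peval a (jac p q F (mvar i) (mvar k)) = 0"
    and x: "peval a x = 0"
  shows "x \<in> rmod.span ({jac p q F (mvar k) (mvar l) | k l. True} \<union> I \<union> {mvar i - 1} \<union> chart_power i (hpt a) 2)"
proof -
  note m = chart_max_hpt[where a = a and i = i, OF ai]
  let ?cp = "chart_power i (hpt a)"
  let ?g = "pgrad a"
  define J where "J = {jac p q F (mvar k) (mvar l) | k l. True}"
  define K where "K = rmod.span (J \<union> I \<union> {mvar i - 1} \<union> ?cp 2)"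
  have sK: "rmod.subspace K" unfolding K_def by (rule rmod.subspace_span)
  have inK: "y \<in> K" if "y \<in> J \<union> I \<union> {mvar i - 1} \<union> ?cp 2" for y
    unfolding K_def using that by (rule rmod.span_base)
  have jacK: "jac p q F y z \<in> K" for y z
  proof -
    have "rmod.span J \<subseteq> K" unfolding K_def by (rule rmod.span_mono) blast
    then show ?thesis using jac_in_span[OF pq, of F y z] unfolding J_def by blast
  qed
  have nosm: "peval a (jac p q F (mvar i) b) = 0" for b
    using exists_mvar_jac_nonzero[of a p q F "mvar i" b] sing by blast
  have Fa: "peval a (F r) = 0" if "r \<in> - {p, q}" for r using F(1)[OF that] I(2) hpt_subset by blast

  \<comment> \<open>The equations, \<open>mvar i\<close>, \<open>U\<close> and \<open>V\<close> have
    differentials that span, but they are one more than the dimension.\<close>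
  have span: "\<exists>\<alpha> \<beta> h c. axis k 1 = \<alpha> *s ?g U + \<beta> *s ?g V + ((\<Sum>r\<in>- {p, q}. h r *s ?g (F r)) + c *s axis i 1)" for k
  proof -
    define y where "y = mvar k - mconst (a k)"
    have "peval a y = 0" by (simp add: y_def peval_simps)
    then obtain \<alpha> \<beta> where "y - (\<alpha> * U + \<beta> * V) \<in> jet_ideal I i (hpt a) 2" using gen by blast
    then obtain h c where "?g (y - (\<alpha> * U + \<beta> * V)) = (\<Sum>r\<in>- {p, q}. h r *s ?g (F r)) + c *s axis i 1"
      using jet_ideal_2_pgrad[where a = a and i = i, OF ai I F] by metis
    moreover have "?g (y - (\<alpha> * U + \<beta> * V)) = axis k 1 - (peval a \<alpha> *s ?g U + peval a \<beta> *s ?g V)"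
      by (simp add: y_def pgrad_diff pgrad_add pgrad_mvar pgrad_mconst pgrad_mult UV)
    ultimately have "axis k 1 = peval a \<alpha> *s ?g U + peval a \<beta> *s ?g V + ((\<Sum>r\<in>- {p, q}. h r *s ?g (F r)) + c *s axis i 1)"
      by (simp add: algebra_simps)
    then show ?thesis by blast
  qed

  define R where "R r0 = (\<lambda>r. ?g (F r))(p := axis i 1, q := ?g V, r0 := ?g U)" for r0
  have indep: "rowdet (R r0) \<noteq> 0"
    if r0: "r0 \<in> - {p, q}" and rel: "?g (F r0) = (\<Sum>r\<in>- {p, q} - {r0}. b r *s ?g (F r)) + c *s axis i 1" for r0 b c
  proof (rule rowdet_nonzero_of_spanning)
    fix k
    have r0p: "p \<noteq> r0" "q \<noteq> r0" "r0 \<noteq> p" "r0 \<noteq> q" using r0 by auto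
    obtain \<alpha> \<beta> h c' where k: "axis k 1 = \<alpha> *s ?g U + \<beta> *s ?g V + ((\<Sum>r\<in>- {p, q}. h r *s ?g (F r)) + c' *s axis i 1)"
      using span by blast
    have "(\<Sum>r\<in>- {p, q}. h r *s ?g (F r)) = h r0 *s ?g (F r0) + (\<Sum>r\<in>- {p, q} - {r0}. h r *s ?g (F r))"
      by (rule sum.remove) (use r0 in auto)
    also have "\<dots> = (\<Sum>r\<in>- {p, q} - {r0}. (h r + h r0 * b r) *s ?g (F r)) + (h r0 * c) *s axis i 1"
      unfolding rel by (simp add: vec_eq_iff sum_component distrib_right distrib_left sum.distrib sum_distrib_left mult.assoc)
    finally have h: "(\<Sum>r\<in>- {p, q}. h r *s ?g (F r)) = (\<Sum>r\<in>- {p, q} - {r0}. (h r + h r0 * b r) *s ?g (F r)) + (h r0 * c) *s axis i 1" .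
    define e where "e r = (if r = p then h r0 * c + c' else if r = q then \<beta> else if r = r0 then \<alpha> else h r + h r0 * b r)" for r
    have "(\<Sum>r\<in>UNIV. e r *s R r0 r) = (h r0 * c + c') *s axis i 1 + (\<beta> *s ?g V + (\<Sum>r\<in>- {p, q}. e r *s R r0 r))"
      unfolding sum_split_two[OF pq] using pq r0p by (simp add: e_def R_def)
    also have "(\<Sum>r\<in>- {p, q}. e r *s R r0 r) = \<alpha> *s ?g U + (\<Sum>r\<in>- {p, q} - {r0}. e r *s R r0 r)"
      using r0 by (subst sum.remove[of _ r0]) (auto simp: e_def R_def)
    also have "(\<Sum>r\<in>- {p, q} - {r0}. e r *s R r0 r) = (\<Sum>r\<in>- {p, q} - {r0}. (h r + h r0 * b r) *s ?g (F r))"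
      by (rule sum.cong) (auto simp: e_def R_def)
    finally have "axis k 1 = (\<Sum>r\<in>UNIV. e r *s R r0 r)"
      unfolding k h by (simp add: vec_eq_iff algebra_simps)
    then show "\<exists>e. axis k 1 = (\<Sum>r\<in>UNIV. e r *s R r0 r)" by blast
  qed

  \<comment> \<open>The vanishing bracket of \<open>mvar i\<close> and \<open>V\<close> gives a
    linear relation of the rows. Were \<open>V\<close> involved, it could be eliminated and the rows
    with \<open>U\<close> instead would form a basis, although their determinant vanishes too. Nor
    can the relation consist of \<open>mvar i\<close> alone, so some equation \<open>F r0\<close>
    occurs.\<close>
  have "\<exists>r0 b c. r0 \<in> - {p, q} \<and> ?g (F r0) = (\<Sum>r\<in>- {p, q} - {r0}. b r *s ?g (F r)) + c *s axis i 1"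
  proof -
    define M where "M W = (\<lambda>r. ?g (F r))(p := axis i 1, q := ?g W)" for W
    have M0: "rowdet (M W) = 0" for W using nosm[of W] unfolding peval_jac pgrad_mvar M_def .
    obtain z where z: "z \<noteq> 0" "(\<Sum>r\<in>UNIV. (z $ r) *s M V r) = 0" by (rule rowdet_zero_relation[OF M0[of V]])
    have "(\<Sum>r\<in>- {p, q}. (z $ r) *s M V r) = (\<Sum>r\<in>- {p, q}. (z $ r) *s ?g (F r))"
      by (rule sum.cong) (auto simp: M_def)
    with z(2) have z2: "(z $ p) *s axis i 1 + ((z $ q) *s ?g V + (\<Sum>r\<in>- {p, q}. (z $ r) *s ?g (F r))) = 0"
      unfolding sum_split_two[OF pq] using pq by (simp add: M_def)
    have neg2: "y = - (x + s)" if "x + (y + s) = 0" for x y s :: "'a^'v"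
      using that by (metis add.left_commute eq_neg_iff_add_eq_0)
    have zq: "z $ q = 0"
    proof (rule ccontr)
      assume zq: "z $ q \<noteq> 0"
      have "(z $ q) *s ?g V = - ((z $ p) *s axis i 1 + (\<Sum>r\<in>- {p, q}. (z $ r) *s ?g (F r)))"
        by (rule neg2[OF z2])
      then have "inverse (z $ q) *s ((z $ q) *s ?g V) = inverse (z $ q) *s - ((z $ p) *s axis i 1 + (\<Sum>r\<in>- {p, q}. (z $ r) *s ?g (F r)))"
        by simp
      then have gV: "?g V = inverse (z $ q) *s - ((z $ p) *s axis i 1 + (\<Sum>r\<in>- {p, q}. (z $ r) *s ?g (F r)))"
        using zq by (simp add: vec_eq_iff)
      have "rowdet (M U) \<noteq> 0"
      proof (rule rowdet_nonzero_of_spanning)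
        fix k
        obtain \<alpha> \<beta> h c where k: "axis k 1 = \<alpha> *s ?g U + \<beta> *s ?g V + ((\<Sum>r\<in>- {p, q}. h r *s ?g (F r)) + c *s axis i 1)"
          using span by blast
        define t where "t = \<beta> * inverse (z $ q)"
        define e where "e r = (if r = p then c - t * z $ p else if r = q then \<alpha> else h r - t * z $ r)" for r
        have "(\<Sum>r\<in>UNIV. e r *s M U r) = (c - t * z $ p) *s axis i 1 + (\<alpha> *s ?g U + (\<Sum>r\<in>- {p, q}. e r *s M U r))"
          unfolding sum_split_two[OF pq] using pq by (simp add: e_def M_def)
        also have "(\<Sum>r\<in>- {p, q}. e r *s M U r) = (\<Sum>r\<in>- {p, q}. (h r - t * z $ r) *s ?g (F r))"
          by (rule sum.cong) (auto simp: e_def M_def)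
        also have "\<dots> = (\<Sum>r\<in>- {p, q}. h r *s ?g (F r)) - t *s (\<Sum>r\<in>- {p, q}. (z $ r) *s ?g (F r))"
          by (simp add: vec_eq_iff sum_component left_diff_distrib sum_subtractf sum_distrib_left mult.assoc)
        finally have "axis k 1 = (\<Sum>r\<in>UNIV. e r *s M U r)"
          unfolding k gV t_def by (simp add: vec_eq_iff algebra_simps)
        then show "\<exists>e. axis k 1 = (\<Sum>r\<in>UNIV. e r *s M U r)" by blast
      qed
      with M0 show False by blast
    qed
    have "\<exists>r0\<in>- {p, q}. z $ r0 \<noteq> 0"
    proof (rule ccontr)
      assume "\<not> ?thesis"
      then have zr: "z $ r = 0" if "r \<in> - {p, q}" for r using that by blast
      then have "(z $ p) *s axis i (1::'a) = 0" using z2 zq by simp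
      then have "((z $ p) *s axis i (1::'a)) $ i = 0" by simp
      then have "z $ p = 0" by (simp add: axis_def)
      then have "z = 0" using zq zr by (simp add: vec_eq_iff) (metis ComplI insertE singletonD)
      with z(1) show False by blast
    qed
    then obtain r0 where r0: "r0 \<in> - {p, q}" "z $ r0 \<noteq> 0" by blast
    have s: "(\<Sum>r\<in>- {p, q}. (z $ r) *s ?g (F r)) = (z $ r0) *s ?g (F r0) + (\<Sum>r\<in>- {p, q} - {r0}. (z $ r) *s ?g (F r))"
      by (rule sum.remove) (use r0 in auto)
    have "?g (F r0) = (\<Sum>r\<in>- {p, q} - {r0}. (- inverse (z $ r0) * z $ r) *s ?g (F r)) + (- inverse (z $ r0) * z $ p) *s axis i 1"
    proof -
      have "(z $ r0) * ?g (F r0) $ j + (\<Sum>r\<in>- {p, q} - {r0}. z $ r * ?g (F r) $ j) + z $ p * axis i 1 $ j = 0" for j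
      proof -
        have "((z $ p) *s axis i 1 + ((z $ q) *s ?g V + (\<Sum>r\<in>- {p, q}. (z $ r) *s ?g (F r)))) $ j = 0" unfolding z2 by simp
        then show ?thesis unfolding s zq by (simp add: sum_component algebra_simps)
      qed
      then have "?g (F r0) $ j = - inverse (z $ r0) * ((\<Sum>r\<in>- {p, q} - {r0}. z $ r * ?g (F r) $ j) + z $ p * axis i 1 $ j)" for j
        using r0(2) by (simp add: field_simps eq_neg_iff_add_eq_0)
      then show ?thesis
        by (simp add: vec_eq_iff sum_component distrib_left sum_distrib_left mult.assoc)
    qed
    with r0(1) show ?thesis
      by (intro exI[of _ r0] exI[of _ "\<lambda>r. - inverse (z $ r0) * z $ r"] exI[of _ "- inverse (z $ r0) * z $ p"] conjI)
  qed
  then obtain r0 b0 c0 where r0: "r0 \<in> - {p, q}"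
    and rel0: "?g (F r0) = (\<Sum>r\<in>- {p, q} - {r0}. b0 r *s ?g (F r)) + c0 *s axis i 1" by blast

  \<comment> \<open>The factor \<open>t = mvar i ^ N\<close>, of value \<open>1\<close> at the
    point, clears the saturation and writes \<open>U * V\<close> by the equations, up to a multiple
    of \<open>mvar i - 1\<close> and terms of third order.\<close>
  obtain f c w where UVd: "U * V = f + c * (mvar i - 1) + w" "f \<in> I" "w \<in> ?cp 3"
    by (rule jet_ideal_decompose[OF I(1) UV(3)])
  obtain N where N: "mvar i ^ N * f \<in> rmod.span (F ` (- {p, q}))" using F(2) UVd(2) unfolding saturation_def by blast
  obtain h where h: "mvar i ^ N * f = (\<Sum>r\<in>- {p, q}. h r * F r)" by (rule in_span_image[OF finite N])
  define t :: "('v, 'a) mpol" where "t = mvar i ^ N"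
  have ta: "peval a t = 1" by (simp add: t_def peval_simps ai)
  have main: "t * U * V = (\<Sum>r\<in>- {p, q}. h r * F r) + (t * c) * (mvar i - 1) + t * w"
    using h UVd(1) unfolding t_def by (simp add: mult.assoc distrib_left)
  have tw: "t * w \<in> ?cp 3" by (rule rmod.subspace_scale[OF subspace_chart_power UVd(3)])

  text \<open>Differentiating twice along the directions dual to \<open>U\<close> and \<open>V\<close> shows that some equation
    occurs in \<open>U * V\<close> with a unit coefficient.\<close>
  have "\<exists>r1\<in>- {p, q}. peval a (h r1) \<noteq> 0"
  proof (rule ccontr)
    assume "\<not> ?thesis"
    then have ha: "peval a (h r) = 0" if "r \<in> - {p, q}" for r using that by blast
    \<comment> \<open>The columns of \<open>B\<close> are dual to the rows \<open>R r0\<close>. Thus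
      \<open>D r0\<close> and \<open>D q\<close> are dual to \<open>U\<close> and \<open>V\<close>,
      kill \<open>mvar i - 1\<close>, and vanish at \<open>a\<close> on all equations, on
      \<open>F r0\<close> by its dependence.\<close>
    define A :: "'a^'v^'v" where "A = (\<chi> r. R r0 r)"
    have "det A \<noteq> 0" using indep[OF r0 rel0] by (simp add: rowdet_def A_def)
    then obtain B where B: "A ** B = mat 1" using invertible_det_nz[of A] unfolding invertible_def by blast
    have dual: "(\<Sum>k\<in>UNIV. R r0 r $ k * B $ k $ s) = (if r = s then 1 else 0)" for r s
      using B by (simp add: vec_eq_iff matrix_matrix_mult_def mat_def A_def)
    define D where "D s = apply_field (\<lambda>k. mconst (B $ k $ s))" for s
    have pD: "peval a (D s y) = (\<Sum>k\<in>UNIV. ?g y $ k * B $ k $ s)" for s y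
      by (simp add: D_def apply_field_def peval_simps pgrad_def mult.commute)
    have rp: "R r0 p = axis i 1" and rq: "R r0 q = ?g V" and rr: "R r0 r0 = ?g U"
      using pq r0 by (auto simp: R_def)
    have DU: "peval a (D r0 U) = 1" "peval a (D q U) = 0"
      unfolding pD rr[symmetric] dual using r0 by auto
    have DV: "peval a (D r0 V) = 0" "peval a (D q V) = 1"
      unfolding pD rq[symmetric] dual using r0 by auto
    have Di: "B $ i $ s = 0" if "s \<noteq> p" for s
    proof -
      have "(\<Sum>k\<in>UNIV. axis i 1 $ k * B $ k $ s) = 0" using dual[of p s] that unfolding rp by simp
      moreover have "(\<Sum>k\<in>UNIV. axis i 1 $ k * B $ k $ s) = (\<Sum>k\<in>UNIV. if k = i then B $ k $ s else 0)"
        by (rule sum.cong) (auto simp: axis_def)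
      ultimately show ?thesis by simp
    qed
    have DF: "peval a (D s (F r)) = 0" if s: "s = r0 \<or> s = q" and r: "r \<in> - {p, q}" for s r
    proof -
      have other: "(\<Sum>k\<in>UNIV. ?g (F r) $ k * B $ k $ s) = 0" if "r \<in> - {p, q} - {r0}" for r
      proof -
        have "R r0 r = ?g (F r)" using that by (auto simp: R_def)
        then show ?thesis using dual[of r s] that s by auto
      qed
      show ?thesis
      proof (cases "r = r0")
        case False
        with other r show ?thesis unfolding pD by simp
      next
        case True
        have "(\<Sum>k\<in>UNIV. ?g (F r0) $ k * B $ k $ s)
            = (\<Sum>r\<in>- {p, q} - {r0}. b0 r * (\<Sum>k\<in>UNIV. ?g (F r) $ k * B $ k $ s))
              + c0 * (\<Sum>k\<in>UNIV. axis i 1 $ k * B $ k $ s)"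
          unfolding rel0 by (simp add: sum_component distrib_right sum.distrib sum_distrib_left sum_distrib_right mult.assoc)
            (rule sum.swap)
        also have "(\<Sum>k\<in>UNIV. axis i 1 $ k * B $ k $ s) = 0" using dual[of p s] s pq r0 unfolding rp by auto
        finally show ?thesis unfolding True pD using other by simp
      qed
    qed
    \<comment> \<open>This mixed second derivative at \<open>a\<close> is \<open>1\<close> on the
      left side of \<open>main\<close>, whereas all terms on the right side vanish if every
      \<open>h r\<close> does.\<close>
    define S where "S y = peval a (D q (D r0 y))" for y
    have Sadd: "S (y + z) = S y + S z" for y z
      by (simp add: S_def D_def apply_field_add peval_simps)
    have Smult: "S (y * z) = peval a y * S z + peval a z * S y + peval a (D r0 y) * peval a (D q z)
        + peval a (D q y) * peval a (D r0 z)" for y z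
      by (simp add: S_def D_def apply_field_mult apply_field_add peval_simps algebra_simps)
    have Ssum: "S (sum y A) = (\<Sum>x\<in>A. S (y x))" for y :: "'v \<Rightarrow> _" and A
      by (induction A rule: infinite_finite_induct) (simp_all add: Sadd, simp_all add: S_def D_def)
    have Dt: "peval a (D s t) * peval a U = 0" for s by (simp add: UV)
    have "S (t * U * V) = 1"
    proof -
      have "peval a (D r0 (t * U)) = 1" "peval a (D q (t * U)) = 0"
        by (simp_all add: D_def[of r0] D_def[of q] apply_field_mult peval_simps UV ta)
          (simp_all flip: D_def add: DU)
      then show ?thesis unfolding Smult[of "t * U" V] using DV UV by (simp add: peval_simps)
    qed
    moreover have "S (\<Sum>r\<in>- {p, q}. h r * F r) = 0"
      unfolding Ssum by (rule sum.neutral) (simp add: Smult ha Fa DF)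
    moreover have "S ((t * c) * (mvar i - 1)) = 0"
    proof -
      have d: "D s (mvar i - 1) = 0" if "s = r0 \<or> s = q" for s
        using Di[of s] that r0 pq by (auto simp: D_def apply_field_diff apply_field_mvar)
      then show ?thesis unfolding Smult by (simp add: ai peval_simps S_def) (simp add: D_def)
    qed
    moreover have "S (t * w) = 0"
    proof -
      have "D r0 (t * w) \<in> ?cp (Suc (Suc 0))" unfolding D_def
        by (rule apply_field_chart_power) (use tw in \<open>simp add: numeral_3_eq_3\<close>)
      then have "D q (D r0 (t * w)) \<in> ?cp (Suc 0)" unfolding D_def[of q] by (rule apply_field_chart_power)
      then show ?thesis unfolding S_def using chart_power_1[of i "hpt a"] m by auto
    qed
    ultimately show False unfolding main Sadd by simp
  qed
  then obtain r1 where r1: "r1 \<in> - {p, q}" and h1: "peval a (h r1) \<noteq> 0" by blast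

  have gtw: "partial s (t * w) \<in> ?cp 2" for s
    unfolding partial_eq_apply_field by (rule apply_field_chart_power) (use tw in simp)
  have cp2_peval: "peval a y = 0" if "y \<in> ?cp 2" for y
  proof -
    have "y \<in> ?cp (Suc 0)" using that chart_power_antimono[of i "hpt a" 1] by (auto simp: numeral_2_eq_2)
    then show ?thesis using chart_power_1[of i "hpt a"] m by auto
  qed
  \<comment> \<open>The differential of \<open>main\<close> at \<open>a\<close> is a relation in
    which \<open>F r1\<close> has a nonzero coefficient, so \<open>indep\<close> applies to
    \<open>r1\<close> as well.\<close>
  have "?g (t * U * V) = 0" by (simp add: pgrad_mult peval_simps UV)
  moreover have "?g (t * w) = 0" using cp2_peval[OF gtw] by (simp add: pgrad_def vec_eq_iff)
  moreover have "?g (\<Sum>r\<in>- {p, q}. h r * F r) = (\<Sum>r\<in>- {p, q}. peval a (h r) *s ?g (F r))"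
    unfolding pgrad_sum by (rule sum.cong) (simp_all add: pgrad_mult Fa)
  moreover have "?g ((t * c) * (mvar i - 1)) = peval a c *s axis i 1"
    by (simp add: pgrad_mult[of a "t * c"] pgrad_diff pgrad_mvar pgrad_1 peval_simps ai ta)
  ultimately have rel: "(\<Sum>r\<in>- {p, q}. peval a (h r) *s ?g (F r)) + peval a c *s axis i 1 = 0"
    unfolding main by (simp add: pgrad_add)
  have "?g (F r1) = (\<Sum>r\<in>- {p, q} - {r1}. (- inverse (peval a (h r1)) * peval a (h r)) *s ?g (F r))
      + (- inverse (peval a (h r1)) * peval a c) *s axis i 1"
  proof -
    have s: "(\<Sum>r\<in>- {p, q}. peval a (h r) *s ?g (F r)) = peval a (h r1) *s ?g (F r1) + (\<Sum>r\<in>- {p, q} - {r1}. peval a (h r) *s ?g (F r))"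
      by (rule sum.remove) (use r1 in auto)
    have "peval a (h r1) * ?g (F r1) $ j + (\<Sum>r\<in>- {p, q} - {r1}. peval a (h r) * ?g (F r) $ j) + peval a c * axis i 1 $ j = 0" for j
    proof -
      have "((\<Sum>r\<in>- {p, q}. peval a (h r) *s ?g (F r)) + peval a c *s axis i 1) $ j = 0" unfolding rel by simp
      then show ?thesis unfolding s by (simp add: sum_component)
    qed
    then have "?g (F r1) $ j = - inverse (peval a (h r1)) * ((\<Sum>r\<in>- {p, q} - {r1}. peval a (h r) * ?g (F r) $ j) + peval a c * axis i 1 $ j)" for j
      using h1 by (simp add: field_simps eq_neg_iff_add_eq_0)
    then show ?thesis
      by (simp add: vec_eq_iff sum_component distrib_left sum_distrib_left mult.assoc)
  qed
  from indep[OF r1 this] have R1: "rowdet (R r1) \<noteq> 0" .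

  define M where "M y = (\<lambda>r. grad (F r))(p := grad (mvar i), q := grad y)" for y
  define \<delta> where "\<delta> = rowdet ((M V)(r1 := grad U))"
  have \<delta>a: "peval a \<delta> \<noteq> 0"
  proof -
    have "peval a \<delta> = rowdet (R r1)"
      unfolding \<delta>_def rowdet_def peval_det
      by (rule arg_cong[of _ _ det]) (use r1 in \<open>auto simp: vec_eq_iff pgrad_def M_def R_def partial_mvar axis_def\<close>)
    with R1 show ?thesis by simp
  qed
  \<comment> \<open>\<open>E\<close> is what differentiation of \<open>main\<close> yields for
    \<open>h r1\<close> times the gradient of \<open>F r1\<close>, after omitting members of
    \<open>K\<close>.\<close>
  define E where "E = U *s grad V + V *s grad U - (\<Sum>r\<in>- {p, q} - {r1}. h r *s grad (F r)) - (t * c) *s axis i 1"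
  have cong: "h r1 * partial s (F r1) - E $ s \<in> K" for s
  proof -
    have "partial s (t * U * V) = t * (U * partial s V + V * partial s U) + U * V * partial s t"
      by (simp add: partial_mult algebra_simps)
    moreover have "partial s (t * U * V) = (\<Sum>r\<in>- {p, q}. h r * partial s (F r)) + (\<Sum>r\<in>- {p, q}. F r * partial s (h r))
        + (t * c) * axis i 1 $ s + (mvar i - 1) * partial s (t * c) + partial s (t * w)"
    proof -
      have "partial s (\<Sum>r\<in>- {p, q}. h r * F r) = (\<Sum>r\<in>- {p, q}. h r * partial s (F r)) + (\<Sum>r\<in>- {p, q}. F r * partial s (h r))"
        unfolding partial_sum partial_mult sum.distrib by (simp add: mult.commute)
      moreover have "partial s ((t * c) * (mvar i - 1)) = (t * c) * axis i 1 $ s + (mvar i - 1) * partial s (t * c)"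
        unfolding partial_mult[of s "t * c"] by (simp add: partial_diff partial_mvar axis_def mult.commute)
      ultimately show ?thesis unfolding main partial_add by simp
    qed
    moreover have "(\<Sum>r\<in>- {p, q}. h r * partial s (F r)) = h r1 * partial s (F r1) + (\<Sum>r\<in>- {p, q} - {r1}. h r * partial s (F r))"
      by (rule sum.remove) (use r1 in auto)
    moreover have "E $ s = U * partial s V + V * partial s U - (\<Sum>r\<in>- {p, q} - {r1}. h r * partial s (F r)) - (t * c) * axis i 1 $ s"
      by (simp add: E_def sum_component)
    ultimately have "h r1 * partial s (F r1) - E $ s = (U * partial s V + V * partial s U) * (t - 1) + partial s t * (U * V)
        - (\<Sum>r\<in>- {p, q}. partial s (h r) * F r) - partial s (t * c) * (mvar i - 1) - partial s (t * w)"
      by (simp add: algebra_simps)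
    also have "\<dots> \<in> K"
    proof -
      have k1: "mvar i - 1 \<in> K" by (rule inK) blast
      from power_diff_in_ideal[OF sK this, of N] have k2: "t - 1 \<in> K" by (simp add: t_def)
      have k3: "U * V \<in> K" by (rule inK) (use chart_power_2[of U i "hpt a" V] UV m in auto)
      have k4: "F r \<in> K" if "r \<in> - {p, q}" for r by (rule inK) (use F(1)[OF that] in blast)
      have k5: "partial s (t * w) \<in> K" by (rule inK) (use gtw in blast)
      have k6: "(\<Sum>r\<in>- {p, q}. partial s (h r) * F r) \<in> K"
        by (rule rmod.subspace_sum[OF sK rmod.subspace_scale[OF sK k4]])
      show ?thesis
        by (rule rmod.subspace_diff[OF sK rmod.subspace_diff[OF sK rmod.subspace_diff[OF sK
          rmod.subspace_add[OF sK rmod.subspace_scale[OF sK k2] rmod.subspace_scale[OF sK k3]] k6]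
          rmod.subspace_scale[OF sK k1]] k5])
    qed
    finally show ?thesis .
  qed
  \<comment> \<open>Row \<open>r1\<close> is replaced by \<open>E\<close>. The other gradients and
    \<open>axis i 1\<close> repeat existing rows, so only the parts with \<open>U\<close> and
    \<open>V\<close> survive.\<close>
  have key: "h r1 * jac p q F (mvar i) y - (U * rowdet ((M y)(r1 := grad V)) + V * rowdet ((M y)(r1 := grad U))) \<in> K" for y
  proof -
    have My: "(M y)(r1 := grad (F r1)) = M y" using r1 by (auto simp: M_def)
    have "rowdet ((M y)(r1 := h r1 *s grad (F r1))) - rowdet ((M y)(r1 := E)) \<in> K"
      by (rule rowdet_diff_in_ideal[OF sK]) (use cong in simp)
    moreover have "rowdet ((M y)(r1 := h r1 *s grad (F r1))) = h r1 * jac p q F (mvar i) y"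
      unfolding rowdet_scale My by (simp add: jac_def M_def)
    moreover have "rowdet ((M y)(r1 := E)) = U * rowdet ((M y)(r1 := grad V)) + V * rowdet ((M y)(r1 := grad U))"
    proof -
      have "rowdet ((M y)(r1 := grad (F r))) = 0" if "r \<in> - {p, q} - {r1}" for r
        by (rule rowdet_same[of r r1]) (use that in \<open>auto simp: M_def\<close>)
      moreover have "rowdet ((M y)(r1 := axis i 1)) = 0"
        by (rule rowdet_same[of p r1]) (use r1 pq in \<open>auto simp: M_def grad_mvar\<close>)
      ultimately show ?thesis unfolding E_def rowdet_diff rowdet_add rowdet_scale rowdet_sum by simp
    qed
    ultimately show ?thesis by simp
  qed
  \<comment> \<open>For \<open>y = V\<close>, and below for \<open>y = U\<close>, one of the two
    determinants has a repeated row and the other is \<delta> up to sign.\<close>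
  have "h r1 * jac p q F (mvar i) V - V * \<delta> \<in> K"
  proof -
    have "rowdet ((M V)(r1 := grad V)) = 0"
      by (rule rowdet_same[of q r1]) (use r1 in \<open>auto simp: M_def\<close>)
    with key[of V] show ?thesis by (simp add: \<delta>_def)
  qed
  from rmod.subspace_diff[OF sK rmod.subspace_scale[OF sK jacK, of "h r1" "mvar i" V] this]
  have V\<delta>: "V * \<delta> \<in> K" by simp
  have "h r1 * jac p q F (mvar i) U + U * \<delta> \<in> K"
  proof -
    have "rowdet ((M U)(r1 := grad U)) = 0"
      by (rule rowdet_same[of q r1]) (use r1 in \<open>auto simp: M_def\<close>)
    moreover have "rowdet ((M U)(r1 := grad V)) = - \<delta>"
      unfolding \<delta>_def M_def by (rule rowdet_swap) (use r1 in auto)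
    ultimately show ?thesis using key[of U] by simp
  qed
  from rmod.subspace_diff[OF sK this rmod.subspace_scale[OF sK jacK, of "h r1" "mvar i" U]]
  have U\<delta>: "U * \<delta> \<in> K" by simp
  \<comment> \<open>\<delta> is a unit at the point: replacing it by its value changes the product
    only by an element of the squared maximal ideal, which lies in \<open>K\<close>.\<close>
  have cancel: "W \<in> K" if W: "W * \<delta> \<in> K" "peval a W = 0" for W
  proof -
    have "W * (\<delta> - mconst (peval a \<delta>)) \<in> ?cp 2"
      by (rule chart_power_2) (use W(2) m in \<open>auto simp: peval_simps\<close>)
    then have "W * (\<delta> - mconst (peval a \<delta>)) \<in> K" by (intro inK) blast
    from rmod.subspace_diff[OF sK W(1) this] have "mconst (peval a \<delta>) * W \<in> K" by (simp add: algebra_simps)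
    from rmod.subspace_scale[OF sK this, of "mconst (inverse (peval a \<delta>))"]
    show ?thesis
      by (simp add: mult.assoc[symmetric] mult.commute[of "mconst (inverse _)"] mconst_unit[OF \<delta>a])
  qed
  obtain \<alpha> \<beta> where ab: "x - (\<alpha> * U + \<beta> * V) \<in> jet_ideal I i (hpt a) 2" using gen[OF x] by blast
  have "jet_ideal I i (hpt a) 2 \<subseteq> K" unfolding jet_ideal_eq K_def by (rule rmod.span_mono) blast
  then have "x - (\<alpha> * U + \<beta> * V) \<in> K" using ab by blast
  moreover have "\<alpha> * U + \<beta> * V \<in> K"
    by (intro rmod.subspace_add[OF sK] rmod.subspace_scale[OF sK] cancel[OF U\<delta> UV(1)] cancel[OF V\<delta> UV(2)])
  ultimately have "x \<in> K" using rmod.subspace_add[OF sK] by fastforce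
  then show ?thesis unfolding K_def J_def .
qed

lemma apply_field_sum: "apply_field Y (sum f A) = (\<Sum>x\<in>A. apply_field Y (f x))"
  by (induction A rule: infinite_finite_induct) (simp_all add: apply_field_add)

text \<open>By Euler's formula the radial field multiplies each homogeneous component by its
  degree.\<close>

lemma radial_field_invariant:
  assumes I: "homogeneous_ideal I" and f: "f \<in> I"
  shows "apply_field mvar f \<in> I"
proof -
  have "apply_field mvar f = (\<Sum>e\<in>mdegree ` Poly_Mapping.keys f. apply_field mvar (hom_component e f))"
    by (subst hom_component_sum_self[of f, symmetric]) (rule apply_field_sum)
  also have "\<dots> = (\<Sum>e\<in>mdegree ` Poly_Mapping.keys f. of_nat e * hom_component e f)"
    unfolding apply_field_def by (rule sum.cong) (simp_all add: euler[OF homogeneous_hom_component])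
  also have "\<dots> \<in> I"
    by (intro rmod.subspace_sum rmod.subspace_scale subspace_of_homogeneous[OF I] hom_component_in[OF I f])
  finally show ?thesis .
qed

lemma wedge_mvar: "wedge G (mvar k) (mvar l) = G k * mvar l - G l * mvar k"
  by (simp add: wedge_def apply_field_mvar)

lemma homogeneous_wedge: "(\<And>k. homogeneous m (G k)) \<Longrightarrow> homogeneous (m + 1) (wedge G (mvar k) (mvar l))"
  unfolding wedge_mvar by (intro homogeneous_diff homogeneous_mult homogeneous_mvar)

lemma homogeneous_ideal_span_Un:
  assumes B: "\<And>b. b \<in> B \<Longrightarrow> \<exists>e. homogeneous e b" and K: "homogeneous_ideal K"
  shows "homogeneous_ideal (rmod.span (B \<union> K))"
proof -
  note KK = rmod.span_eq_iff[THEN iffD2, OF subspace_of_homogeneous[OF K]]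
  have "homogeneous_ideal (rmod.span B)" using B by (rule homogeneous_ideal_span)
  note h = hom_component_in[OF this] hom_component_in[OF K]
  show ?thesis
    unfolding homogeneous_ideal_iff
  proof (intro conjI ballI allI rmod.subspace_span)
    fix F e assume "F \<in> rmod.span (B \<union> K)"
    then obtain x y where "F = x + y" "x \<in> rmod.span B" "y \<in> K" unfolding rmod.span_Un KK by blast
    then have "hom_component e F = hom_component e x + hom_component e y"
      "hom_component e x \<in> rmod.span B" "hom_component e y \<in> K" by (simp_all add: hom_component_add h)
    then show "hom_component e F \<in> rmod.span (B \<union> K)" unfolding rmod.span_Un KK by blast
  qed
qed

text \<open>A multiplier on the chart is exchanged for a homogeneous one with the same value at the
  point, to which \<open>dehomogenize\<close> applies.\<close>

lemma unit_dehomogenize: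
  assumes ai: "a i = 1" and K: "homogeneous_ideal K"
  obtains u' where "peval a u' = peval a u"
    "\<And>d f. homogeneous d f \<Longrightarrow> u * f \<in> rmod.span (insert (mvar i - 1) K) \<Longrightarrow> \<exists>N. mvar i ^ N * (u' * f) \<in> K"
proof -
  obtain u' D w where u': "homogeneous D u'" "u' - u = w * (mvar i - 1)" by (rule homogenize_unit)
  have sK: "rmod.subspace K" by (rule subspace_of_homogeneous[OF K])
  have "peval a (u' - u) = 0" unfolding u'(2) by (simp add: peval_simps ai)
  then have "peval a u' = peval a u" by (simp add: peval_simps)
  moreover have "\<exists>N. mvar i ^ N * (u' * f) \<in> K"
    if f: "homogeneous d f" "u * f \<in> rmod.span (insert (mvar i - 1) K)" for d f
  proof -
    obtain c where c: "u * f - c * (mvar i - 1) \<in> K" using f(2) in_span_insert_iff[OF sK] by blast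
    have "u' = u + w * (mvar i - 1)" using u'(2) by (simp add: algebra_simps)
    then have "u' * f - (c + w * f) * (mvar i - 1) = u * f - c * (mvar i - 1)"
      by (subst \<open>u' = u + w * (mvar i - 1)\<close>) (simp add: algebra_simps)
    with c have "u' * f - (c + w * f) * (mvar i - 1) \<in> K" by simp
    from dehomogenize[OF K homogeneous_mult[OF u'(1) f(1)] this] show ?thesis .
  qed
  ultimately show thesis by (rule that)
qed

text \<open>If some bracket with \<open>mvar i\<close> is nonzero at the point, it is the multiplier
  itself. Otherwise the point is a node; the brackets generate its maximal ideal by Nakayama's
  lemma, and the minors of the field lie in that ideal. The second conclusion serves to show that
  the brackets do not all vanish on a component.\<close>

lemma local_comparison:
  fixes a :: "'v::finite \<Rightarrow> 'a::field"
  assumes pq: "p \<noteq> q" and ai: "a i = 1" and hI: "homogeneous_ideal I" and Ia: "I \<subseteq> hpt a"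
    and F: "\<And>r. r \<in> - {p, q} \<Longrightarrow> F r \<in> I" "I \<subseteq> saturation (rmod.span (F ` (- {p, q})))"
    and dF: "\<And>r. r \<in> - {p, q} \<Longrightarrow> homogeneous (d r) (F r)"
    and G: "\<And>k. homogeneous m (G k)" "\<And>f. f \<in> I \<Longrightarrow> apply_field G f \<in> I"
    and loc: "regular_at I i (hpt a) \<and> chain_dim {Q \<in> zeros I. Q \<subseteq> hpt a} \<le> enat 1 \<or> ordinary_node_at I i (hpt a)"
  defines "J \<equiv> {jac p q F (mvar k) (mvar l) | k l. True}"
  shows "\<exists>u. u \<notin> hpt a \<and> (\<forall>k l. u * wedge G (mvar k) (mvar l) \<in> rmod.span (J \<union> I))"
    and "(\<exists>k l. jac p q F (mvar k) (mvar l) \<notin> hpt a)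
      \<or> (\<forall>e x. homogeneous e x \<longrightarrow> x \<in> hpt a \<longrightarrow> (\<exists>u. u \<notin> hpt a \<and> u * x \<in> rmod.span (J \<union> I)))"
proof -
  have sI: "rmod.subspace I" by (rule subspace_of_homogeneous[OF hI])
  note m = chart_max_hpt[where a = a and i = i, OF ai]
  have nh: "u \<notin> hpt a" if "peval a u \<noteq> 0" for u using that hpt_subset by blast
  have hK: "homogeneous_ideal (rmod.span (J \<union> I))"
    by (rule homogeneous_ideal_span_Un[OF _ hI]) (use homogeneous_jac[OF pq, of d F] dF in \<open>auto simp: J_def\<close>)
  have "(\<exists>u. u \<notin> hpt a \<and> (\<forall>k l. u * wedge G (mvar k) (mvar l) \<in> rmod.span (J \<union> I))) \<and>
    ((\<exists>k l. jac p q F (mvar k) (mvar l) \<notin> hpt a)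
      \<or> (\<forall>e x. homogeneous e x \<longrightarrow> x \<in> hpt a \<longrightarrow> (\<exists>u. u \<notin> hpt a \<and> u * x \<in> rmod.span (J \<union> I))))"
  proof (cases "\<exists>k. peval a (jac p q F (mvar i) (mvar k)) \<noteq> 0")
    case True
    then obtain k where k: "peval a (jac p q F (mvar i) (mvar k)) \<noteq> 0" by blast
    have "jac p q F (mvar i) (mvar k) * f \<in> rmod.span (J \<union> I)" for f
    proof -
      have "jac p q F (mvar i) (mvar k) \<in> rmod.span (J \<union> I)" by (rule rmod.span_base) (auto simp: J_def)
      from rmod.span_scale[OF this, of f] show ?thesis by (simp add: mult.commute)
    qed
    with nh[OF k] show ?thesis by blast
  next
    case False
    then have sing: "peval a (jac p q F (mvar i) (mvar k)) = 0" for k by blast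
    have "\<not> (regular_at I i (hpt a) \<and> chain_dim {Q \<in> zeros I. Q \<subseteq> hpt a} \<le> enat 1)"
    proof
      assume R: "regular_at I i (hpt a) \<and> chain_dim {Q \<in> zeros I. Q \<subseteq> hpt a} \<le> enat 1"
      obtain v where v: "\<And>x. x \<in> chart_max i (hpt a) \<Longrightarrow> \<exists>c. x - mconst c * v \<in> jet_ideal I i (hpt a) 2"
      proof (rule regular_at_cotangent[OF conjunct1[OF R] conjunct2[OF R]])
        fix v assume "\<And>x. x \<in> chart_max i (hpt a) \<Longrightarrow> \<exists>c. x - mconst c * v \<in> jet_ideal I i (hpt a) 2"
        then show ?thesis by (rule that)
      qed
      have v': "peval a x = 0 \<Longrightarrow> \<exists>c. x - mconst c * v \<in> jet_ideal I i (hpt a) 2" for x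
        by (rule v) (simp add: m)
      from jacobian_at_regular_point[where a = a and i = i, OF pq ai sI Ia F v']
      have "peval a (jac p q F (mvar i) v) \<noteq> 0" by blast
      with exists_mvar_jac_nonzero[of a p q F "mvar i" v] sing show False by blast
    qed
    with loc have node: "ordinary_node_at I i (hpt a)" by blast
    obtain U V where UV: "peval a U = 0" "peval a V = 0" "U * V \<in> jet_ideal I i (hpt a) 3"
      and gen: "\<And>x. peval a x = 0 \<Longrightarrow> \<exists>\<alpha> \<beta>. x - (\<alpha> * U + \<beta> * V) \<in> jet_ideal I i (hpt a) 2"
      and der: "\<And>H x. (\<And>f. f \<in> I \<Longrightarrow> apply_field H f \<in> I) \<Longrightarrow> H i = 0 \<Longrightarrow> peval a x = 0 \<Longrightarrow> peval a (apply_field H x) = 0"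
    proof (rule ordinary_node_coordinates[where a = a and i = i, OF ai sI Ia node])
      fix U V
      assume "peval a U = 0" "peval a V = 0" "U * V \<in> jet_ideal I i (hpt a) 3"
        "\<And>x. peval a x = 0 \<Longrightarrow> \<exists>\<alpha> \<beta>. x - (\<alpha> * U + \<beta> * V) \<in> jet_ideal I i (hpt a) 2"
        "\<And>H x. (\<And>f. f \<in> I \<Longrightarrow> apply_field H f \<in> I) \<Longrightarrow> H i = 0 \<Longrightarrow> peval a x = 0 \<Longrightarrow> peval a (apply_field H x) = 0"
      then show ?thesis by (rule that)
    qed
    define K' where "K' = rmod.span (insert (mvar i - 1) (rmod.span (J \<union> I)))"
    have nak: "\<exists>y\<in>chart_power i (hpt a) 2. x - y \<in> K'" if x: "peval a x = 0" for x
    proof -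
      have "x \<in> rmod.span (J \<union> I \<union> {mvar i - 1} \<union> chart_power i (hpt a) 2)"
        unfolding J_def by (rule jacobian_at_node[where a = a and i = i, OF pq ai sI Ia F UV gen sing x])
      then obtain y z where yz: "x = y + z" "y \<in> rmod.span (J \<union> I \<union> {mvar i - 1})" "z \<in> chart_power i (hpt a) 2"
        unfolding rmod.span_Un[of "J \<union> I \<union> {mvar i - 1}"] rmod.span_eq_iff[THEN iffD2, OF subspace_chart_power] by blast
      have "J \<union> I \<union> {mvar i - 1} \<subseteq> K'" unfolding K'_def using rmod.span_superset[of "J \<union> I"]
        rmod.span_superset[of "insert (mvar i - 1) (rmod.span (J \<union> I))"] by blast
      then have "y \<in> K'" using yz(2) rmod.span_minimal[of _ K'] rmod.subspace_span unfolding K'_def by blast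
      with yz show ?thesis by (intro bexI[of _ z]) simp_all
    qed
    have sK': "rmod.subspace K'" unfolding K'_def by (rule rmod.subspace_span)
    obtain u where u: "peval a u = 1" "\<And>x. peval a x = 0 \<Longrightarrow> u * x \<in> K'"
    proof (rule local_nakayama[where a = a and i = i, OF ai sK' nak])
      fix u assume "peval a u = 1" "\<And>x. peval a x = 0 \<Longrightarrow> u * x \<in> K'"
      then show ?thesis by (rule that)
    qed
    obtain u' where u': "peval a u' = peval a u"
      "\<And>d f. homogeneous d f \<Longrightarrow> u * f \<in> rmod.span (insert (mvar i - 1) (rmod.span (J \<union> I)))
        \<Longrightarrow> \<exists>N. mvar i ^ N * (u' * f) \<in> rmod.span (J \<union> I)"
    proof (rule unit_dehomogenize[where a = a and i = i and u = u, OF ai hK])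
      fix u' assume "peval a u' = peval a u"
        "\<And>d f. homogeneous d f \<Longrightarrow> u * f \<in> rmod.span (insert (mvar i - 1) (rmod.span (J \<union> I)))
          \<Longrightarrow> \<exists>N. mvar i ^ N * (u' * f) \<in> rmod.span (J \<union> I)"
      then show ?thesis by (rule that)
    qed
    have un: "mvar i ^ N * u' \<notin> hpt a" for N
      by (rule nh) (simp add: peval_simps ai u'(1) u(1))
    have clear: "\<exists>N. mvar i ^ N * (u' * f) \<in> rmod.span (J \<union> I)" if "homogeneous d f" "peval a f = 0" for d f
      using u'(2)[OF that(1)] u(2)[OF that(2)] unfolding K'_def by blast
    \<comment> \<open>Correcting \<open>mvar i * G\<close> by the radial field removes the component
      at \<open>i\<close>, so \<open>H\<close> is a derivation of the chart; it still preserves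
      \<open>I\<close>.\<close>
    define H where "H k = mvar i * G k - G i * mvar k" for k
    have Hf: "apply_field H f = mvar i * apply_field G f - G i * apply_field mvar f" for f
      by (simp add: apply_field_def H_def left_diff_distrib sum_subtractf sum_distrib_left mult.assoc)
    have HI: "apply_field H f \<in> I" if "f \<in> I" for f
      unfolding Hf by (intro rmod.subspace_diff[OF sI] rmod.subspace_scale[OF sI] G(2)[OF that] radial_field_invariant[OF hI that])
    have "peval a (apply_field H (mvar k - mconst (a k))) = 0" for k
      by (rule der[OF HI]) (simp_all add: H_def mult.commute peval_simps)
    then have Ha: "peval a (H k) = 0" for k
      by (simp add: apply_field_diff apply_field_mvar) (simp add: apply_field_def)
    have Gk: "peval a (G k) = peval a (G i) * a k" for k using Ha[of k] by (simp add: H_def peval_simps ai)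
    have wa: "peval a (wedge G (mvar k) (mvar l)) = 0" for k l
      unfolding wedge_mvar by (simp add: peval_simps Gk[of k] Gk[of l])
    have "\<exists>N. mvar i ^ N * (u' * wedge G (mvar k) (mvar l)) \<in> rmod.span (J \<union> I)" for k l
      by (rule clear[OF homogeneous_wedge[OF G(1)] wa])
    then obtain N where N: "\<And>k l. mvar i ^ N k l * (u' * wedge G (mvar k) (mvar l)) \<in> rmod.span (J \<union> I)" by metis
    \<comment> \<open>The sum bounds the exponents of all pairs, so one multiplier works for every
      minor.\<close>
    define M where "M = (\<Sum>(k, l)\<in>UNIV. N k l)"
    have "(mvar i ^ M * u') * wedge G (mvar k) (mvar l) \<in> rmod.span (J \<union> I)" for k l
    proof -
      have "N k l \<le> M" unfolding M_def using member_le_sum[of "(k, l)" UNIV "\<lambda>(k, l). N k l"] by simp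
      then have "(mvar i ^ M * u') * wedge G (mvar k) (mvar l)
          = mvar i ^ (M - N k l) * (mvar i ^ N k l * (u' * wedge G (mvar k) (mvar l)))"
        by (simp add: mult.assoc[symmetric] power_add[symmetric])
      then show ?thesis using rmod.span_scale[OF N] by metis
    qed
    moreover have "\<exists>u. u \<notin> hpt a \<and> u * x \<in> rmod.span (J \<union> I)" if x: "homogeneous e x" "x \<in> hpt a" for e x
    proof -
      have "peval a x = 0" using hpt_subset[OF x(2)] .
      from clear[OF x(1) this] obtain N where "mvar i ^ N * (u' * x) \<in> rmod.span (J \<union> I)" by blast
      then have "(mvar i ^ N * u') * x \<in> rmod.span (J \<union> I)" by (simp add: mult.assoc)
      with un show ?thesis by blast
    qed
    ultimately show ?thesis using un by blast
  qed
  then show "\<exists>u. u \<notin> hpt a \<and> (\<forall>k l. u * wedge G (mvar k) (mvar l) \<in> rmod.span (J \<union> I))"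
    and "(\<exists>k l. jac p q F (mvar k) (mvar l) \<notin> hpt a)
      \<or> (\<forall>e x. homogeneous e x \<longrightarrow> x \<in> hpt a \<longrightarrow> (\<exists>u. u \<notin> hpt a \<and> u * x \<in> rmod.span (J \<union> I)))"
    by blast+
qed

section \<open>Constancy of the ratio of the two bivectors\<close>

lemma homogeneous_mvar_power: "homogeneous k (mvar i ^ k)"
  using homogeneous_power[OF homogeneous_mvar, of k i] by simp

text \<open>The ratio of \<open>\<sigma> * W\<close> and \<open>J\<close> is a rational function on the zero set of \<open>P\<close>. Multiplication by it
  preserves the space of forms of degree \<open>r + D' + e\<close> in the ideal generated by the \<open>J b\<close>. This space
  has finite dimension, so the ratio is algebraic over \<open>k\<close>, hence constant.\<close>

lemma proportionality_constant:
  fixes J W :: "'b::finite \<Rightarrow> ('v::finite, 'a::alg_closed_field) mpol"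
  assumes P: "is_prime P" "homogeneous_ideal P" and i: "mvar i \<notin> P"
    and J: "\<And>b. homogeneous (D' + e) (J b)" and W: "\<And>b. homogeneous D' (W b)"
    and prp: "\<And>b c. J c * W b - J b * W c \<in> P" and b0: "J b0 \<notin> P"
    and N: "\<And>j b. mvar j ^ N * W b \<in> rmod.span (range J \<union> P)"
    and \<sigma>: "homogeneous e \<sigma>"
  shows "\<exists>\<gamma>. \<forall>b. \<sigma> * W b - mconst \<gamma> * J b \<in> P"
proof -
  have sP: "rmod.subspace P" by (rule subspace_of_homogeneous[OF P(2)])
  note PP = rmod.span_eq_iff[THEN iffD2, OF sP]
  note add = rmod.subspace_add[OF sP] and sc = rmod.subspace_scale[OF sP] and sm = rmod.subspace_sum[OF sP]
  \<comment> \<open>From this degree on every form multiplies each \<open>W b\<close> into the ideal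
    of the \<open>J b\<close> and \<open>P\<close>; the summand \<open>1\<close> keeps the degree
    positive.\<close>
  define r where "r = N * CARD('v) + 1"
  \<comment> \<open>On the zero set of \<open>P\<close>, the sum of the \<open>c' b * J b\<close> is
    the ratio times the sum of the \<open>c b * J b\<close>.\<close>
  define nexts where "nexts c c' \<longleftrightarrow> (\<forall>b. homogeneous r (c' b)) \<and>
    \<sigma> * (\<Sum>b\<in>UNIV. c b * W b) - (\<Sum>b\<in>UNIV. c' b * J b) \<in> P" for c c' :: "'b \<Rightarrow> ('v, 'a) mpol"
  have step: "\<exists>c'. nexts c c'" if c: "\<forall>b. homogeneous r (c b)" for c
  proof -
    have "\<sigma> * c b \<in> {u. \<forall>b. u * W b \<in> rmod.span (range J \<union> P)}" for b
    proof (rule high_degree_in_ideal[where N = N and d = "e + r"])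
      show "rmod.subspace {u. \<forall>b. u * W b \<in> rmod.span (range J \<union> P)}"
        unfolding rmod.subspace_def
        by (auto simp: distrib_right mult.assoc intro: rmod.span_zero rmod.span_add rmod.span_scale)
    qed (use N homogeneous_mult[OF \<sigma> spec[OF c]] in \<open>auto simp: r_def\<close>)
    then have "\<sigma> * c b * W b \<in> rmod.span (range J \<union> P)" for b by blast
    then have "(\<Sum>b\<in>UNIV. \<sigma> * c b * W b) \<in> rmod.span (range J \<union> P)" by (rule rmod.span_sum)
    then obtain x y where xy: "(\<Sum>b\<in>UNIV. \<sigma> * c b * W b) = x + y" "x \<in> rmod.span (range J)" "y \<in> P"
      unfolding rmod.span_Un PP by blast
    obtain h where h: "x = (\<Sum>b\<in>UNIV. h b * J b)" by (rule in_span_image[OF finite_class.finite_UNIV xy(2)])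
    let ?e = "r + (D' + e)"
    have "homogeneous ?e (\<Sum>b\<in>UNIV. \<sigma> * c b * W b)"
    proof (rule homogeneous_sum)
      fix b
      have "homogeneous (e + r + D') (\<sigma> * c b * W b)" by (intro homogeneous_mult \<sigma> W spec[OF c])
      then show "homogeneous ?e (\<sigma> * c b * W b)" by (simp add: ac_simps)
    qed
    then have "(\<Sum>b\<in>UNIV. \<sigma> * c b * W b) = hom_component ?e (\<Sum>b\<in>UNIV. \<sigma> * c b * W b)"
      by (simp add: hom_component_homogeneous)
    also have "\<dots> = (\<Sum>b\<in>UNIV. hom_component r (h b) * J b) + hom_component ?e y"
      unfolding xy(1) h by (simp add: hom_component_add hom_component_sum hom_component_mult_homogeneous[OF J])
    finally have "\<sigma> * (\<Sum>b\<in>UNIV. c b * W b) - (\<Sum>b\<in>UNIV. hom_component r (h b) * J b) = hom_component ?e y"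
      by (simp add: sum_distrib_left mult.assoc)
    with hom_component_in[OF P(2) xy(3)] show ?thesis unfolding nexts_def
      by (intro exI[of _ "\<lambda>b. hom_component r (h b)"]) (simp add: homogeneous_hom_component)
  qed
  define nxt where "nxt c = (SOME c'. nexts c c')" for c
  have nxt: "\<forall>b. homogeneous r (nxt c b)" "\<sigma> * (\<Sum>b\<in>UNIV. c b * W b) - (\<Sum>b\<in>UNIV. nxt c b * J b) \<in> P"
    if "\<forall>b. homogeneous r (c b)" for c
  proof -
    have "nexts c (nxt c)" unfolding nxt_def by (rule someI_ex[OF step[OF that]])
    then show "\<forall>b. homogeneous r (nxt c b)" "\<sigma> * (\<Sum>b\<in>UNIV. c b * W b) - (\<Sum>b\<in>UNIV. nxt c b * J b) \<in> P"
      unfolding nexts_def by (rule conjunct1, rule conjunct2)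
  qed
  \<comment> \<open>The iteration starts with \<open>mvar i ^ r * J b0\<close>, which is not in
    \<open>P\<close>.\<close>
  define cs where "cs n = (nxt ^^ n) (\<lambda>b. if b = b0 then mvar i ^ r else 0)" for n
  have cs: "\<forall>b. homogeneous r (cs n b)" for n
  proof (induction n)
    case 0 show ?case by (simp add: cs_def homogeneous_mvar_power)
  next
    case (Suc n) from nxt(1)[OF this] show ?case by (simp add: cs_def)
  qed
  define w where "w n = (\<Sum>b\<in>UNIV. cs n b * J b)" for n
  let ?x = "\<sigma> * W b0" and ?y = "J b0"
  have w: "homogeneous (r + (D' + e)) (w n)" for n
    unfolding w_def by (intro homogeneous_sum homogeneous_mult J spec[OF cs])
  have w_Suc: "?y * w (Suc n) - ?x * w n \<in> P" for n
  proof -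
    have 1: "\<sigma> * (\<Sum>b\<in>UNIV. cs n b * W b) - w (Suc n) \<in> P"
      unfolding w_def using nxt(2)[OF cs, of n] by (simp add: cs_def)
    have 2: "(\<Sum>b\<in>UNIV. cs n b * (?y * W b - J b * W b0)) \<in> P" by (intro sm sc prp)
    have e1: "(\<Sum>b\<in>UNIV. cs n b * (?y * W b - J b * W b0)) = ?y * (\<Sum>b\<in>UNIV. cs n b * W b) - W b0 * w n"
      unfolding w_def by (simp add: right_diff_distrib sum_subtractf sum_distrib_left ac_simps)
    have eq: "?y * w (Suc n) - ?x * w n = \<sigma> * (\<Sum>b\<in>UNIV. cs n b * (?y * W b - J b * W b0))
        + (- ?y) * (\<sigma> * (\<Sum>b\<in>UNIV. cs n b * W b) - w (Suc n))"
      unfolding e1 by (simp add: algebra_simps)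
    show ?thesis unfolding eq by (rule add[OF sc[OF 2] sc[OF 1]])
  qed
  have w_pow: "?y ^ n * w n - ?x ^ n * w 0 \<in> P" for n
  proof (induction n)
    case 0 then show ?case by (simp add: rmod.subspace_0[OF sP])
  next
    case (Suc n)
    have eq: "?y ^ Suc n * w (Suc n) - ?x ^ Suc n * w 0
        = ?y ^ n * (?y * w (Suc n) - ?x * w n) + ?x * (?y ^ n * w n - ?x ^ n * w 0)"
      by (simp add: algebra_simps)
    show ?case unfolding eq by (rule add[OF sc[OF w_Suc] sc[OF Suc]])
  qed
  define B where "B = card {\<alpha> :: 'v \<Rightarrow>\<^sub>0 nat. mdegree \<alpha> = r + (D' + e)}"
  obtain a where a: "\<exists>n\<le>B. a n \<noteq> 0" "(\<Sum>n\<le>B. mconst (a n) * w n) = 0"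
    by (rule exists_linear_relation[OF w eq_refl[OF B_def[symmetric]]])
  \<comment> \<open>Modulo \<open>P\<close> the iterate \<open>w n\<close> is
    \<open>(?x / ?y) ^ n * w 0\<close>. Clearing denominators in the linear relation of the iterates
    gives a binary relation between \<open>?x\<close> and \<open>?y\<close>.\<close>
  have "(\<Sum>n\<le>B. mconst (a n) * ?y ^ (B - n) * (?y ^ n * w n - ?x ^ n * w 0)) \<in> P"
    by (intro sm sc w_pow)
  also have "(\<Sum>n\<le>B. mconst (a n) * ?y ^ (B - n) * (?y ^ n * w n - ?x ^ n * w 0))
      = ?y ^ B * (\<Sum>n\<le>B. mconst (a n) * w n) - w 0 * (\<Sum>n\<le>B. mconst (a n) * ?x ^ n * ?y ^ (B - n))"
  proof -
    have "mconst (a n) * ?y ^ (B - n) * (?y ^ n * w n - ?x ^ n * w 0)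
        = ?y ^ B * (mconst (a n) * w n) - w 0 * (mconst (a n) * ?x ^ n * ?y ^ (B - n))" if "n \<le> B" for n
    proof -
      have "?y ^ B = ?y ^ (B - n) * ?y ^ n" using that by (simp add: power_add[symmetric])
      then show ?thesis by (simp only: right_diff_distrib) (simp add: ac_simps)
    qed
    then show ?thesis by (simp add: sum_subtractf sum_distrib_left)
  qed
  finally have "w 0 * (\<Sum>n\<le>B. mconst (a n) * ?x ^ n * ?y ^ (B - n)) \<in> P"
    using rmod.subspace_neg[OF sP] by (fastforce simp: a(2))
  moreover have "w 0 \<notin> P"
  proof -
    have "w 0 = mvar i ^ r * J b0"
      unfolding w_def by (simp add: cs_def if_distrib[of "\<lambda>x. x * _"] cong: if_cong)
    then show ?thesis using b0 i by (simp add: prime_mult_iff[OF P(1)] prime_power_iff[OF P(1)])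
  qed
  ultimately have "(\<Sum>n\<le>B. mconst (a n) * ?x ^ n * ?y ^ (B - n)) \<in> P"
    by (simp add: prime_mult_iff[OF P(1)])
  from binary_relation_splits[OF P(1) a(1) this]
  obtain \<alpha> \<beta> where \<alpha>\<beta>: "\<alpha> \<noteq> 0 \<or> \<beta> \<noteq> 0" "mconst \<alpha> * ?x + mconst \<beta> * ?y \<in> P" by blast
  have "\<alpha> \<noteq> 0"
  proof
    assume "\<alpha> = 0"
    with \<alpha>\<beta> have "\<beta> \<noteq> 0" "mconst \<beta> * ?y \<in> P" by simp_all
    from sc[OF this(2), of "mconst (inverse \<beta>)"] this(1) have "?y \<in> P"
      by (simp add: mult.assoc[symmetric] mconst_mult[symmetric])
    with b0 show False by blast
  qed
  define \<gamma> where "\<gamma> = - (inverse \<alpha> * \<beta>)"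
  have "mconst (inverse \<alpha>) * (mconst \<alpha> * ?x + mconst \<beta> * ?y) = ?x - mconst \<gamma> * ?y"
    using \<open>\<alpha> \<noteq> 0\<close> by (simp add: distrib_left mult.assoc[symmetric] mconst_mult[symmetric] \<gamma>_def mconst_minus)
  then have l0: "?x - mconst \<gamma> * ?y \<in> P" using sc[OF \<alpha>\<beta>(2)] by metis
  have "\<sigma> * W b - mconst \<gamma> * J b \<in> P" for b
  proof -
    have eq: "?y * (\<sigma> * W b - mconst \<gamma> * J b) = \<sigma> * (?y * W b - J b * W b0) + J b * (?x - mconst \<gamma> * ?y)"
      by (simp add: algebra_simps)
    have "?y * (\<sigma> * W b - mconst \<gamma> * J b) \<in> P" unfolding eq by (rule add[OF sc[OF prp] sc[OF l0]])
    with b0 show ?thesis by (simp add: prime_mult_iff[OF P(1)])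
  qed
  then show ?thesis by blast
qed

text \<open>For positive \<open>e\<close> take \<sigma> to be
  \<open>mvar i ^ (e - 1) * mvar j\<close>. The constants obtained make every \<open>mvar j\<close>
  a scalar multiple of \<open>mvar i\<close> on the zero set, which would be a point. So
  \<open>e = 0\<close>, and \<open>1\<close> can be taken for \<sigma>.\<close>

lemma proportionality_degree:
  fixes J W :: "'b::finite \<Rightarrow> ('v::finite, 'a::alg_closed_field) mpol"
  assumes P: "P \<in> proj_points" "chain_dim (zeros P) = enat 1"
    and J: "\<And>b. homogeneous (D' + e) (J b)" and W: "\<And>b. homogeneous D' (W b)"
    and prp: "\<And>b c. J c * W b - J b * W c \<in> P" and b0: "J b0 \<notin> P" "W b0 \<notin> P"
    and N: "\<And>j b. mvar j ^ N * W b \<in> rmod.span (range J \<union> P)"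
  shows "e = 0 \<and> (\<exists>\<gamma>. \<gamma> \<noteq> 0 \<and> (\<forall>b. W b - mconst \<gamma> * J b \<in> P))"
proof -
  obtain i where pr: "is_prime P" and hP: "homogeneous_ideal P" and i: "mvar i \<notin> P"
    using P(1) unfolding proj_points_iff by blast
  have sP: "rmod.subspace P" by (rule subspace_of_homogeneous[OF hP])
  note const = proportionality_constant[where J = J and W = W, OF pr hP i J W prp b0(1) N]
  have "e = 0"
  proof (rule ccontr)
    assume e: "e \<noteq> 0"
    then obtain e' where e': "e = Suc e'" using not0_implies_Suc by blast
    have "\<exists>\<gamma>. \<forall>b. mvar i ^ e' * mvar j * W b - mconst \<gamma> * J b \<in> P" for j
      by (rule const) (use homogeneous_mult[OF homogeneous_mvar_power homogeneous_mvar] in \<open>simp add: e'\<close>)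
    then obtain \<gamma> where \<gamma>: "\<And>j. mvar i ^ e' * mvar j * W b0 - mconst (\<gamma> j) * J b0 \<in> P" by metis
    have "\<gamma> i \<noteq> 0"
    proof
      assume "\<gamma> i = 0"
      with \<gamma>[of i] have "mvar i ^ e' * mvar i * W b0 \<in> P" by simp
      with i b0 show False by (simp add: prime_mult_iff[OF pr] prime_power_iff[OF pr])
    qed
    have rel: "mconst (\<gamma> i) * mvar j - mconst (\<gamma> j) * mvar i \<in> P" for j
    proof -
      have "mvar i ^ e' * W b0 * (mconst (\<gamma> i) * mvar j - mconst (\<gamma> j) * mvar i)
          = mconst (\<gamma> i) * (mvar i ^ e' * mvar j * W b0 - mconst (\<gamma> j) * J b0)
            - mconst (\<gamma> j) * (mvar i ^ e' * mvar i * W b0 - mconst (\<gamma> i) * J b0)"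
        by (simp add: algebra_simps)
      also have "\<dots> \<in> P" by (intro rmod.subspace_diff[OF sP] rmod.subspace_scale[OF sP] \<gamma>)
      finally show ?thesis using i b0 by (simp add: prime_mult_iff[OF pr] prime_power_iff[OF pr])
    qed
    define a where "a j = inverse (\<gamma> i) * \<gamma> j" for j
    have ai: "a i = 1" using \<open>\<gamma> i \<noteq> 0\<close> by (simp add: a_def)
    have "mvar j - mconst (a j) * mvar i \<in> P" for j
    proof -
      have "mvar j - mconst (a j) * mvar i
          = mconst (inverse (\<gamma> i)) * (mconst (\<gamma> i) * mvar j - mconst (\<gamma> j) * mvar i)"
        using \<open>\<gamma> i \<noteq> 0\<close> by (simp add: right_diff_distrib mult.assoc[symmetric] mconst_mult[symmetric] a_def)
      then show ?thesis using rmod.subspace_scale[OF sP rel] by metis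
    qed
    from proj_point_eq_hpt(1)[where a = a and i = i, OF P(1) ai this] have "P = hpt a" .
    with P(2) chain_dim_hpt[where a = a and i = i, OF ai] show False by simp
  qed
  have "\<exists>\<gamma>. \<forall>b. 1 * W b - mconst \<gamma> * J b \<in> P"
    by (rule const) (simp add: \<open>e = 0\<close> homogeneous_1)
  then obtain \<gamma> where \<gamma>: "\<And>b. W b - mconst \<gamma> * J b \<in> P" by auto
  have "\<gamma> \<noteq> 0" using \<gamma>[of b0] b0(2) by auto
  with \<gamma> \<open>e = 0\<close> show ?thesis by blast
qed

text \<open>\<open>e\<close> is the excess of the degree of the Jacobian minors over that of the
  minors of the field. The local multipliers at all closed points of the component enter one ideal
  \<open>U\<close>, which therefore contains powers of the variables.\<close>

lemma generic_comparison:
  fixes I :: "('v::finite, 'a::alg_closed_field) mpol set"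
  assumes pq: "p \<noteq> q" and hI: "homogeneous_ideal I" and pd: "pure_dimension 1 I"
    and F: "\<And>r. r \<in> - {p, q} \<Longrightarrow> F r \<in> I" "I \<subseteq> saturation (rmod.span (F ` (- {p, q})))"
    and dF: "\<And>r. r \<in> - {p, q} \<Longrightarrow> homogeneous (d r) (F r)" and D: "(\<Sum>r\<in>- {p, q}. d r - 1) = m + 1 + e"
    and G: "\<And>k. homogeneous m (G k)" "\<And>f. f \<in> I \<Longrightarrow> apply_field G f \<in> I"
    and nodes: "at_most_ordinary_nodes I"
    and P: "P \<in> component_points I" and fin: "finite (zeros I \<inter> singularities G)"
  shows "e = 0 \<and> (\<exists>\<gamma>. \<gamma> \<noteq> 0 \<and>
    (\<forall>k l. wedge G (mvar k) (mvar l) - mconst \<gamma> * jac p q F (mvar k) (mvar l) \<in> P))"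
proof -
  have sI: "rmod.subspace I" by (rule subspace_of_homogeneous[OF hI])
  have Pz: "P \<in> zeros I" and Pd: "chain_dim (zeros P) = enat 1"
    using P pd unfolding component_points_def pure_dimension_def by blast+
  note PP = zerosD[OF Pz]
  define J where "J b = jac p q F (mvar (fst b)) (mvar (snd b))" for b :: "'v \<times> 'v"
  define W where "W b = wedge G (mvar (fst b)) (mvar (snd b))" for b :: "'v \<times> 'v"
  have rJ: "{jac p q F (mvar k) (mvar l) | k l. True} = range J" by (auto simp: J_def image_def)
  have hJ: "homogeneous (m + 1 + e) (J b)" for b
    using homogeneous_jac[OF pq, of d F "fst b" "snd b"] dF unfolding J_def D by simp
  have hW: "homogeneous (m + 1) (W b)" for b
    unfolding W_def by (rule homogeneous_wedge[OF G(1)])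
  have prp: "J c * W b - J b * W c \<in> P" for b c
    unfolding J_def W_def
    by (rule subsetD[OF PP(2)], rule jac_wedge_proportional[OF pq sI])
      (simp_all add: G(2) F(1) radial_field_invariant[OF hI])
  have closed: "hpt a \<in> closed_points I" if "a i = 1" "P \<subseteq> hpt a" for a i
    using hpt_in_proj_points[of a i] hpt_maximal[of a i] that PP(2) unfolding closed_points_def zeros_def by auto
  have loc: "\<exists>u. u \<notin> hpt a \<and> (\<forall>b. u * W b \<in> rmod.span (range J \<union> I))"
    "(\<exists>b. J b \<notin> hpt a)
      \<or> (\<forall>e x. homogeneous e x \<longrightarrow> x \<in> hpt a \<longrightarrow> (\<exists>u. u \<notin> hpt a \<and> u * x \<in> rmod.span (range J \<union> I)))"
    if a: "a i = 1" "P \<subseteq> hpt a" for a i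
  proof -
    have Ia: "I \<subseteq> hpt a" using a(2) PP(2) by blast
    have "mvar i \<notin> hpt a" unfolding mvar_in_hpt_iff using a(1) by simp
    then have "regular_at I i (hpt a) \<and> chain_dim {Q \<in> zeros I. Q \<subseteq> hpt a} \<le> enat 1 \<or> ordinary_node_at I i (hpt a)"
      using nodes closed[of a i, OF a] local_dimension_le_1[OF pd] unfolding at_most_ordinary_nodes_def by blast
    note lc = local_comparison[where a = a and i = i and d = d, OF pq a(1) hI Ia F dF G this, unfolded rJ]
    from lc(1) show "\<exists>u. u \<notin> hpt a \<and> (\<forall>b. u * W b \<in> rmod.span (range J \<union> I))" unfolding W_def by blast
    from lc(2) show "(\<exists>b. J b \<notin> hpt a)
      \<or> (\<forall>e x. homogeneous e x \<longrightarrow> x \<in> hpt a \<longrightarrow> (\<exists>u. u \<notin> hpt a \<and> u * x \<in> rmod.span (range J \<union> I)))"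
      by (auto simp: J_def)
  qed
  \<comment> \<open>If all brackets vanished on the component, then at a closed point every form of
    the point would, after multiplication by some \<open>u\<close> outside the point, lie in
    \<open>P\<close>. The point would equal \<open>P\<close>, against dimension one.\<close>
  obtain b0 where b0: "J b0 \<notin> P"
  proof (rule ccontr)
    assume "\<not> thesis"
    then have JP: "J b \<in> P" for b using that by blast
    obtain Q where Q: "Q \<in> closed_points I" "P \<subseteq> Q" by (rule exists_closed_point[OF Pz])
    obtain a i where a: "a i = 1" "Q = hpt a" using closed_point_hpt[OF Q(1)] by metis
    have "hpt a \<noteq> P" using chain_dim_hpt[of a i] a(1) Pd by auto
    moreover have ha: "homogeneous_ideal (hpt a)"
      using hpt_in_proj_points[of a i] a(1) unfolding proj_points_iff by simp
    ultimately obtain x0 e' where x: "hom_component e' x0 \<in> hpt a" "hom_component e' x0 \<notin> P"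
      using in_subspace_of_components[OF PP(5)] hom_component_in[OF ha] Q(2) a(2) by blast
    have JI: "rmod.span (range J \<union> I) \<subseteq> P"
      by (rule rmod.span_minimal[OF _ PP(5)]) (use JP PP(2) in auto)
    have "P \<subseteq> hpt a" using Q(2) a(2) by simp
    from loc(2)[of a i, OF a(1) this] JP this x(1) homogeneous_hom_component
    obtain u where "u \<notin> hpt a" "u * hom_component e' x0 \<in> rmod.span (range J \<union> I)" by blast
    with JI have "u \<notin> P" "u * hom_component e' x0 \<in> P" using \<open>P \<subseteq> hpt a\<close> by blast+
    with x(2) show False by (simp add: prime_mult_iff[OF PP(3)])
  qed
  \<comment> \<open>Otherwise all of the infinitely many points of the component would be
    singularities of the field.\<close>
  have "\<exists>b. W b \<notin> P"
  proof (rule ccontr)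
    assume "\<not> ?thesis"
    then have WP: "wedge G (mvar k) (mvar l) \<in> P" for k l unfolding W_def by (metis fst_conv snd_conv)
    have "zeros P \<subseteq> zeros I \<inter> singularities G"
    proof
      fix Q assume "Q \<in> zeros P"
      then have Q: "Q \<in> proj_points" "P \<subseteq> Q" unfolding zeros_def by simp_all
      have "mvar k * G l - mvar l * G k \<in> Q" for k l
        using subsetD[OF Q(2) WP[of l k]] unfolding wedge_mvar by (simp add: mult.commute)
      with Q PP(2) show "Q \<in> zeros I \<inter> singularities G" unfolding zeros_def singularities_def by auto
    qed
    then have "finite (zeros P)" using fin finite_subset by blast
    with infinite_zeros_curve[OF PP(1) Pd] show False by blast
  qed
  then obtain b1 where b1: "W b1 \<notin> P" by blast
  have W0: "W b0 \<notin> P"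
  proof
    assume "W b0 \<in> P"
    then have "J b1 * W b0 \<in> P" by (rule rmod.subspace_scale[OF PP(5)])
    then have "J b0 * W b1 \<in> P" using in_ideal_diff_iff[OF PP(5) prp[of b0 b1]] by blast
    with b0 b1 show False by (simp add: prime_mult_iff[OF PP(3)])
  qed
  define U where "U = {u. \<forall>b. u * W b \<in> rmod.span (range J \<union> P)}"
  have hK: "homogeneous_ideal (rmod.span (range J \<union> P))"
    by (rule homogeneous_ideal_span_Un[OF _ PP(4)]) (use hJ in blast)
  have hU: "homogeneous_ideal U"
    unfolding homogeneous_ideal_iff
  proof (intro conjI ballI allI)
    show "rmod.subspace U" unfolding U_def rmod.subspace_def
      by (auto simp: distrib_right mult.assoc intro: rmod.span_zero rmod.span_add rmod.span_scale)
    fix u e' assume u: "u \<in> U"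
    have "hom_component e' u * W b \<in> rmod.span (range J \<union> P)" for b
    proof -
      have "hom_component (e' + (m + 1)) (u * W b) \<in> rmod.span (range J \<union> P)"
        using hom_component_in[OF hK, of "u * W b"] u unfolding U_def by blast
      then show ?thesis by (simp add: hom_component_mult_homogeneous[OF hW])
    qed
    then show "hom_component e' u \<in> U" unfolding U_def by blast
  qed
  have PU: "P \<subseteq> U"
  proof
    fix u assume "u \<in> P"
    then have "u * W b \<in> P" for b using rmod.subspace_scale[OF PP(5), of u "W b"] by (simp add: mult.commute)
    then show "u \<in> U" unfolding U_def using rmod.span_superset[of "range J \<union> P"] by blast
  qed
  \<comment> \<open>A zero specialises to a rational closed point, which lies on the component
    because \<open>U\<close> contains \<open>P\<close>. The local multiplier there belongs to
    \<open>U\<close> but not to the point.\<close>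
  have "zeros U = {}"
  proof (rule ccontr)
    assume "zeros U \<noteq> {}"
    then obtain Q where "Q \<in> zeros U" by blast
    then obtain R where R: "R \<in> closed_points U" by (rule exists_closed_point)
    obtain a i where a: "a i = 1" "R = hpt a" using closed_point_hpt[OF R] by metis
    have Ra: "U \<subseteq> hpt a" using R a(2) unfolding closed_points_def zeros_def by blast
    obtain u where u: "u \<notin> hpt a" "\<And>b. u * W b \<in> rmod.span (range J \<union> I)"
      using loc(1)[of a i, OF a(1)] PU Ra by blast
    have "rmod.span (range J \<union> I) \<subseteq> rmod.span (range J \<union> P)" by (rule rmod.span_mono) (use PP(2) in blast)
    with u(2) have "u \<in> U" unfolding U_def by blast
    with u(1) Ra show False by blast
  qed
  then obtain N where N: "\<And>j. mvar j ^ N \<in> U" using zeros_empty_imp_powers[OF hU] by blast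
  then have N': "mvar j ^ N * W b \<in> rmod.span (range J \<union> P)" for j b unfolding U_def by blast
  have "e = 0 \<and> (\<exists>\<gamma>. \<gamma> \<noteq> 0 \<and> (\<forall>b. W b - mconst \<gamma> * J b \<in> P))"
    by (rule proportionality_degree[where J = J and W = W, OF PP(1) Pd hJ hW prp b0 W0 N'])
  then show ?thesis unfolding W_def J_def by (metis fst_conv snd_conv)
qed

section \<open>Complete intersection curves\<close>

text \<open>A polynomial whose product with \<open>mvar i\<close> is outside a radical ideal is
  avoided by some point; saturation then disposes of the factor \<open>mvar i\<close>.\<close>

lemma in_ideal_of_vanishing:
  assumes I: "closed_subscheme I" "reduced I" and F: "\<And>P. P \<in> zeros I \<Longrightarrow> F \<in> P"
  shows "F \<in> I"
proof -
  have hI: "homogeneous_ideal I" and sat: "saturation I = I" using I(1) unfolding closed_subscheme_def by simp_all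
  have "mvar i * F \<in> I" for i
  proof (rule ccontr)
    assume "mvar i * F \<notin> I"
    then have "(mvar i * F) ^ N \<notin> I" for N using I(2) unfolding reduced_def by blast
    from exists_zero_avoiding[OF hI this] obtain P where "P \<in> zeros I" "F \<notin> P" by blast
    with F show False by blast
  qed
  then have "mvar i ^ 1 * F \<in> I" for i by simp
  then have "F \<in> saturation I" unfolding saturation_def by blast
  with sat show ?thesis by simp
qed

text \<open>If a product of forms lies in \<open>I\<close>, the zero sets of the factors cover that
  of \<open>I\<close>. Irreducibility selects one factor, which lies in \<open>I\<close> because
  \<open>I\<close> is radical and saturated.\<close>

lemma is_prime_of_irreducible:
  assumes I: "closed_subscheme I" "reduced I" and irr: "irreducible_scheme I"
  shows "is_prime I"
proof -
  have hI: "homogeneous_ideal I" using I(1) unfolding closed_subscheme_def by simp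
  have sI: "rmod.subspace I" by (rule subspace_of_homogeneous[OF hI])
  obtain Q where Q: "Q \<in> zeros I" using irr unfolding irreducible_scheme_def by blast
  have "1 \<notin> I" using zerosD(2,3)[OF Q] unfolding is_prime_def by blast
  have "F \<in> I \<or> G \<in> I" if hom: "homogeneous e F" "homogeneous f G" and FG: "F * G \<in> I" for e f F G
  proof -
    let ?J = "\<lambda>x. rmod.span (insert x I)"
    have sub: "?J x \<subseteq> P \<longleftrightarrow> x \<in> P" if P: "P \<in> zeros I" for x P
    proof -
      have "x \<in> P \<Longrightarrow> ?J x \<subseteq> P" using zerosD(2,5)[OF P] by (intro rmod.span_minimal) auto
      moreover have "x \<in> ?J x" by (rule rmod.span_base) simp
      ultimately show ?thesis by blast
    qed
    have zJ: "zeros (?J x) = {P \<in> zeros I. x \<in> P}" for x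
    proof -
      have "I \<subseteq> ?J x" using rmod.span_superset[of "insert x I"] by blast
      then have "P \<in> zeros (?J x) \<Longrightarrow> P \<in> zeros I" for P unfolding zeros_def by blast
      with sub show ?thesis unfolding zeros_def by blast
    qed
    have "zeros I = zeros (?J F) \<union> zeros (?J G)"
    proof -
      have "F \<in> P \<or> G \<in> P" if P: "P \<in> zeros I" for P
        using zerosD(2)[OF P] FG prime_mult_iff[OF zerosD(3)[OF P]] by blast
      then show ?thesis unfolding zJ by blast
    qed
    moreover have "homogeneous_ideal (?J F)" "homogeneous_ideal (?J G)"
      by (rule homogeneous_ideal_span_insert[OF hI hom(1)], rule homogeneous_ideal_span_insert[OF hI hom(2)])
    ultimately have "zeros I = zeros (?J F) \<or> zeros I = zeros (?J G)"
      using irr unfolding irreducible_scheme_def by blast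
    then have "(\<forall>P\<in>zeros I. F \<in> P) \<or> (\<forall>P\<in>zeros I. G \<in> P)" unfolding zJ by blast
    then show ?thesis using in_ideal_of_vanishing[OF I, of F] in_ideal_of_vanishing[OF I, of G] by blast
  qed
  from is_prime_hpart[OF sI \<open>1 \<notin> I\<close> this] show ?thesis unfolding hpart_homogeneous_ideal[OF hI] .
qed

text \<open>The first linear form is a variable \<open>t\<^sub>i\<close>: a power of \<open>t\<^sub>i\<close> multiplies the saturation into the
  ideal of the given forms, and \<open>t\<^sub>i\<close> is a nonzerodivisor modulo that ideal.\<close>

lemma complete_intersection_curve_parameters:
  fixes I :: "('v::finite, 'a::alg_closed_field) mpol set" and p q :: 'v
  assumes pq: "p \<noteq> q" and P: "I \<in> proj_points" "chain_dim (zeros I) = enat 1"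
    and F: "\<And>r. r \<in> - {p, q} \<Longrightarrow> homogeneous (d r) (F r)" "\<And>r. r \<in> - {p, q} \<Longrightarrow> 0 < d r"
    and sat: "I = saturation (rmod.span (F ` (- {p, q})))"
  obtains x y where "homogeneous 1 x" "homogeneous 1 y"
    "zeros (rmod.span (range (F(p := x, q := y)))) = {}" "I \<subseteq> rmod.span (F ` (- {p, q}))"
proof -
  obtain i where pr: "is_prime I" and hI: "homogeneous_ideal I" and i: "mvar i \<notin> I"
    using P(1) unfolding proj_points_iff by blast
  \<comment> \<open>By dimension one the hyperplane \<open>mvar i = 0\<close> meets the curve only
    in closed points. They are finitely many, so a second linear form avoids them.\<close>
  define K where "K = rmod.span (insert (mvar i) I)"
  have hK: "homogeneous_ideal K" unfolding K_def by (rule homogeneous_ideal_span_insert[OF hI homogeneous_mvar])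
  have K: "I \<subseteq> K" "mvar i \<in> K" unfolding K_def using rmod.span_superset[of "insert (mvar i) I"] by blast+
  have rat: "\<exists>a. a j = 1 \<and> Q = hpt a" if Q: "Q \<in> zeros K" and j: "mvar j \<notin> Q" for Q j
  proof (rule closed_point_rational[OF _ j])
    have "Q \<in> zeros I" "I \<subset> Q" using zerosD(1,2)[OF Q] K i unfolding zeros_def by blast+
    with Q show "Q \<in> closed_points K" unfolding closed_points_def using no_triple_chain[OF P(2) _ _ _ _ P(1)] by blast
  qed
  have "finite (zeros K)" by (rule finite_zeros_of_rational[OF hK rat])
  moreover have "\<exists>a j. a j = 1 \<and> Q = hpt a" if Q: "Q \<in> zeros K" for Q
    using zerosD(1)[OF Q] rat[OF Q] unfolding proj_points_iff by metis
  ultimately obtain c where c: "\<forall>Q\<in>zeros K. lin c \<notin> Q" using linear_form_avoiding_zeros by blast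
  define z where "z = F(p := mvar i, q := lin c)"
  have zr: "z r = F r" if "r \<in> - {p, q}" for r using that by (simp add: z_def)
  then have zF: "z ` (- {p, q}) = F ` (- {p, q})" by (intro image_cong) auto
  have empty: "zeros (rmod.span (range z)) = {}"
  proof (rule ccontr)
    assume "zeros (rmod.span (range z)) \<noteq> {}"
    then obtain Q where Q: "Q \<in> zeros (rmod.span (range z))" by blast
    note QQ = zerosD[OF Q]
    have zQ: "z r \<in> Q" for r using QQ(2) rmod.span_base[of "z r" "range z"] by blast
    have FQ: "rmod.span (F ` (- {p, q})) \<subseteq> Q"
      unfolding zF[symmetric] by (rule rmod.span_minimal[OF _ QQ(5)]) (use zQ in blast)
    obtain j where j: "mvar j \<notin> Q" using QQ(1) unfolding proj_points_iff by blast
    have "I \<subseteq> Q"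
    proof
      fix f assume "f \<in> I"
      then obtain N where "mvar j ^ N * f \<in> rmod.span (F ` (- {p, q}))"
        unfolding sat saturation_def by blast
      with FQ j show "f \<in> Q" by (auto simp: prime_mult_iff[OF QQ(3)] prime_power_iff[OF QQ(3)])
    qed
    moreover have "mvar i \<in> Q" "lin c \<in> Q" using zQ[of p] zQ[of q] pq by (simp_all add: z_def)
    ultimately have "K \<subseteq> Q" unfolding K_def by (intro rmod.span_minimal[OF _ QQ(5)]) auto
    with c QQ(1) \<open>lin c \<in> Q\<close> show False unfolding zeros_def by blast
  qed
  have "\<exists>e. 0 < e \<and> homogeneous e (z r)" for r
    using F[of r] homogeneous_mvar[of i] homogeneous_lin[of c] zero_less_one by (cases "r \<in> {p, q}") (auto simp: z_def)
  then have "positive_forms z" unfolding positive_forms_def by blast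
  from system_of_parameters_regular[OF this empty] have reg: "regular_system z" .
  have "f \<in> rmod.span (F ` (- {p, q}))" if f: "f \<in> I" for f
  proof -
    obtain N where N: "mvar i ^ N * f \<in> rmod.span (F ` (- {p, q}))"
      using f unfolding sat saturation_def by blast
    have "mvar i ^ N * g \<in> rmod.span (z ` (- {p, q})) \<Longrightarrow> g \<in> rmod.span (z ` (- {p, q}))" for g
    proof (induction N)
      case (Suc N)
      have "z p * (mvar i ^ N * g) \<in> rmod.span (z ` (- {p, q}))"
        using Suc.prems pq by (simp add: z_def mult.assoc)
      from regular_systemD[OF reg _ this] have "mvar i ^ N * g \<in> rmod.span (z ` (- {p, q}))" by simp
      then show ?case by (rule Suc.IH)
    qed simp
    from this[of f] N show ?thesis unfolding zF .
  qed
  then have "I \<subseteq> rmod.span (F ` (- {p, q}))" by blast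
  with homogeneous_mvar homogeneous_lin empty[unfolded z_def] show thesis by (rule that)
qed

section \<open>The case of equality\<close>

lemma wedge_expand:
  "wedge G a b = (\<Sum>k\<in>UNIV. \<Sum>l\<in>UNIV. partial k a * partial l b * wedge G (mvar k) (mvar l))"
proof -
  have prod: "apply_field Y a * apply_field Z b = (\<Sum>k\<in>UNIV. \<Sum>l\<in>UNIV. partial k a * partial l b * (Y k * Z l))" for Y Z
    unfolding apply_field_def sum_product by (simp add: ac_simps)
  have "wedge G a b = apply_field G a * apply_field mvar b - apply_field mvar a * apply_field G b"
    unfolding wedge_def by (simp add: mult.commute)
  then show ?thesis
    unfolding prod wedge_mvar by (simp add: right_diff_distrib sum_subtractf ac_simps)
qed

lemma jac_expand:
  assumes "p \<noteq> q"
  shows "jac p q F a b = (\<Sum>k\<in>UNIV. \<Sum>l\<in>UNIV. partial k a * partial l b * jac p q F (mvar k) (mvar l))"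
proof -
  have "jac p q F a b = (\<Sum>k\<in>UNIV. partial k a * (\<Sum>l\<in>UNIV. partial l b * jac p q F (mvar k) (mvar l)))"
    by (subst jac_left[OF assms]) (subst jac_right, rule refl)
  then show ?thesis by (simp add: sum_distrib_left mult.assoc)
qed

lemma jac_eq_det:
  assumes "p \<noteq> q"
  shows "jac p q F a b = det (\<chi> r s. partial s ((F(p := a, q := b)) r))"
proof -
  have eq: "(\<lambda>r. grad (F r))(p := grad a, q := grad b) = (\<lambda>r. grad ((F(p := a, q := b)) r))" by auto
  show ?thesis unfolding jac_def rowdet_def eq unfolding grad_def ..
qed

lemma of_nat_degree_nonzero:
  assumes "\<not> CHAR('a::semiring_1) dvd (\<Prod>j\<in>A. d j)" "finite A" "j \<in> A"
  shows "of_nat (d j) \<noteq> (0 :: 'a)"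
  using assms dvd_trans[OF _ dvd_prodI[OF assms(2,3)]] unfolding of_nat_eq_0_iff_char_dvd by blast

text \<open>Modulo the system of parameters \<open>F\<close>, \<open>x\<close>, \<open>y\<close> the wedge vanishes, but the Jacobian
  determinant does not.\<close>

lemma wedge_not_proportional:
  fixes I :: "('v::finite, 'a::alg_closed_field) mpol set" and p q :: 'v
  assumes pq: "p \<noteq> q" and P: "I \<in> proj_points" "chain_dim (zeros I) = enat 1"
    and F: "\<And>r. r \<in> - {p, q} \<Longrightarrow> homogeneous (d r) (F r)" "\<And>r. r \<in> - {p, q} \<Longrightarrow> of_nat (d r) \<noteq> (0::'a)"
    and sat: "I = saturation (rmod.span (F ` (- {p, q})))" and "\<gamma> \<noteq> 0"
  shows "\<exists>k l. wedge G (mvar k) (mvar l) - mconst \<gamma> * jac p q F (mvar k) (mvar l) \<notin> I"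
proof (rule ccontr)
  assume "\<not> ?thesis"
  then have prp: "wedge G (mvar k) (mvar l) - mconst \<gamma> * jac p q F (mvar k) (mvar l) \<in> I" for k l by blast
  have sI: "rmod.subspace I" using P(1) unfolding proj_points_iff is_prime_def by blast
  have pos: "0 < d r" if "r \<in> - {p, q}" for r using F(2)[OF that] by (cases "d r") auto
  obtain x y where xy: "homogeneous 1 x" "homogeneous 1 y"
    and z: "zeros (rmod.span (range (F(p := x, q := y)))) = {}" and I: "I \<subseteq> rmod.span (F ` (- {p, q}))"
    by (rule complete_intersection_curve_parameters[where F = F and d = d, OF pq P F(1) pos sat])
  \<comment> \<open>The slots \<open>p\<close> and \<open>q\<close> take the linear forms; their
    degree \<open>1\<close> is nonzero in every field.\<close>
  let ?z = "F(p := x, q := y)" and ?d = "d(p := 1, q := 1)"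
  let ?K = "rmod.span (range ?z)"
  have K: "u * x \<in> ?K" "u * y \<in> ?K" for u
    using pq rmod.span_scale[OF rmod.span_base[OF rangeI[of ?z p]], of u]
      rmod.span_scale[OF rmod.span_base[OF rangeI[of ?z q]], of u] by simp_all
  have "F ` (- {p, q}) \<subseteq> range ?z"
  proof
    fix f assume "f \<in> F ` (- {p, q})"
    then obtain r where "r \<noteq> p" "r \<noteq> q" "f = F r" by blast
    then have "f = ?z r" by simp
    then show "f \<in> range ?z" by blast
  qed
  then have IK: "I \<subseteq> ?K" using I rmod.span_mono by blast
  have "wedge G x y - mconst \<gamma> * jac p q F x y
      = (\<Sum>k\<in>UNIV. \<Sum>l\<in>UNIV. partial k x * partial l y *
          (wedge G (mvar k) (mvar l) - mconst \<gamma> * jac p q F (mvar k) (mvar l)))"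
    unfolding wedge_expand[of G x y] jac_expand[OF pq, of F x y]
    by (simp add: right_diff_distrib sum_subtractf sum_distrib_left ac_simps)
  also have "\<dots> \<in> I" by (intro rmod.subspace_sum[OF sI] rmod.subspace_scale[OF sI] prp)
  finally have w1: "wedge G x y - mconst \<gamma> * jac p q F x y \<in> ?K" using IK by blast
  \<comment> \<open>By Euler's formula the radial field fixes linear forms, so the wedge is a
    combination of \<open>x\<close> and \<open>y\<close>.\<close>
  have w2: "wedge G x y \<in> ?K"
  proof -
    have xy': "apply_field mvar x = x" "apply_field mvar y = y"
      using euler[OF xy(1)] euler[OF xy(2)] unfolding apply_field_def by simp_all
    show ?thesis unfolding wedge_def xy' by (rule rmod.span_diff[OF K(2) K(1)])
  qed
  have "wedge G x y - (wedge G x y - mconst \<gamma> * jac p q F x y) \<in> ?K" by (rule rmod.span_diff[OF w2 w1])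
  then have "mconst \<gamma> * jac p q F x y \<in> ?K" by (simp only: diff_diff_eq2 add_diff_cancel_left')
  then have "mconst (inverse \<gamma>) * (mconst \<gamma> * jac p q F x y) \<in> ?K" by (rule rmod.span_scale)
  then have "jac p q F x y \<in> ?K"
    unfolding mult.assoc[symmetric] mconst_mult[symmetric] left_inverse[OF \<open>\<gamma> \<noteq> 0\<close>] mconst_1 mult_1_left .
  moreover have "det (\<chi> r s. partial s (?z r)) \<notin> ?K"
  proof (rule jacobian_notin[where d = ?d])
    show "homogeneous (?d r) (?z r)" for r
      using F(1)[of r] xy by (cases "r = q"; cases "r = p") auto
    show "of_nat (?d r) \<noteq> (0::'a)" for r
      using F(2)[of r] by (cases "r = q"; cases "r = p") auto
  qed (rule z)
  ultimately show False unfolding jac_eq_det[OF pq] by blast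
qed

theorem corollary2:
  fixes I :: "('v::finite, 'a::alg_closed_field) mpol set"
    and G :: "'v \<Rightarrow> ('v, 'a) mpol"
    and n m :: nat
    and d :: "nat \<Rightarrow> nat"
  assumes "CARD('v) = n + 1"
    and "curve I"
    and "reduced I"
    and "at_most_ordinary_nodes I"
    and "complete_intersection {1..<n} d I"
    and "vector_field m G"
    and "left_invariant I G"
    and "finite (zeros I \<inter> singularities G)"
  shows "(\<Sum>j = 1..<n. d j) \<le> m + n \<and>
    ((\<Sum>j = 1..<n. d j) = m + n \<longrightarrow>
       \<not> irreducible_scheme I \<or> CHAR('a) dvd (\<Prod>j = 1..<n. d j))"
proof -
  have cI: "closed_subscheme I" and hI: "homogeneous_ideal I" and pd: "pure_dimension 1 I"
    using assms(2) unfolding curve_def closed_subscheme_def by simp_all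
  obtain e0 F where e0: "e0 + card {1..<n} + 1 = CARD('v)" "pure_dimension e0 I"
    and F: "\<And>j. j \<in> {1..<n} \<Longrightarrow> 0 < d j \<and> homogeneous (d j) (F j)"
    and sat: "I = saturation (rmod.span (F ` {1..<n}))"
    using assms(5) unfolding complete_intersection_def hypersurface_form_def Idl_eq_span by blast
  obtain Q where Q: "Q \<in> zeros I" using pd unfolding pure_dimension_def by blast
  obtain P where P: "P \<in> component_points I" by (rule exists_component_point[OF Q])
  \<comment> \<open>Comparing the two dimensions rules out \<open>n = 0\<close>, where
    \<open>{1..<n}\<close> is empty just as for \<open>n = 1\<close>.\<close>
  have "enat e0 = enat 1" using e0(2) pd P unfolding pure_dimension_def by metis
  with e0(1) assms(1) have n: "1 \<le> n" by simp
  with assms(1) have "card (UNIV :: 'v set) \<noteq> 1" by simp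
  \<comment> \<open>Any two distinct indices serve as free slots; the \<open>n - 1\<close> equations
    are moved to the other indices by \<beta>.\<close>
  then obtain p q :: 'v where pq: "p \<noteq> q" by (metis UNIV_eq_I card_1_singletonE is_singletonI is_singleton_altdef singletonI)
  have "card (- {p, q}) = card {1..<n}"
    using pq assms(1) by (simp add: Compl_eq_Diff_UNIV card_Diff_subset)
  then obtain \<beta> where \<beta>: "bij_betw \<beta> (- {p, q}) {1..<n}"
    using finite_same_card_bij[of "- {p, q}" "{1..<n}"] by auto
  define F' d' where "F' = F \<circ> \<beta>" and "d' = d \<circ> \<beta>"
  have \<beta>r: "\<beta> r \<in> {1..<n}" if "r \<in> - {p, q}" for r using bij_betwE[OF \<beta>] that by blast
  have F': "homogeneous (d' r) (F' r)" if "r \<in> - {p, q}" for r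
    using F[OF \<beta>r[OF that]] by (simp add: F'_def d'_def)
  have "F' ` (- {p, q}) = F ` {1..<n}" unfolding F'_def image_comp[symmetric] bij_betw_imp_surj_on[OF \<beta>] ..
  with sat have sat': "I = saturation (rmod.span (F' ` (- {p, q})))" by simp
  have FI: "F' r \<in> I" if "r \<in> - {p, q}" for r
  proof -
    have "mvar i ^ 0 * F' r \<in> rmod.span (F' ` (- {p, q}))" for i
      using rmod.span_base[OF imageI[OF that, of F']] by simp
    then show ?thesis unfolding sat' saturation_def by blast
  qed
  \<comment> \<open>The total of the lowered degrees differs from that of the \<open>d j\<close> by
    \<open>n - 1\<close>; since all \<open>d j\<close> are positive, no subtraction
    truncates.\<close>
  have "(\<Sum>r\<in>- {p, q}. d' r - 1) = (\<Sum>j = 1..<n. d j - 1)"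
    unfolding d'_def comp_def by (rule sum.reindex_bij_betw[OF \<beta>])
  moreover have "(\<Sum>j = 1..<n. d j) = (\<Sum>j = 1..<n. (d j - 1) + 1)"
    using F by (intro sum.cong) fastforce+
  ultimately have D: "(\<Sum>r\<in>- {p, q}. d' r - 1) + (n - 1) = (\<Sum>j = 1..<n. d j)"
    unfolding sum.distrib by simp
  have G: "homogeneous m (G k)" "f \<in> I \<Longrightarrow> apply_field G f \<in> I" for k f
    using assms(6,7) unfolding vector_field_def left_invariant_def by blast+
  have compare: "e = 0 \<and> (\<exists>\<gamma>. \<gamma> \<noteq> 0 \<and>
      (\<forall>k l. wedge G (mvar k) (mvar l) - mconst \<gamma> * jac p q F' (mvar k) (mvar l) \<in> P'))"
    if "(\<Sum>r\<in>- {p, q}. d' r - 1) = m + 1 + e" "P' \<in> component_points I" for e P'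
    by (rule generic_comparison[where d = d' and m = m, OF pq hI pd FI eq_refl[OF sat'] F' that(1) G assms(4) that(2) assms(8)])
  show ?thesis
  proof (intro conjI impI)
    show "(\<Sum>j = 1..<n. d j) \<le> m + n"
    proof (rule ccontr)
      assume "\<not> ?thesis"
      \<comment> \<open>As \<open>m + n - (n - 1) = m + 1\<close>, the excess of the degree sum over
        \<open>m + n\<close> is the gap \<open>e\<close> between the two bivectors.\<close>
      then have "(\<Sum>r\<in>- {p, q}. d' r - 1) = m + 1 + ((\<Sum>j = 1..<n. d j) - (m + n))" using D n by simp
      from compare[OF this P] have "(\<Sum>j = 1..<n. d j) - (m + n) = 0" by blast
      with \<open>\<not> ?thesis\<close> show False by simp
    qed
    assume eq: "(\<Sum>j = 1..<n. d j) = m + n"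
    show "\<not> irreducible_scheme I \<or> CHAR('a) dvd (\<Prod>j = 1..<n. d j)"
    proof (rule ccontr)
      assume "\<not> ?thesis"
      then have irr: "irreducible_scheme I" and chr: "\<not> CHAR('a) dvd (\<Prod>j = 1..<n. d j)" by blast+
      have "is_prime I" by (rule is_prime_of_irreducible[OF cI assms(3) irr])
      then have Ip: "I \<in> proj_points"
        using hI zerosD(1,2)[OF Q] unfolding proj_points_iff by blast
      then have Ic: "I \<in> component_points I" unfolding component_points_def zeros_def by blast
      have I1: "chain_dim (zeros I) = enat 1" using pd Ic unfolding pure_dimension_def by blast
      have "(\<Sum>r\<in>- {p, q}. d' r - 1) = m + 1 + 0" using D n eq by simp
      from compare[OF this Ic] obtain \<gamma> where \<gamma>: "\<gamma> \<noteq> 0"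
        "\<And>k l. wedge G (mvar k) (mvar l) - mconst \<gamma> * jac p q F' (mvar k) (mvar l) \<in> I" by blast
      have "of_nat (d' r) \<noteq> (0::'a)" if "r \<in> - {p, q}" for r
        using of_nat_degree_nonzero[OF chr _ \<beta>r[OF that]] by (simp add: d'_def)
      from wedge_not_proportional[where F = F' and d = d' and G = G, OF pq Ip I1 F' this sat' \<gamma>(1)] \<gamma>(2)
      show False by blast
    qed
  qed
qed

end
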